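(* Let $G_w$ be a weighted bicyclic graph with no pendant vertices. Then $i_+(G_w)=2$ if and only if $G_w$ is (isomorphic as a weighted graph to) one of the following: (1) $\infty(3,1,3)_w$, with arbitrary positive weights; (2) $\infty(3,2,3)_w$ with $4a_1a_3b_1b_3-a_2b_2c_1^2\ge 0$; (3) $\infty(3,1,4)_w$ with $b_1b_3=b_2b_4$; (4) $\infty(4,1,4)_w$ with $a_1a_3=a_2a_4$ and $b_1b_3=b_2b_4$; (5) $\theta(1,1,1)_w$ with $a_2b_1\ne a_1b_2$ or $a_2c_1\ne a_1c_2$; (6) $\theta(1,0,1)_w$ with $a_2c_1\ne a_1c_2$; (7) $\theta(1,0,2)_w$ with $b_1c_2\ge c_1c_3$; (8) $\theta(2,0,2)_w$ with $a_2b_1c_2=a_1a_3c_2+a_2c_1c_3$.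
   Context: A weighted graph is a simple graph with a positive weight on each edge; its adjacency matrix has entry $w(xy)$ if $xy$ is an edge and $0$ otherwise, and $i_+(G_w)$ is the number of positive eigenvalues of this matrix, with multiplicity. A bicyclic graph is a connected simple graph with $|E|=|V|+1$. For $p,q\ge3$, $l\ge1$, $\infty(p,l,q)_w$ is the weighted graph formed by a cycle $v x_1\cdots x_{p-1} v$, a cycle $u y_1\cdots y_{q-1}u$ (vertex-disjoint apart from $u=v$ when $l=1$) and a path $v=v_1v_2\cdots v_l=u$, with weights $w(vx_1)=a_1$, $w(x_ix_{i+1})=a_{i+1}$ ($1\le i\le p-2$), $w(x_{p-1}v)=a_p$; $w(uy_1)=b_1$, $w(y_jy_{j+1})=b_{j+1}$, $w(y_{q-1}u)=b_q$; and $w(v_iv_{i+1})=c_i$ ($1\le i\le l-1$). For integers $p,l,q\ge0$ with at most one equal to $0$, $\theta(p,l,q)_w$ consists of two vertices $u,v$ joined by three internally disjoint paths $ux_1\cdots x_pv$, $uy_1\cdots y_lv$, $uz_1\cdots z_qv$ (a path with no internal vertex being the edge $uv$), with edge weights read from $u$ to $v$ equal to $a_1,\dots,a_{p+1}$, $b_1,\dots,b_{l+1}$ and $c_1,\dots,c_{q+1}$ respectively. (So in $\theta(1,0,2)_w$, $b_1=w(uv)$ and the third path $uz_1z_2v$ has weights $c_1,c_2,c_3$.) *)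

theory Defs
  imports "Jordan_Normal_Form.Char_Poly" "HOL-Combinatorics.List_Permutation"
begin

section \<open>Weighted graphs\<close>

record 'a wgraph =
  verts :: "'a set"
  edges :: "'a set set"
  wt :: "'a set \<Rightarrow> real"

text \<open>A finite simple graph with a positive weight on each edge. The value of
  \<^term>\<open>wt G\<close> outside \<^term>\<open>edges G\<close> is irrelevant.\<close>

definition weighted_graph :: "'a wgraph \<Rightarrow> bool" where
  "weighted_graph G \<longleftrightarrow> finite (verts G) \<and>
     (\<forall>e\<in>edges G. e \<subseteq> verts G \<and> card e = 2 \<and> 0 < wt G e)"

definition connected_graph :: "'a wgraph \<Rightarrow> bool" where
  "connected_graph G \<longleftrightarrow> verts G \<noteq> {} \<and>
     (\<forall>x\<in>verts G. \<forall>y\<in>verts G. (x, y) \<in> {(s, t). {s, t} \<in> edges G}\<^sup>*)"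

definition bicyclic :: "'a wgraph \<Rightarrow> bool" where
  "bicyclic G \<longleftrightarrow> weighted_graph G \<and> connected_graph G \<and>
     card (edges G) = card (verts G) + 1"

definition degree_in :: "'a wgraph \<Rightarrow> 'a \<Rightarrow> nat" where
  "degree_in G x = card {e \<in> edges G. x \<in> e}"

definition pendant :: "'a wgraph \<Rightarrow> 'a \<Rightarrow> bool" where
  "pendant G x \<longleftrightarrow> x \<in> verts G \<and> degree_in G x = 1"

definition wgraph_iso :: "'a wgraph \<Rightarrow> 'b wgraph \<Rightarrow> bool" where
  "wgraph_iso G H \<longleftrightarrow> (\<exists>f. bij_betw f (verts G) (verts H) \<and>
     (\<forall>x\<in>verts G. \<forall>y\<in>verts G.
        ({x, y} \<in> edges G \<longleftrightarrow> {f x, f y} \<in> edges H) \<and>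
        ({x, y} \<in> edges G \<longrightarrow> wt G {x, y} = wt H {f x, f y})))"


section \<open>The number of positive eigenvalues\<close>

definition adj_entry :: "'a wgraph \<Rightarrow> 'a \<Rightarrow> 'a \<Rightarrow> real" where
  "adj_entry G x y = (if {x, y} \<in> edges G then wt G {x, y} else 0)"

definition adj_mat :: "'a wgraph \<Rightarrow> 'a list \<Rightarrow> real mat" where
  "adj_mat G xs = mat (length xs) (length xs) (\<lambda>(i, j). adj_entry G (xs ! i) (xs ! j))"

definition num_pos_eigenvalues :: "real mat \<Rightarrow> nat" where
  "num_pos_eigenvalues A = (\<Sum>x | eigenvalue A x \<and> 0 < x. Polynomial.order x (char_poly A))"

text \<open>The ordering of the vertices is immaterial; see \<open>i_plus_eq\<close> below.\<close>

definition i_plus :: "'a wgraph \<Rightarrow> nat" where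
  "i_plus G = num_pos_eigenvalues (adj_mat G (SOME xs. distinct xs \<and> set xs = verts G))"

lemma adj_mat_carrier [simp]: "adj_mat G xs \<in> carrier_mat (length xs) (length xs)"
  by (simp add: adj_mat_def)

lemma char_poly_permute:
  fixes A :: "'a :: comm_ring_1 mat"
  assumes A: "A \<in> carrier_mat n n" and p: "p permutes {0..<n}"
  shows "char_poly (mat n n (\<lambda>(i, j). A $$ (p i, p j))) = char_poly A"
proof -
  let ?M = "char_poly_matrix A"
  let ?R = "mat n n (\<lambda>(i, j). ?M $$ (p i, j))"
  have M: "?M \<in> carrier_mat n n" using A by simp
  have pn: "p i < n" if "i < n" for i
    using permutes_in_image[OF p, of i] that by simp
  have pinj: "p i = p j \<longleftrightarrow> i = j" for i j
    using permutes_inj[OF p] by (auto dest: injD)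
  have "char_poly_matrix (mat n n (\<lambda>(i, j). A $$ (p i, p j)))
      = mat n n (\<lambda>(i, j). ?M $$ (p i, p j))"
    using A pn pinj by (intro eq_matI) (auto simp: char_poly_matrix_def)
  also have "\<dots> = (mat n n (\<lambda>(i, j). ?R\<^sup>T $$ (p i, j)))\<^sup>T"
    using pn by (intro eq_matI) auto
  finally have "char_poly (mat n n (\<lambda>(i, j). A $$ (p i, p j)))
      = det (mat n n (\<lambda>(i, j). ?R\<^sup>T $$ (p i, j)))"
    by (simp add: char_poly_def det_transpose[of _ n])
  also have "\<dots> = signof p * det (?R\<^sup>T)"
    by (rule det_permute_rows) (use p in auto)
  also have "det (?R\<^sup>T) = det ?R" by (rule det_transpose) auto
  also have "det ?R = signof p * det ?M" by (rule det_permute_rows[OF M p])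
  finally show ?thesis by (simp add: char_poly_def sign_def)
qed

lemma num_pos_eigenvalues_cong:
  assumes "A \<in> carrier_mat n n" "B \<in> carrier_mat m m" "char_poly A = char_poly B"
  shows "num_pos_eigenvalues A = num_pos_eigenvalues B"
  using assms by (simp add: num_pos_eigenvalues_def eigenvalue_root_char_poly)

lemma i_plus_eq:
  assumes "distinct xs" "set xs = verts G"
  shows "i_plus G = num_pos_eigenvalues (adj_mat G xs)"
proof -
  define ys where "ys = (SOME ys. distinct ys \<and> set ys = verts G)"
  have ys: "distinct ys \<and> set ys = verts G"
    unfolding ys_def by (rule someI[of _ xs]) (use assms in simp)
  with assms have "mset ys = mset xs"
    by (metis set_eq_iff_mset_eq_distinct)
  then obtain p where p: "p permutes {..<length xs}" "permute_list p xs = ys"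
    by (rule mset_eq_permutation)
  have len: "length ys = length xs" using p(2) by auto
  have pn: "p i < length xs" if "i < length xs" for i
    using permutes_in_image[OF p(1), of i] that by simp
  have "adj_mat G ys = mat (length xs) (length xs) (\<lambda>(i, j). adj_mat G xs $$ (p i, p j))"
    using pn p(1) len
    by (intro eq_matI) (auto simp: adj_mat_def p(2)[symmetric] permute_list_nth)
  then have "char_poly (adj_mat G ys) = char_poly (adj_mat G xs)"
    using char_poly_permute[OF adj_mat_carrier, of p xs G] p(1) by (simp add: lessThan_atLeast0)
  then show ?thesis
    unfolding i_plus_def ys_def[symmetric]
    by (rule num_pos_eigenvalues_cong[OF adj_mat_carrier adj_mat_carrier])
qed


section \<open>The graphs \<open>\<infinity>(p,l,q)\<close> and \<open>\<theta>(p,l,q)\<close>\<close>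

text \<open>The edges of a walk \<open>v\<^sub>0, \<dots>, v\<^sub>k\<close>, with weights \<open>a 1, \<dots>, a k\<close>.
  Weight families are indexed from 1; values outside the stated range are unused.\<close>

definition walk_edges :: "'v list \<Rightarrow> (nat \<Rightarrow> real) \<Rightarrow> ('v set \<times> real) list" where
  "walk_edges vs a = map (\<lambda>i. ({vs ! (i - 1), vs ! i}, a i)) [1..<length vs]"

definition wgraph_of :: "('v set \<times> real) list \<Rightarrow> 'v wgraph" where
  "wgraph_of es = \<lparr>verts = \<Union> (fst ` set es), edges = fst ` set es,
     wt = (\<lambda>e. the (map_of es e))\<rparr>"

definition pos_weights :: "nat \<Rightarrow> (nat \<Rightarrow> real) \<Rightarrow> bool" where
  "pos_weights k a \<longleftrightarrow> (\<forall>i\<in>{1..k}. 0 < a i)"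

text \<open>\<open>IV 1\<close> is the vertex \<open>v\<close> and \<open>IV l\<close> is the vertex \<open>u\<close>.\<close>

datatype infty_vertex = IV nat | IX nat | IY nat

definition infty_graph ::
  "nat \<Rightarrow> nat \<Rightarrow> nat \<Rightarrow> (nat \<Rightarrow> real) \<Rightarrow> (nat \<Rightarrow> real) \<Rightarrow> (nat \<Rightarrow> real) \<Rightarrow> infty_vertex wgraph"
where
  "infty_graph p l q a b c = wgraph_of
     (walk_edges ([IV 1] @ map IX [1..<p] @ [IV 1]) a @
      walk_edges ([IV l] @ map IY [1..<q] @ [IV l]) b @
      walk_edges (map IV [1..<l + 1]) c)"

datatype theta_vertex = TU | TV | TX nat | TY nat | TZ nat

definition theta_graph ::
  "nat \<Rightarrow> nat \<Rightarrow> nat \<Rightarrow> (nat \<Rightarrow> real) \<Rightarrow> (nat \<Rightarrow> real) \<Rightarrow> (nat \<Rightarrow> real) \<Rightarrow> theta_vertex wgraph"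
where
  "theta_graph p l q a b c = wgraph_of
     (walk_edges ([TU] @ map TX [1..<p + 1] @ [TV]) a @
      walk_edges ([TU] @ map TY [1..<l + 1] @ [TV]) b @
      walk_edges ([TU] @ map TZ [1..<q + 1] @ [TV]) c)"

text \<open>The parameters are meant to satisfy \<open>p, q \<ge> 3\<close>, \<open>l \<ge> 1\<close> for \<open>\<infinity>(p,l,q)\<close>,
  and at most one of \<open>p, l, q\<close> is meant to be \<open>0\<close> for \<open>\<theta>(p,l,q)\<close>.\<close>

definition is_infty ::
  "'a wgraph \<Rightarrow> nat \<Rightarrow> nat \<Rightarrow> nat \<Rightarrow> (nat \<Rightarrow> real) \<Rightarrow> (nat \<Rightarrow> real) \<Rightarrow> (nat \<Rightarrow> real) \<Rightarrow> bool"
where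
  "is_infty G p l q a b c \<longleftrightarrow>
     pos_weights p a \<and> pos_weights q b \<and> pos_weights (l - 1) c \<and>
     wgraph_iso G (infty_graph p l q a b c)"

definition is_theta ::
  "'a wgraph \<Rightarrow> nat \<Rightarrow> nat \<Rightarrow> nat \<Rightarrow> (nat \<Rightarrow> real) \<Rightarrow> (nat \<Rightarrow> real) \<Rightarrow> (nat \<Rightarrow> real) \<Rightarrow> bool"
where
  "is_theta G p l q a b c \<longleftrightarrow>
     pos_weights (p + 1) a \<and> pos_weights (l + 1) b \<and> pos_weights (q + 1) c \<and>
     wgraph_iso G (theta_graph p l q a b c)"

end

theory Submission
  imports Defs "Jordan_Normal_Form.Schur_Decomposition"
begin

text \<open>By the spectral theorem, \<open>i_plus G\<close> is the largest dimension of a space on which the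
  quadratic form of the adjacency matrix is positive definite, and it is at most the number of
  linear functionals whose common kernel makes the form nonpositive. All bounds below are
  certificates of one of these two kinds.

  The structure of \<open>G\<close> comes from a longest path: each of its ends has a further neighbour on the
  path, and counting degrees shows that the path with these two chords is all of \<open>G\<close>. According
  to whether the chords cross, \<open>G\<close> is a \<open>\<theta>\<close>- or an \<open>\<infinity>\<close>-graph. If it is not one of eight small
  graphs, three edges forming a triangular pattern (or a five-cycle) force \<open>i_plus G \<ge> 3\<close>; for the
  eight graphs the condition on the weights is read off by completing products in the form.\<close>

subsection \<open>Diagonalization of real symmetric matrices\<close>

text \<open>The weight conditions come from splitting off an edge. An edge spans a hyperbolic plane,
  which accounts for one positive eigenvalue, and the orthogonal complement carries a corrected
  form. Splitting \<open>z1 z2\<close> off a path \<open>u z1 z2 v\<close> with weights c1, c2, c3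
  adds - c1 c3 / c2 to the weight of \<open>u v\<close>; splitting the edge of weight a2 opposite to
  \<open>v\<close> off a triangle leaves the term - (a1 a3 / a2) v^2 in half the quadratic form.
  Cleared of denominators, the requirements on these corrected weights are the conditions of the
  theorem. Two kinds of lower certificate are needed. A nonzero determinant between three pairwise
  nonadjacent vertices and three others would also force three negative eigenvalues, which is
  impossible on the five vertices of \<open>theta_graph 1 0 2\<close>; and
  \<open>infty_graph 3 2 3\<close> is covered by two triangles, hence has no three pairwise
  nonadjacent vertices. In these two cases explicit vectors spanning a positive definite space are
  used.\<close>

lemma symmetric_mat_real_eigenvalue:
  fixes A :: "real mat"
  assumes A: "A \<in> carrier_mat n n" and sym: "A\<^sup>T = A" and n: "n \<noteq> 0"
  obtains e where "eigenvalue A e"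
proof -
  let ?C = "map_mat complex_of_real A"
  have C: "?C \<in> carrier_mat n n" using A by simp
  obtain as where as: "char_poly ?C = (\<Prod>a\<leftarrow>as. [:- a, 1:])" "length as = n"
    using char_poly_factorized[OF C] by blast
  then obtain e as' where e: "as = e # as'" using n by (cases as) auto
  have "eigenvalue ?C e"
    unfolding eigenvalue_root_char_poly[OF C] as(1) e by simp
  then obtain v where v: "v \<in> carrier_vec n" "v \<noteq> 0\<^sub>v n" "?C *\<^sub>v v = e \<cdot>\<^sub>v v"
    unfolding eigenvalue_def eigenvector_def using A by auto
  have symi: "A $$ (i, j) = A $$ (j, i)" if "i < n" "j < n" for i j
    using that A by (metis carrier_matD index_transpose_mat(1) sym)
  have ev: "(\<Sum>j<n. complex_of_real (A $$ (i, j)) * v $ j) = e * v $ i" if "i < n" for i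
  proof -
    have "(?C *\<^sub>v v) $ i = (\<Sum>j<n. complex_of_real (A $$ (i, j)) * v $ j)"
      using that A v(1) by (auto simp: scalar_prod_def lessThan_atLeast0 intro!: sum.cong)
    with v(3) show ?thesis using that v(1) by simp
  qed
  have ev': "(\<Sum>j<n. complex_of_real (A $$ (i, j)) * cnj (v $ j)) = cnj e * cnj (v $ i)" if "i < n" for i
    using arg_cong[OF ev[OF that], of cnj] by (simp add: cnj_sum)
  \<comment> \<open>Both ends of this chain equal the Hermitian form of \<open>A\<close> at
    \<open>v\<close>: applying \<open>A\<close> to \<open>v\<close> yields the factor
    \<open>e\<close>, and moving the real symmetric \<open>A\<close> to the conjugate of
    \<open>v\<close> yields \<open>cnj e\<close>.\<close>
  have "e * (\<Sum>i<n. v $ i * cnj (v $ i))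
      = (\<Sum>i<n. cnj (v $ i) * (\<Sum>j<n. complex_of_real (A $$ (i, j)) * v $ j))"
    unfolding sum_distrib_left by (rule sum.cong) (auto simp: ev sum_distrib_left[symmetric])
  also have "\<dots> = (\<Sum>j<n. \<Sum>i<n. cnj (v $ i) * (complex_of_real (A $$ (i, j)) * v $ j))"
    unfolding sum_distrib_left by (rule sum.swap)
  also have "\<dots> = (\<Sum>j<n. v $ j * (\<Sum>i<n. complex_of_real (A $$ (j, i)) * cnj (v $ i)))"
    unfolding sum_distrib_left by (intro sum.cong) (auto simp: symi)
  also have "\<dots> = cnj e * (\<Sum>i<n. v $ i * cnj (v $ i))"
    unfolding sum_distrib_left[of "cnj e"] by (rule sum.cong) (simp_all add: ev')
  finally have eq: "e * (\<Sum>i<n. v $ i * cnj (v $ i)) = cnj e * (\<Sum>i<n. v $ i * cnj (v $ i))" .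
  have "v \<bullet>c v \<noteq> 0" using v by simp
  moreover have "v \<bullet>c v = (\<Sum>i<n. v $ i * cnj (v $ i))"
    using v(1) by (auto simp: scalar_prod_def lessThan_atLeast0 intro!: sum.cong)
  ultimately have "e = cnj e" using eq by simp
  then obtain r where r: "e = complex_of_real r" by (metis Reals_cases Reals_cnj_iff)
  have "poly (char_poly ?C) (complex_of_real r) = 0"
    unfolding as(1) e r by simp
  then have "poly (char_poly A) r = 0"
    by (simp add: of_real_hom.char_poly_hom[OF A])
  then have "eigenvalue A r" using eigenvalue_root_char_poly[OF A] by simp
  then show ?thesis by (rule that)
qed

text \<open>Gram-Schmidt keeps the head of the list, so completing \<open>v\<close> to a basis and
  normalizing leaves a multiple of \<open>v\<close> in front; \<open>c\<close> is 1 / sqrt (v . v).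
  Over the reals conjugation is the identity, so conjugate orthogonality is orthogonality.\<close>

lemma orthonormal_completion:
  fixes v :: "real vec"
  assumes v: "v \<in> carrier_vec n" "v \<noteq> 0\<^sub>v n"
  obtains W c where "W \<in> carrier_mat n n" "W\<^sup>T * W = 1\<^sub>m n" "col W 0 = c \<cdot>\<^sub>v v"
proof -
  interpret cof_vec_space n "TYPE(real)" .
  from v have n: "n \<noteq> 0" by (intro notI) auto
  define b where "b = basis_completion v"
  define ws where "ws = gram_schmidt n b"
  from basis_completion[OF v, folded b_def]
  have b: "distinct b" "\<not> lin_dep (set b)" "set b \<subseteq> carrier_vec n" "hd b = v" "length b = n"
    by auto
  then obtain vs where bv: "b = v # vs" using n by (cases b) auto
  from gram_schmidt_result[OF b(3,1,2) refl, folded ws_def]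
  have ws: "set ws \<subseteq> carrier_vec n" "corthogonal ws" "length ws = n"
    by (auto simp: b)
  have hdws: "hd ws = v" using gram_schmidt_hd[OF v(1), of vs, folded bv] unfolding ws_def .
  define us where "us = map (\<lambda>w. (1 / sqrt (w \<bullet> w)) \<cdot>\<^sub>v w) ws"
  define W where "W = mat_of_cols n us"
  have W: "W \<in> carrier_mat n n" unfolding W_def us_def using ws(3) mat_of_cols_carrier(1) by fastforce
  have wsn: "ws ! i \<in> carrier_vec n" if "i < n" for i using that ws by auto
  have conj: "conjugate w = w" for w :: "real vec" by (rule eq_vecI) auto
  have colW: "col W i = (1 / sqrt (ws ! i \<bullet> ws ! i)) \<cdot>\<^sub>v ws ! i" if "i < n" for i
    using that ws(3) wsn[OF that] unfolding W_def us_def by (subst col_mat_of_cols) auto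
  have orth: "ws ! i \<bullet> ws ! j = 0 \<longleftrightarrow> i \<noteq> j" if "i < n" "j < n" for i j
    using corthogonalD[OF ws(2), of i j] that ws(3) by (simp add: conj)
  have pos: "ws ! i \<bullet> ws ! i > 0" if "i < n" for i
    using orth[OF that that] conjugate_square_ge_0_vec[of "ws ! i"] by (simp add: conj)
  have "W\<^sup>T * W = 1\<^sub>m n"
  proof (rule eq_matI)
    fix i j assume "i < dim_row (1\<^sub>m n :: real mat)" "j < dim_col (1\<^sub>m n :: real mat)"
    then have ij: "i < n" "j < n" by auto
    have "(W\<^sup>T * W) $$ (i, j) = col W i \<bullet> col W j" using W ij by simp
    also have "\<dots> = (1 / sqrt (ws ! i \<bullet> ws ! i)) * ((1 / sqrt (ws ! j \<bullet> ws ! j)) * (ws ! i \<bullet> ws ! j))"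
      unfolding colW[OF ij(1)] colW[OF ij(2)]
      using wsn[OF ij(1)] wsn[OF ij(2)] smult_scalar_prod_distrib scalar_prod_smult_distrib
      by (metis smult_carrier_vec)
    also have "\<dots> = 1\<^sub>m n $$ (i, j)"
      using orth[OF ij] pos[OF ij(1)] ij by (cases "i = j") (auto simp: field_simps)
    finally show "(W\<^sup>T * W) $$ (i, j) = 1\<^sub>m n $$ (i, j)" .
  qed (use W in auto)
  moreover have "col W 0 = (1 / sqrt (v \<bullet> v)) \<cdot>\<^sub>v v"
    using colW[of 0] n ws(3) hdws by (cases ws) auto
  ultimately show ?thesis using W that by blast
qed

text \<open>Deflation: in an orthonormal basis that starts with an eigenvector the first column is a
  multiple of the first unit vector, by symmetry so is the first row, and the induction hypothesis
  applies to the remaining block.\<close>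

theorem symmetric_mat_diagonalization:
  fixes A :: "real mat"
  assumes "A \<in> carrier_mat n n" and "A\<^sup>T = A"
  shows "\<exists>U d. U \<in> carrier_mat n n \<and> U\<^sup>T * U = 1\<^sub>m n \<and> U\<^sup>T * A * U = mat_diag n d"
  using assms
proof (induction n arbitrary: A)
  case 0
  then show ?case by (intro exI[of _ "1\<^sub>m 0"] exI[of _ "\<lambda>_. 0"]) (auto simp: mat_diag_def intro!: eq_matI)
next
  case (Suc n A)
  note A = Suc.prems(1)
  obtain e where "eigenvalue A e"
    using symmetric_mat_real_eigenvalue[OF Suc.prems] by blast
  then obtain v where v: "v \<in> carrier_vec (Suc n)" "v \<noteq> 0\<^sub>v (Suc n)" "A *\<^sub>v v = e \<cdot>\<^sub>v v"
    unfolding eigenvalue_def eigenvector_def using A by auto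
  obtain W c where W: "W \<in> carrier_mat (Suc n) (Suc n)" "W\<^sup>T * W = 1\<^sub>m (Suc n)"
    "col W 0 = c \<cdot>\<^sub>v v"
    using orthonormal_completion[OF v(1,2)] by blast
  have WT: "W\<^sup>T \<in> carrier_mat (Suc n) (Suc n)" using W(1) by simp
  define B where "B = W\<^sup>T * A * W"
  have B: "B \<in> carrier_mat (Suc n) (Suc n)" unfolding B_def using W(1) A by auto
  have Bsym: "B\<^sup>T = B"
  proof -
    have "B\<^sup>T = W\<^sup>T * (W\<^sup>T * A)\<^sup>T"
      unfolding B_def by (rule transpose_mult[of _ "Suc n" "Suc n"]) (use W A in auto)
    also have "(W\<^sup>T * A)\<^sup>T = A\<^sup>T * W\<^sup>T\<^sup>T"
      by (rule transpose_mult[of _ "Suc n" "Suc n"]) (use W A in auto)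
    finally show ?thesis unfolding B_def Suc.prems(2) using W(1) A
      by (simp add: assoc_mult_mat[of _ "Suc n" "Suc n" _ "Suc n" _ "Suc n"])
  qed
  have B0: "B $$ (i, 0) = (if i = 0 then e else 0)" if "i < Suc n" for i
  proof -
    have "B = W\<^sup>T * (A * W)"
      unfolding B_def by (rule assoc_mult_mat) (use WT W A in auto)
    moreover have "col (A * W) 0 = A *\<^sub>v col W 0"
      by (rule col_mult2[OF A W(1)]) simp
    ultimately have "B $$ (i, 0) = col W i \<bullet> (A *\<^sub>v col W 0)"
      using that W(1) A by (simp del: col_mult2)
    also have "A *\<^sub>v col W 0 = e \<cdot>\<^sub>v col W 0"
      unfolding W(3) using A v by (simp add: mult_mat_vec[OF A v(1)] smult_smult_assoc mult.commute)
    also have "col W i \<bullet> (e \<cdot>\<^sub>v col W 0) = e * (W\<^sup>T * W) $$ (i, 0)"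
      using that W(1) by simp
    finally show ?thesis unfolding W(2) using that by simp
  qed
  define D where "D = mat n n (\<lambda>(i, j). B $$ (Suc i, Suc j))"
  have D: "D \<in> carrier_mat n n" by (simp add: D_def)
  have Bsymi: "B $$ (i, j) = B $$ (j, i)" if "i < Suc n" "j < Suc n" for i j
    using that B by (metis Bsym carrier_matD index_transpose_mat(1))
  have Bblock: "B = four_block_mat (mat 1 1 (\<lambda>_. e)) (0\<^sub>m 1 n) (0\<^sub>m n 1) D"
  proof (rule eq_matI)
    fix i j assume "i < dim_row (four_block_mat (mat 1 1 (\<lambda>_. e)) (0\<^sub>m 1 n) (0\<^sub>m n 1) D)"
      "j < dim_col (four_block_mat (mat 1 1 (\<lambda>_. e)) (0\<^sub>m 1 n) (0\<^sub>m n 1) D)"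
    then have ij: "i < Suc n" "j < Suc n" by (auto simp: D_def)
    show "B $$ (i, j) = four_block_mat (mat 1 1 (\<lambda>_. e)) (0\<^sub>m 1 n) (0\<^sub>m n 1) D $$ (i, j)"
      using ij B0[OF ij(1)] B0[OF ij(2)] Bsymi[OF ij] D
      by (cases i; cases j) (auto simp: D_def)
  qed (use B D in auto)
  have "D\<^sup>T = D" unfolding D_def using Bsymi by (intro eq_matI) auto
  from Suc.IH[OF D this] obtain U d where U: "U \<in> carrier_mat n n" "U\<^sup>T * U = 1\<^sub>m n"
    "U\<^sup>T * D * U = mat_diag n d" by blast
  \<comment> \<open>The diagonalizer \<open>U\<close> of the smaller block, extended so that it
    fixes the eigenvector already found; \<open>W * X\<close> is then the witness.\<close>
  define X where "X = four_block_mat (1\<^sub>m 1) (0\<^sub>m 1 n) (0\<^sub>m n 1) U"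
  have X: "X \<in> carrier_mat (Suc n) (Suc n)" unfolding X_def using U(1)
    four_block_carrier_mat[of "1\<^sub>m 1" 1 1 U n n] by auto
  have XT: "X\<^sup>T = four_block_mat (1\<^sub>m 1) (0\<^sub>m 1 n) (0\<^sub>m n 1) (U\<^sup>T)"
    unfolding X_def using U(1) by (subst transpose_four_block_mat[of _ 1 1 _ n _ n]) auto
  have XX: "X\<^sup>T * X = 1\<^sub>m (Suc n)"
    unfolding XT unfolding X_def using U(1)
    by (subst mult_four_block_mat[of _ 1 1 _ n _ n _ _ 1 _ n]) (auto simp: U(2) simp flip: four_block_one_mat[of 1 n, simplified])
  have XBX: "X\<^sup>T * B * X = mat_diag (Suc n) (case_nat e d)"
  proof -
    have "X\<^sup>T * B = four_block_mat (mat 1 1 (\<lambda>_. e)) (0\<^sub>m 1 n) (0\<^sub>m n 1) (U\<^sup>T * D)"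
      unfolding XT Bblock using U(1) D
      by (subst mult_four_block_mat[of _ 1 1 _ n _ n _ _ 1 _ n]) auto
    then have "X\<^sup>T * B * X = four_block_mat (mat 1 1 (\<lambda>_. e)) (0\<^sub>m 1 n) (0\<^sub>m n 1) (U\<^sup>T * D * U)"
      unfolding X_def using U(1) D
      by (simp, subst mult_four_block_mat[of _ 1 1 _ n _ n _ _ 1 _ n]) auto
    also have "\<dots> = mat_diag (Suc n) (case_nat e d)"
      unfolding U(3) by (rule eq_matI) (auto simp: mat_diag_def split: nat.splits)
    finally show ?thesis .
  qed
  have XTc: "X\<^sup>T \<in> carrier_mat (Suc n) (Suc n)" using X by simp
  have WXT: "(W * X)\<^sup>T = X\<^sup>T * W\<^sup>T" by (rule transpose_mult[OF W(1) X])
  have "(W * X)\<^sup>T * (W * X) = X\<^sup>T * (W\<^sup>T * W) * X"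
    unfolding WXT using XTc WT W(1) X
    by (smt (verit) assoc_mult_mat mult_carrier_mat)
  also have "\<dots> = 1\<^sub>m (Suc n)" unfolding W(2) using XTc XX by simp
  finally have 1: "(W * X)\<^sup>T * (W * X) = 1\<^sub>m (Suc n)" .
  have "(W * X)\<^sup>T * A * (W * X) = X\<^sup>T * B * X"
    unfolding WXT B_def using XTc WT W(1) X A
    by (smt (verit) assoc_mult_mat mult_carrier_mat)
  then have 2: "(W * X)\<^sup>T * A * (W * X) = mat_diag (Suc n) (case_nat e d)" using XBX by simp
  show ?case using 1 2 W(1) X by (meson mult_carrier_mat)
qed

subsection \<open>Inertia of the adjacency form\<close>

lemma order_linear_factor: "Polynomial.order x [:- a, 1:] = (if x = a then 1 else 0)" for a :: real
proof (cases "x = a")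
  case True
  then show ?thesis using order_power_n_n[of a 1] by simp
next
  case False
  then show ?thesis by (simp add: order_0I)
qed

lemma order_prod_linear_factors:
  fixes es :: "real list"
  shows "Polynomial.order x (\<Prod>e\<leftarrow>es. [:- e, 1:]) = count_list es x"
proof (induction es)
  case (Cons e es)
  have "monic (\<Prod>e\<leftarrow>es. [:- e, 1:])" by (rule monic_prod_list) auto
  then have "(\<Prod>e\<leftarrow>es. [:- e, 1:]) \<noteq> 0" by (metis leading_coeff_0_iff zero_neq_one)
  then have "[:- e, 1:] * (\<Prod>e\<leftarrow>es. [:- e, 1:]) \<noteq> 0" by (intro no_zero_divisors) auto
  then show ?case using Cons by (simp add: order_mult order_linear_factor del: mult_pCons_left)
qed simp

lemma sum_count_list_filter:
  assumes "finite S" "{x \<in> set es. P x} \<subseteq> S" "\<And>x. x \<in> S \<Longrightarrow> P x"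
  shows "(\<Sum>x\<in>S. count_list es x) = length (filter P es)"
  using assms(2)
proof (induction es)
  case (Cons e es)
  have "(\<Sum>x\<in>S. count_list (e # es) x) = (\<Sum>x\<in>S. count_list es x) + (\<Sum>x\<in>S. if e = x then 1 else 0)"
    unfolding sum.distrib[symmetric] by (rule sum.cong) auto
  then show ?case using Cons assms(1,3) by auto
qed simp

text \<open>An orthogonal \<open>U\<close> makes \<open>A\<close> similar to the diagonal matrix, so
  the order of a root is the number of its occurrences among the \<open>d i\<close>. Summing over
  the distinct positive roots therefore counts indices, which takes care of multiplicities.\<close>

lemma num_pos_eigenvalues_diagonal:
  fixes A :: "real mat"
  assumes A: "A \<in> carrier_mat n n" and U: "U \<in> carrier_mat n n" "U\<^sup>T * U = 1\<^sub>m n"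
    and D: "U\<^sup>T * A * U = mat_diag n d"
  shows "num_pos_eigenvalues A = card {i. i < n \<and> 0 < d i}"
proof -
  let ?es = "map d [0..<n]"
  have UT: "U\<^sup>T \<in> carrier_mat n n" using U(1) by simp
  have "U * U\<^sup>T = 1\<^sub>m n" by (rule mat_mult_left_right_inverse[OF UT U(1) U(2)])
  then have "similar_mat_wit (mat_diag n d) A (U\<^sup>T) U"
    using A U UT D by (intro similar_mat_witI[of _ _ n]) (auto simp: mat_diag_def)
  then have "char_poly A = char_poly (mat_diag n d)"
    using char_poly_similar unfolding similar_mat_def by metis
  also have "\<dots> = (\<Prod>a\<leftarrow>diag_mat (mat_diag n d). [:- a, 1:])"
    by (rule char_poly_upper_triangular[of _ n]) (auto simp: mat_diag_def)
  also have "diag_mat (mat_diag n d) = ?es" by (auto simp: diag_mat_def mat_diag_def)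
  finally have cp: "char_poly A = (\<Prod>a\<leftarrow>?es. [:- a, 1:])" .
  have ev: "eigenvalue A x \<longleftrightarrow> x \<in> set ?es" for x
    unfolding eigenvalue_root_char_poly[OF A] cp
    by (auto simp: poly_prod_list o_def prod_list_zero_iff)
  have "num_pos_eigenvalues A = (\<Sum>x | x \<in> set ?es \<and> 0 < x. count_list ?es x)"
    unfolding num_pos_eigenvalues_def ev cp order_prod_linear_factors ..
  also have "\<dots> = length (filter (\<lambda>x. 0 < x) ?es)"
    by (rule sum_count_list_filter) auto
  also have "\<dots> = card {i. i < n \<and> 0 < d i}"
    by (simp add: filter_map o_def length_filter_conv_card cong: conj_cong)
  finally show ?thesis .
qed

lemma adj_entry_commute: "adj_entry G x y = adj_entry G y x"
  by (simp add: adj_entry_def insert_commute)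

text \<open>\<open>\<Phi> i\<close> is the \<open>i\<close>-th orthonormal eigenvector, read as a
  function on vertices, and \<open>d i\<close> is its eigenvalue. In this form the two inertia
  bounds need neither matrices nor an ordering of the vertices.\<close>

theorem adj_entry_spectral:
  assumes fin: "finite (verts G)"
  obtains d :: "nat \<Rightarrow> real" and \<Phi> :: "nat \<Rightarrow> 'a \<Rightarrow> real" and n :: nat
  where "\<forall>x\<in>verts G. \<forall>y\<in>verts G. adj_entry G x y = (\<Sum>i<n. d i * \<Phi> i x * \<Phi> i y)"
    "\<forall>i<n. \<forall>j<n. (\<Sum>x\<in>verts G. \<Phi> i x * \<Phi> j x) = (if i = j then 1 else 0)"
    "i_plus G = card {i. i < n \<and> 0 < d i}"
proof -
  obtain xs where xs: "distinct xs" "set xs = verts G"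
    using finite_distinct_list[OF fin] by auto
  define n where "n = length xs"
  define A where "A = adj_mat G xs"
  have A: "A \<in> carrier_mat n n" by (simp add: A_def n_def)
  have "A\<^sup>T = A" unfolding A_def adj_mat_def by (rule eq_matI) (auto intro: adj_entry_commute)
  then obtain U d where U: "U \<in> carrier_mat n n" "U\<^sup>T * U = 1\<^sub>m n" "U\<^sup>T * A * U = mat_diag n d"
    using symmetric_mat_diagonalization[OF A] by blast
  have UT: "U\<^sup>T \<in> carrier_mat n n" using U(1) by simp
  have UU: "U * U\<^sup>T = 1\<^sub>m n" by (rule mat_mult_left_right_inverse[OF UT U(1) U(2)])
  have "U * mat_diag n d * U\<^sup>T = (U * U\<^sup>T) * A * (U * U\<^sup>T)"
    unfolding U(3)[symmetric] using U(1) UT A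
    by (smt (verit) assoc_mult_mat mult_carrier_mat)
  then have AU: "A = U * mat_diag n d * U\<^sup>T" unfolding UU using A by simp
  have ent: "A $$ (i, j) = (\<Sum>k<n. d k * U $$ (i, k) * U $$ (j, k))" if "i < n" "j < n" for i j
  proof -
    have "(U * mat_diag n d) $$ (i, k) = U $$ (i, k) * d k" if "k < n" for k
      using U(1) \<open>i < n\<close> that by (subst mat_diag_mult_right[OF U(1)]) simp
    moreover have "A $$ (i, j) = (\<Sum>k<n. (U * mat_diag n d) $$ (i, k) * U $$ (j, k))"
      using that U(1) unfolding AU
      by (subst index_mult_mat) (auto simp: scalar_prod_def lessThan_atLeast0 mat_diag_def)
    ultimately show ?thesis by (auto intro!: sum.cong)
  qed
  have orth: "(\<Sum>k<n. U $$ (k, i) * U $$ (k, j)) = (if i = j then 1 else 0)" if "i < n" "j < n" for i j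
  proof -
    have "(\<Sum>k<n. U $$ (k, i) * U $$ (k, j)) = (U\<^sup>T * U) $$ (i, j)"
      using that U(1) by (subst index_mult_mat) (auto simp: scalar_prod_def lessThan_atLeast0)
    then show ?thesis unfolding U(2) using that by simp
  qed
  have bij: "bij_betw ((!) xs) {..<n} (verts G)"
    using bij_betw_nth[OF xs(1), of "{..<n}"] xs(2) n_def by simp
  \<comment> \<open>The position of a vertex in the list, which carries row indices of
    \<open>U\<close> over to vertices.\<close>
  define ix where "ix = the_inv_into {..<n} ((!) xs)"
  have ix: "ix (xs ! i) = i" if "i < n" for i
    unfolding ix_def using bij that by (intro the_inv_into_f_f) (auto simp: bij_betw_def)
  have ix': "ix x < n \<and> xs ! ix x = x" if "x \<in> verts G" for x
  proof -
    from that bij obtain i where "i < n" "x = xs ! i" unfolding bij_betw_def by auto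
    then show ?thesis using ix by auto
  qed
  show ?thesis
  proof (rule that[where n = n and d = d and \<Phi> = "\<lambda>i x. U $$ (ix x, i)"])
    have "adj_entry G x y = (\<Sum>i<n. d i * U $$ (ix x, i) * U $$ (ix y, i))"
      if xy: "x \<in> verts G" "y \<in> verts G" for x y
    proof -
      have "adj_entry G x y = A $$ (ix x, ix y)"
        using ix'[OF xy(1)] ix'[OF xy(2)] unfolding A_def adj_mat_def n_def by auto
      then show ?thesis using ent ix'[OF xy(1)] ix'[OF xy(2)] by simp
    qed
    then show "\<forall>x\<in>verts G. \<forall>y\<in>verts G.
      adj_entry G x y = (\<Sum>i<n. d i * U $$ (ix x, i) * U $$ (ix y, i))" by blast
  next
    have "(\<Sum>x\<in>verts G. U $$ (ix x, i) * U $$ (ix x, j)) = (if i = j then 1 else 0)"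
      if ij: "i < n" "j < n" for i j
    proof -
      have "(\<Sum>x\<in>verts G. U $$ (ix x, i) * U $$ (ix x, j)) = (\<Sum>k<n. U $$ (ix (xs ! k), i) * U $$ (ix (xs ! k), j))"
        by (rule sum.reindex_bij_betw[OF bij, symmetric])
      also have "\<dots> = (\<Sum>k<n. U $$ (k, i) * U $$ (k, j))" by (rule sum.cong) (auto simp: ix)
      finally show ?thesis using orth[OF ij] by simp
    qed
    then show "\<forall>i<n. \<forall>j<n.
      (\<Sum>x\<in>verts G. U $$ (ix x, i) * U $$ (ix x, j)) = (if i = j then 1 else 0)" by blast
  next
    show "i_plus G = card {i. i < n \<and> 0 < d i}"
      unfolding i_plus_eq[OF xs] A_def[symmetric]
      by (rule num_pos_eigenvalues_diagonal[OF A U])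
  qed
qed

text \<open>Gaussian elimination, one equation at a time. The index types are arbitrary because the
  equations are indexed by eigenvalues in one application and by functionals in the other.\<close>

lemma homogeneous_system_nontrivial:
  fixes M :: "'e \<Rightarrow> 'j \<Rightarrow> real"
  assumes "finite E" "finite J" "card E < card J"
  shows "\<exists>t. (\<exists>j\<in>J. t j \<noteq> 0) \<and> (\<forall>e\<in>E. (\<Sum>j\<in>J. M e j * t j) = 0)"
  using assms
proof (induction E arbitrary: J M rule: finite_induct)
  case empty
  then have "J \<noteq> {}" by auto
  then show ?case by (intro exI[of _ "\<lambda>_. 1"]) auto
next
  case (insert e E)
  show ?case
  proof (cases "\<forall>j\<in>J. M e j = 0")
    case True
    have "card E < card J" using insert by simp
    from insert.IH[OF insert.prems(1) this, of M] True show ?thesis by auto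
  next
    case False
    then obtain k where k: "k \<in> J" "M e k \<noteq> 0" by auto
    define J' where "J' = J - {k}"
    have J': "finite J'" "card E < card J'"
      using insert k(1) unfolding J'_def by auto
    \<comment> \<open>Row \<open>e\<close> has its pivot in column \<open>k\<close>; solving it for
      the unknown \<open>k\<close> and substituting into row \<open>f\<close> gives these
      coefficients. The value of the eliminated unknown is \<open>s\<close>.\<close>
    obtain t where t: "\<exists>j\<in>J'. t j \<noteq> 0"
      "\<forall>f\<in>E. (\<Sum>j\<in>J'. (M f j - M f k * M e j / M e k) * t j) = 0"
      using insert.IH[OF J', of "\<lambda>f j. M f j - M f k * M e j / M e k"] by blast
    define s where "s = - (\<Sum>j\<in>J'. M e j * t j) / M e k"
    define t' where "t' = t(k := s)"
    have split: "(\<Sum>j\<in>J. M f j * t' j) = M f k * s + (\<Sum>j\<in>J'. M f j * t j)" for f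
    proof -
      have "(\<Sum>j\<in>J. M f j * t' j) = M f k * t' k + (\<Sum>j\<in>J'. M f j * t' j)"
        unfolding J'_def by (rule sum.remove) (use insert k in auto)
      moreover have "(\<Sum>j\<in>J'. M f j * t' j) = (\<Sum>j\<in>J'. M f j * t j)"
        by (rule sum.cong) (auto simp: t'_def J'_def)
      ultimately show ?thesis by (simp add: t'_def)
    qed
    have "(\<Sum>j\<in>J. M f j * t' j) = 0" if "f \<in> E" for f
    proof -
      have "M f k * s = (\<Sum>j\<in>J'. - (M f k * M e j / M e k * t j))"
        unfolding s_def by (simp add: sum_distrib_left sum_divide_distrib sum_negf mult.assoc)
      then have "(\<Sum>j\<in>J. M f j * t' j) = (\<Sum>j\<in>J'. (M f j - M f k * M e j / M e k) * t j)"
        unfolding split by (simp add: sum.distrib[symmetric] left_diff_distrib)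
      then show ?thesis using t(2) that by simp
    qed
    moreover have "(\<Sum>j\<in>J. M e j * t' j) = 0"
      unfolding split s_def using k(2) by simp
    moreover have "\<exists>j\<in>J. t' j \<noteq> 0" using t(1) unfolding t'_def J'_def by auto
    ultimately show ?thesis by (intro exI[of _ t']) auto
  qed
qed

text \<open>Kept bilinear, since Gram matrices and isotropic pairings need its mixed values.\<close>

definition qform :: "'a wgraph \<Rightarrow> ('a \<Rightarrow> real) \<Rightarrow> ('a \<Rightarrow> real) \<Rightarrow> real" where
  "qform G f g = (\<Sum>x\<in>verts G. \<Sum>y\<in>verts G. adj_entry G x y * f x * g y)"

lemma qform_spectral:
  assumes "\<forall>x\<in>verts G. \<forall>y\<in>verts G. adj_entry G x y = (\<Sum>i<n. d i * \<Phi> i x * \<Phi> i y)"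
  shows "qform G f f = (\<Sum>i<n. d i * (\<Sum>x\<in>verts G. \<Phi> i x * f x)\<^sup>2)"
proof -
  have "qform G f f = (\<Sum>x\<in>verts G. \<Sum>y\<in>verts G. \<Sum>i<n. d i * (\<Phi> i x * f x) * (\<Phi> i y * f y))"
    unfolding qform_def by (intro sum.cong) (auto simp: assms sum_distrib_left sum_distrib_right mult_ac)
  also have "\<dots> = (\<Sum>x\<in>verts G. \<Sum>i<n. \<Sum>y\<in>verts G. d i * (\<Phi> i x * f x) * (\<Phi> i y * f y))"
    by (intro sum.cong sum.swap) auto
  also have "\<dots> = (\<Sum>i<n. \<Sum>x\<in>verts G. \<Sum>y\<in>verts G. d i * (\<Phi> i x * f x) * (\<Phi> i y * f y))"
    by (rule sum.swap)
  also have "\<dots> = (\<Sum>i<n. d i * (\<Sum>x\<in>verts G. \<Phi> i x * f x)\<^sup>2)"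
    by (intro sum.cong) (auto simp: power2_eq_square sum_distrib_left sum_distrib_right mult_ac)
  finally show ?thesis .
qed

text \<open>With fewer positive eigenvalues than test functions, some nontrivial combination of the
  latter is orthogonal to every eigenvector of positive eigenvalue, and there the spectral expansion
  is nonpositive. Linear independence of the \<open>F j\<close> is built into
  \<open>pos\<close>.\<close>

theorem card_le_i_plus:
  fixes F :: "'j \<Rightarrow> 'a \<Rightarrow> real"
  assumes fin: "finite (verts G)" "finite J"
    and pos: "\<And>t. \<exists>j\<in>J. t j \<noteq> 0 \<Longrightarrow>
      0 < qform G (\<lambda>x. \<Sum>j\<in>J. t j * F j x) (\<lambda>x. \<Sum>j\<in>J. t j * F j x)"
  shows "card J \<le> i_plus G"
proof (rule ccontr)
  assume "\<not> card J \<le> i_plus G"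
  then have less: "i_plus G < card J" by simp
  obtain d \<Phi> and n :: nat where spec: "\<forall>x\<in>verts G. \<forall>y\<in>verts G. adj_entry G x y = (\<Sum>i<n. d i * \<Phi> i x * \<Phi> i y)"
    and "\<forall>i<n. \<forall>j<n.
      (\<Sum>x\<in>verts G. \<Phi> i x * \<Phi> j x) = (if i = j then 1 else 0)"
    and ip: "i_plus G = card {i. i < n \<and> 0 < d i}"
    by (rule adj_entry_spectral[OF fin(1)], rule that)
  obtain t where t: "\<exists>j\<in>J. t j \<noteq> 0"
    "\<And>i. i < n \<Longrightarrow> 0 < d i \<Longrightarrow> (\<Sum>j\<in>J. (\<Sum>x\<in>verts G. \<Phi> i x * F j x) * t j) = 0"
    using homogeneous_system_nontrivial[of "{i. i < n \<and> 0 < d i}" J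
      "\<lambda>i j. \<Sum>x\<in>verts G. \<Phi> i x * F j x"] fin(2) less unfolding ip by auto
  let ?f = "\<lambda>x. \<Sum>j\<in>J. t j * F j x"
  have "(\<Sum>x\<in>verts G. \<Phi> i x * ?f x) = (\<Sum>j\<in>J. (\<Sum>x\<in>verts G. \<Phi> i x * F j x) * t j)" for i
    unfolding sum_distrib_left sum_distrib_right
    by (subst sum.swap) (auto simp: mult_ac)
  then have zero: "(\<Sum>x\<in>verts G. \<Phi> i x * ?f x) = 0" if "i < n" "0 < d i" for i
    using t(2) that by simp
  have "qform G ?f ?f \<le> 0"
    unfolding qform_spectral[OF spec]
  proof (rule sum_nonpos)
    fix i assume "i \<in> {..<n}"
    then show "d i * (\<Sum>x\<in>verts G. \<Phi> i x * ?f x)\<^sup>2 \<le> 0"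
      using zero[of i] by (cases "0 < d i") (auto simp: mult_nonpos_nonneg)
  qed
  with pos[OF t(1)] show False by simp
qed

text \<open>The dual count: with more positive eigenvalues than functionals, a nontrivial
  combination of the corresponding eigenvectors is killed by all functionals, while the form is
  positive on it.\<close>

theorem i_plus_le_card:
  fixes l :: "'k \<Rightarrow> ('a \<Rightarrow> real) \<Rightarrow> real"
  assumes fin: "finite (verts G)" "finite K"
    and lin: "\<And>k f g s. k \<in> K \<Longrightarrow> l k (\<lambda>x. s * f x + g x) = s * l k f + l k g"
    and nonpos: "\<And>f. \<forall>k\<in>K. l k f = 0 \<Longrightarrow> qform G f f \<le> 0"
  shows "i_plus G \<le> card K"
proof (rule ccontr)
  assume "\<not> i_plus G \<le> card K"
  then have less: "card K < i_plus G" by simp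
  obtain d \<Phi> and n :: nat where spec: "\<forall>x\<in>verts G. \<forall>y\<in>verts G. adj_entry G x y = (\<Sum>i<n. d i * \<Phi> i x * \<Phi> i y)"
    and orth: "\<forall>i<n. \<forall>j<n.
      (\<Sum>x\<in>verts G. \<Phi> i x * \<Phi> j x) = (if i = j then 1 else 0)"
    and ip: "i_plus G = card {i. i < n \<and> 0 < d i}"
    by (rule adj_entry_spectral[OF fin(1)], rule that)
  define P where "P = {i. i < n \<and> 0 < d i}"
  have P: "finite P" unfolding P_def by simp
  obtain t where t: "\<exists>j\<in>P. t j \<noteq> 0" "\<And>k. k \<in> K \<Longrightarrow> (\<Sum>j\<in>P. l k (\<Phi> j) * t j) = 0"
    using homogeneous_system_nontrivial[of K P "\<lambda>k j. l k (\<Phi> j)"] fin(2) P less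
    unfolding ip P_def[symmetric] by auto
  let ?f = "\<lambda>x. \<Sum>j\<in>P. t j * \<Phi> j x"
  have l0: "l k (\<lambda>x. 0) = 0" if "k \<in> K" for k
    using lin[OF that, of 1 "\<lambda>_. 0" "\<lambda>_. 0"] by simp
  have lsum: "l k (\<lambda>x. \<Sum>j\<in>S. t j * \<Phi> j x) = (\<Sum>j\<in>S. t j * l k (\<Phi> j))" if "finite S" "k \<in> K" for S k
    using that(1) by (induction S) (simp_all add: l0 lin that(2))
  have "\<forall>k\<in>K. l k ?f = 0"
    using t(2) by (simp add: lsum P mult.commute)
  from nonpos[OF this] have np: "qform G ?f ?f \<le> 0" .
  have coef: "(\<Sum>x\<in>verts G. \<Phi> i x * ?f x) = (if i \<in> P then t i else 0)" if "i < n" for i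
  proof -
    have "(\<Sum>x\<in>verts G. \<Phi> i x * ?f x) = (\<Sum>j\<in>P. t j * (\<Sum>x\<in>verts G. \<Phi> i x * \<Phi> j x))"
      unfolding sum_distrib_left by (subst sum.swap) (auto simp: mult_ac)
    also have "\<dots> = (\<Sum>j\<in>P. if i = j then t j else 0)"
      by (rule sum.cong) (use orth that in \<open>auto simp: P_def\<close>)
    finally show ?thesis using P by simp
  qed
  obtain k where k: "k \<in> P" "t k \<noteq> 0" using t(1) by auto
  have "qform G ?f ?f = (\<Sum>i<n. d i * (if i \<in> P then t i else 0)\<^sup>2)"
    unfolding qform_spectral[OF spec] by (rule sum.cong) (simp_all only: coef lessThan_iff)
  moreover have "0 < (\<Sum>i<n. d i * (if i \<in> P then t i else 0)\<^sup>2)"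
    by (rule sum_pos2[of _ k]) (use k in \<open>auto simp: P_def\<close>)
  ultimately show False using np by simp
qed

subsection \<open>Lower bounds for the number of positive eigenvalues\<close>

lemma qform_sum_sum:
  assumes "finite I" "finite J"
  shows "qform G (\<lambda>x. \<Sum>i\<in>I. s i * f i x) (\<lambda>x. \<Sum>j\<in>J. t j * g j x)
    = (\<Sum>i\<in>I. \<Sum>j\<in>J. s i * t j * qform G (f i) (g j))"
proof -
  have "qform G (\<lambda>x. \<Sum>i\<in>I. s i * f i x) (\<lambda>x. \<Sum>j\<in>J. t j * g j x)
      = (\<Sum>x\<in>verts G. \<Sum>y\<in>verts G. \<Sum>i\<in>I. \<Sum>j\<in>J. s i * t j * (adj_entry G x y * f i x * g j y))"
    unfolding qform_def
    by (intro sum.cong) (simp_all add: sum_distrib_left sum_distrib_right mult_ac)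
  also have "\<dots> = (\<Sum>x\<in>verts G. \<Sum>i\<in>I. \<Sum>y\<in>verts G. \<Sum>j\<in>J. s i * t j * (adj_entry G x y * f i x * g j y))"
    by (intro sum.cong refl sum.swap)
  also have "\<dots> = (\<Sum>i\<in>I. \<Sum>x\<in>verts G. \<Sum>y\<in>verts G. \<Sum>j\<in>J. s i * t j * (adj_entry G x y * f i x * g j y))"
    by (rule sum.swap)
  also have "\<dots> = (\<Sum>i\<in>I. \<Sum>x\<in>verts G. \<Sum>j\<in>J. \<Sum>y\<in>verts G. s i * t j * (adj_entry G x y * f i x * g j y))"
    by (intro sum.cong refl sum.swap)
  also have "\<dots> = (\<Sum>i\<in>I. \<Sum>j\<in>J. \<Sum>x\<in>verts G. \<Sum>y\<in>verts G. s i * t j * (adj_entry G x y * f i x * g j y))"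
    by (intro sum.cong refl sum.swap)
  also have "\<dots> = (\<Sum>i\<in>I. \<Sum>j\<in>J. s i * t j * qform G (f i) (g j))"
    unfolding qform_def by (simp add: sum_distrib_left)
  finally show ?thesis .
qed

lemma qform_add:
  "qform G (\<lambda>x. s * f x + g x) (\<lambda>x. t * h x + k x)
    = s * t * qform G f h + s * qform G f k + t * qform G g h + qform G g k"
  unfolding qform_def
  by (simp add: algebra_simps sum.distrib sum_distrib_left)

definition unit_fun :: "'a \<Rightarrow> 'a \<Rightarrow> real" where
  "unit_fun u x = (if x = u then 1 else 0)"

lemma qform_unit_fun:
  assumes "finite (verts G)" "u \<in> verts G" "v \<in> verts G"
  shows "qform G (unit_fun u) (unit_fun v) = adj_entry G u v"
proof -
  have "qform G (unit_fun u) (unit_fun v)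
      = (\<Sum>x\<in>verts G. \<Sum>y\<in>verts G. if v = y then (if u = x then adj_entry G x y else 0) else 0)"
    unfolding qform_def unit_fun_def by (intro sum.cong) auto
  also have "\<dots> = adj_entry G u v" using assms by simp
  finally show ?thesis .
qed

text \<open>On a totally isotropic space dually paired with a second one, the vectors \<open>s P\<^sub>i + Q\<^sub>i\<close> have a
  diagonally dominant Gram matrix once \<open>s D\<close> is large.\<close>

lemma isotropic_le_i_plus:
  fixes P Q :: "'j \<Rightarrow> 'a \<Rightarrow> real"
  assumes fin: "finite (verts G)" "finite J" and "D \<noteq> 0"
    and PP: "\<And>i j. i \<in> J \<Longrightarrow> j \<in> J \<Longrightarrow> qform G (P i) (P j) = 0"
    and PQ: "\<And>i j. i \<in> J \<Longrightarrow> j \<in> J \<Longrightarrow> qform G (P i) (Q j) = (if i = j then D else 0)"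
  shows "card J \<le> i_plus G"
proof -
  have comm: "qform G f g = qform G g f" for f g
    unfolding qform_def by (subst sum.swap) (simp add: adj_entry_commute mult_ac)
  define q where "q i j = qform G (Q i) (Q j)" for i j
  define C where "C = (\<Sum>i\<in>J. \<Sum>j\<in>J. \<bar>q i j\<bar>)"
  \<comment> \<open>Chosen so that the two mixed terms add up to \<open>2 * s * D = C + 1\<close>,
    one more than the total size \<open>C\<close> of the entries \<open>q i j\<close>. The sign of
    \<open>s\<close> follows that of \<open>D\<close>.\<close>
  define s where "s = (C + 1) / (2 * D)"
  define F where "F i = (\<lambda>x. s * P i x + Q i x)" for i
  have QP: "qform G (Q i) (P j) = (if i = j then D else 0)" if "i \<in> J" "j \<in> J" for i j
    using PQ[of j i] comm[of "Q i" "P j"] that by auto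
  have FF: "qform G (F i) (F j) = (if i = j then C + 1 else 0) + q i j" if "i \<in> J" "j \<in> J" for i j
    using \<open>D \<noteq> 0\<close> unfolding F_def qform_add PP[OF that] PQ[OF that] QP[OF that] q_def s_def by simp
  have pos: "0 < qform G (\<lambda>x. \<Sum>j\<in>J. t j * F j x) (\<lambda>x. \<Sum>j\<in>J. t j * F j x)"
    if t: "\<exists>j\<in>J. t j \<noteq> 0" for t
  proof -
    define T where "T = (\<Sum>j\<in>J. (t j)\<^sup>2)"
    have "0 < T" unfolding T_def using t fin(2)
      by (metis sum_pos2 zero_le_power2 zero_less_power2)
    have le: "(t i)\<^sup>2 \<le> T" if "i \<in> J" for i
      unfolding T_def by (rule member_le_sum) (use that fin(2) in auto)
    have bound: "- (T * \<bar>q i j\<bar>) \<le> t i * t j * q i j" if "i \<in> J" "j \<in> J" for i j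
    proof -
      have "2 * (\<bar>t i\<bar> * \<bar>t j\<bar>) \<le> (t i)\<^sup>2 + (t j)\<^sup>2"
        using zero_le_power2[of "\<bar>t i\<bar> - \<bar>t j\<bar>"] by (simp add: power2_diff)
      then have "\<bar>t i * t j\<bar> \<le> T" using le[OF that(1)] le[OF that(2)] by (simp add: abs_mult)
      then have "\<bar>t i * t j * q i j\<bar> \<le> T * \<bar>q i j\<bar>"
        by (simp add: abs_mult mult_right_mono)
      then show ?thesis by linarith
    qed
    have "- (T * C) = (\<Sum>i\<in>J. \<Sum>j\<in>J. - (T * \<bar>q i j\<bar>))"
      unfolding C_def by (simp add: sum_distrib_left sum_negf)
    also have "\<dots> \<le> (\<Sum>i\<in>J. \<Sum>j\<in>J. t i * t j * q i j)"
      by (intro sum_mono bound)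
    finally have 1: "- (T * C) \<le> (\<Sum>i\<in>J. \<Sum>j\<in>J. t i * t j * q i j)" .
    have "qform G (\<lambda>x. \<Sum>j\<in>J. t j * F j x) (\<lambda>x. \<Sum>j\<in>J. t j * F j x)
        = (\<Sum>i\<in>J. \<Sum>j\<in>J. t i * t j * ((if i = j then C + 1 else 0) + q i j))"
      unfolding qform_sum_sum[OF fin(2) fin(2)] by (intro sum.cong) (auto simp: FF)
    also have "\<dots> = (\<Sum>i\<in>J. (\<Sum>j\<in>J. if i = j then t i * t j * (C + 1) else 0)
        + (\<Sum>j\<in>J. t i * t j * q i j))"
      unfolding sum.distrib[symmetric] by (intro sum.cong) (auto simp: algebra_simps)
    also have "\<dots> = T * (C + 1) + (\<Sum>i\<in>J. \<Sum>j\<in>J. t i * t j * q i j)"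
      using fin(2) by (simp add: sum.distrib T_def sum_distrib_right power2_eq_square)
    finally show ?thesis using 1 \<open>0 < T\<close> by (simp add: algebra_simps)
  qed
  show ?thesis by (rule card_le_i_plus[OF fin pos])
qed

text \<open>Row \<open>j\<close> of \<open>c\<close> holds the coordinates of a test vector on the
  listed vertices. The combined coordinates \<open>y\<close> are quantified separately, so that an
  application can put in simplified values before it expands the double sum.\<close>

lemma positive_on_vertices_le_i_plus:
  fixes r :: "nat \<Rightarrow> 'a" and c :: "nat \<Rightarrow> nat \<Rightarrow> real"
  assumes fin: "finite (verts G)" and r: "\<And>k. k < m \<Longrightarrow> r k \<in> verts G"
    and pos: "\<And>t y. \<exists>j<d. t j \<noteq> 0 \<Longrightarrow> (\<And>k. k < m \<Longrightarrow> y k = (\<Sum>j<d. t j * c j k)) \<Longrightarrow>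
      0 < (\<Sum>k<m. \<Sum>l<m. y k * y l * adj_entry G (r k) (r l))"
  shows "d \<le> i_plus G"
proof -
  define F where "F j = (\<lambda>x. \<Sum>k<m. c j k * unit_fun (r k) x)" for j
  have "card {..<d} \<le> i_plus G"
  proof (rule card_le_i_plus[OF fin, where F = F])
    fix t :: "nat \<Rightarrow> real" assume t: "\<exists>j\<in>{..<d}. t j \<noteq> 0"
    define y where "y k = (\<Sum>j<d. t j * c j k)" for k
    have eq: "(\<lambda>x. \<Sum>j<d. t j * F j x) = (\<lambda>x. \<Sum>k<m. y k * unit_fun (r k) x)"
    proof
      fix x show "(\<Sum>j<d. t j * F j x) = (\<Sum>k<m. y k * unit_fun (r k) x)"
        unfolding F_def y_def sum_distrib_left sum_distrib_right
        by (subst sum.swap) (simp add: mult.assoc)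
    qed
    have "qform G (\<lambda>x. \<Sum>j<d. t j * F j x) (\<lambda>x. \<Sum>j<d. t j * F j x)
        = (\<Sum>k<m. \<Sum>l<m. y k * y l * adj_entry G (r k) (r l))"
      unfolding eq by (subst qform_sum_sum) (auto intro!: sum.cong simp: qform_unit_fun fin r)
    moreover have "0 < (\<Sum>k<m. \<Sum>l<m. y k * y l * adj_entry G (r k) (r l))"
      by (rule pos[of t]) (use t in \<open>auto simp: y_def\<close>)
    ultimately show "0 < qform G (\<lambda>x. \<Sum>j<d. t j * F j x) (\<lambda>x. \<Sum>j<d. t j * F j x)" by simp
  qed simp
  then show ?thesis by simp
qed

lemma isotropic_vertices_le_i_plus:
  fixes p q :: "nat \<Rightarrow> 'a" and N :: "nat \<Rightarrow> nat \<Rightarrow> real"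
  assumes fin: "finite (verts G)" and "D \<noteq> 0"
    and p: "\<And>i. i < d \<Longrightarrow> p i \<in> verts G" and q: "\<And>i. i < d \<Longrightarrow> q i \<in> verts G"
    and pp: "\<And>i j. i < d \<Longrightarrow> j < d \<Longrightarrow> adj_entry G (p i) (p j) = 0"
    and N: "\<And>i k. i < d \<Longrightarrow> k < d \<Longrightarrow>
      (\<Sum>j<d. N i j * adj_entry G (p j) (q k)) = (if i = k then D else 0)"
  shows "d \<le> i_plus G"
proof -
  let ?P = "\<lambda>i x. \<Sum>j<d. N i j * unit_fun (p j) x"
  let ?Q = "\<lambda>i. unit_fun (q i)"
  have "card {..<d} \<le> i_plus G"
  proof (rule isotropic_le_i_plus[OF fin _ \<open>D \<noteq> 0\<close>, where P = ?P and Q = ?Q])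
    fix i j assume "i \<in> {..<d}" "j \<in> {..<d}"
    then have ij: "i < d" "j < d" by auto
    show "qform G (?P i) (?P j) = 0"
      by (subst qform_sum_sum) (auto simp: qform_unit_fun fin p pp)
    have "qform G (?P i) (?Q j) = (\<Sum>k<d. N i k * adj_entry G (p k) (q j))"
      using qform_sum_sum[of "{..<d}" "{0::nat}" G "N i" "\<lambda>j. unit_fun (p j)" "\<lambda>_. 1" "\<lambda>_. ?Q j"] ij
      by (simp add: qform_unit_fun fin p q)
    then show "qform G (?P i) (?Q j) = (if i = j then D else 0)" using N[OF ij] by simp
  qed simp
  then show ?thesis by simp
qed

lemma adj_entry_self: "weighted_graph G \<Longrightarrow> adj_entry G x x = 0"
  unfolding weighted_graph_def adj_entry_def by (auto dest!: bspec[of _ _ "{x}"])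

lemma two_le_i_plus:
  assumes G: "weighted_graph G" and "{p1, p2, q1, q2} \<subseteq> verts G"
    and "adj_entry G p1 p2 = 0"
    and "adj_entry G p1 q1 * adj_entry G p2 q2 - adj_entry G p1 q2 * adj_entry G p2 q1 \<noteq> 0"
  shows "2 \<le> i_plus G"
proof -
  define p where "p = (!) [p1, p2]"
  define q where "q = (!) [q1, q2]"
  let ?a = "\<lambda>i j. adj_entry G (p i) (q j)"
  define N where "N i j = [[?a 1 1, - ?a 0 1], [- ?a 1 0, ?a 0 0]] ! i ! j" for i j
  have fin: "finite (verts G)" using G by (simp add: weighted_graph_def)
  have lt: "i < 2 \<longleftrightarrow> i = 0 \<or> i = 1" for i :: nat by auto
  have sum2: "(\<Sum>j<2. f j) = f 0 + f 1" for f :: "nat \<Rightarrow> real"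
    by (simp add: eval_nat_numeral)
  show ?thesis
  proof (rule isotropic_vertices_le_i_plus[OF fin assms(4), where p = p and q = q and N = N])
  qed (use assms adj_entry_self[OF G] adj_entry_commute[of G p1 p2] in
    \<open>auto simp: lt sum2 p_def q_def N_def algebra_simps\<close>)
qed

text \<open>The hypothesis \<open>det\<close> is the 3 by 3 determinant expanded along its first
  row, and \<open>N\<close> in the proof is the adjugate matrix.\<close>

lemma three_le_i_plus:
  fixes G :: "'a wgraph"
  defines "w \<equiv> adj_entry G"
  assumes G: "weighted_graph G" and "{p1, p2, p3, q1, q2, q3} \<subseteq> verts G"
    and pp: "w p1 p2 = 0" "w p1 p3 = 0" "w p2 p3 = 0"
    and det: "w p1 q1 * (w p2 q2 * w p3 q3 - w p2 q3 * w p3 q2)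
      - w p1 q2 * (w p2 q1 * w p3 q3 - w p2 q3 * w p3 q1)
      + w p1 q3 * (w p2 q1 * w p3 q2 - w p2 q2 * w p3 q1) \<noteq> 0"
  shows "3 \<le> i_plus G"
proof -
  define p where "p = (!) [p1, p2, p3]"
  define q where "q = (!) [q1, q2, q3]"
  let ?a = "\<lambda>i j. w (p i) (q j)"
  define N where "N i j =
    [[?a 1 1 * ?a 2 2 - ?a 1 2 * ?a 2 1, ?a 0 2 * ?a 2 1 - ?a 0 1 * ?a 2 2, ?a 0 1 * ?a 1 2 - ?a 0 2 * ?a 1 1],
     [?a 1 2 * ?a 2 0 - ?a 1 0 * ?a 2 2, ?a 0 0 * ?a 2 2 - ?a 0 2 * ?a 2 0, ?a 0 2 * ?a 1 0 - ?a 0 0 * ?a 1 2],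
     [?a 1 0 * ?a 2 1 - ?a 1 1 * ?a 2 0, ?a 0 1 * ?a 2 0 - ?a 0 0 * ?a 2 1, ?a 0 0 * ?a 1 1 - ?a 0 1 * ?a 1 0]]
    ! i ! j" for i j
  have fin: "finite (verts G)" using G by (simp add: weighted_graph_def)
  have lt: "i < 3 \<longleftrightarrow> i = 0 \<or> i = 1 \<or> i = 2" for i :: nat by auto
  have sum3: "(\<Sum>j<3. f j) = f 0 + f 1 + f 2" for f :: "nat \<Rightarrow> real"
    by (simp add: eval_nat_numeral)
  note comm = adj_entry_commute[of G p1 p2] adj_entry_commute[of G p1 p3] adj_entry_commute[of G p2 p3]
  show ?thesis
  proof (rule isotropic_vertices_le_i_plus[OF fin det, where p = p and q = q and N = N])
    fix i j :: nat assume "i < 3" "j < 3"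
    then show "adj_entry G (p i) (p j) = 0"
      using pp adj_entry_self[OF G] comm unfolding lt w_def p_def by auto
  next
    fix i k :: nat assume ik: "i < 3" "k < 3"
    show "(\<Sum>j<3. N i j * adj_entry G (p j) (q k)) = (if i = k
      then w p1 q1 * (w p2 q2 * w p3 q3 - w p2 q3 * w p3 q2)
        - w p1 q2 * (w p2 q1 * w p3 q3 - w p2 q3 * w p3 q1)
        + w p1 q3 * (w p2 q1 * w p3 q2 - w p2 q2 * w p3 q1) else 0)"
      unfolding sum3 w_def[symmetric]
      using ik unfolding lt
      by (elim disjE; simp add: N_def p_def q_def; simp add: algebra_simps)
  qed (use assms(3) in \<open>auto simp: lt p_def q_def\<close>)
qed

text \<open>Eliminating the edge \<open>z1 z2\<close> leaves a triangle \<open>u v x\<close> whose edge \<open>u v\<close> has the negative weight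
  \<open>- \<sigma> / w z1 z2\<close>; rescaled to unit weights its matrix has eigenvalues 1, 1, -2. The rows of \<open>c\<close> are
  \<open>z1 + z2\<close> and the two lifted positive eigenvectors.\<close>

lemma five_cycle_three_le_i_plus:
  fixes G :: "'a wgraph"
  defines "w \<equiv> adj_entry G"
  assumes G: "weighted_graph G" and V: "{u, v, x, z1, z2} \<subseteq> verts G"
    and pos: "0 < w u x" "0 < w x v" "0 < w z1 z2"
    and zero: "w u z2 = 0" "w v z1 = 0" "w x z1 = 0" "w x z2 = 0"
    and less: "w u v * w z1 z2 < w u z1 * w z2 v"
  shows "3 \<le> i_plus G"
proof -
  define \<sigma> where "\<sigma> = w u z1 * w z2 v - w u v * w z1 z2"
  define r where "r = (!) [u, v, x, z1, z2]"
  define c where "c j k =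
    [[0, 0, 0, 1, 1],
     [w x v * w z1 z2, - w u x * w z1 z2, 0, w u x * w z2 v, - w x v * w u z1],
     [w x v * w z1 z2, w u x * w z1 z2, 2 * \<sigma>, - w u x * w z2 v, - w x v * w u z1]] ! j ! k" for j k
  define m where "m = w u x * w x v * w z1 z2 * \<sigma>"
  have fin: "finite (verts G)" using G by (simp add: weighted_graph_def)
  have lt3: "(\<exists>j<3. t j \<noteq> 0) \<longleftrightarrow> t 0 \<noteq> 0 \<or> t 1 \<noteq> 0 \<or> t 2 \<noteq> 0" for t :: "nat \<Rightarrow> real"
    by (auto simp: eval_nat_numeral less_Suc_eq)
  have sum3: "(\<Sum>j<3. f j) = f 0 + f 1 + f 2" for f :: "nat \<Rightarrow> real"
    by (simp add: eval_nat_numeral)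
  have sum5: "(\<Sum>j<5. f j) = f 0 + f 1 + f 2 + f 3 + f 4" for f :: "nat \<Rightarrow> real"
    by (simp add: eval_nat_numeral)
  have sym: "w a b = w b a" for a b unfolding w_def by (rule adj_entry_commute)
  have self: "w a a = 0" for a unfolding w_def by (rule adj_entry_self[OF G])
  show ?thesis
  proof (rule positive_on_vertices_le_i_plus[OF fin, where r = r and c = c and m = 5])
    fix k :: nat assume "k < 5"
    then show "r k \<in> verts G" using V by (auto simp: r_def eval_nat_numeral less_Suc_eq)
  next
    fix t y :: "nat \<Rightarrow> real"
    assume t: "\<exists>j<3. t j \<noteq> 0" and y: "\<And>k. k < 5 \<Longrightarrow> y k = (\<Sum>j<3. t j * c j k)"
    have yv: "y 0 = (t 1 + t 2) * (w x v * w z1 z2)" "y 1 = (t 2 - t 1) * (w u x * w z1 z2)"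
      "y 2 = 2 * \<sigma> * t 2" "y 3 = t 0 - (t 2 - t 1) * (w u x * w z2 v)"
      "y 4 = t 0 - (t 1 + t 2) * (w x v * w u z1)"
      by (simp_all add: y sum3 c_def algebra_simps)
    have "(\<Sum>k<5. \<Sum>l<5. y k * y l * w (r k) (r l))
        = 2 * (y 0 * y 1 * w u v + y 0 * y 2 * w u x + y 0 * y 3 * w u z1 + y 1 * y 2 * w x v
          + y 1 * y 4 * w z2 v + y 3 * y 4 * w z1 z2)"
      unfolding sum5 r_def using zero
      by (simp add: self sym[of v u] sym[of x u] sym[of z1 u] sym[of z2 u] sym[of v x] sym[of z1 v]
        sym[of v z2] sym[of z1 x] sym[of z2 x] sym[of z2 z1])
    \<comment> \<open>The three rows are orthogonal for the form, so only squares remain. The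
      factors 2 and 6 in front of \<open>m\<close> are the squared norms of the eigenvectors (1, -1,
      0) and (1, 1, 2) of the rescaled triangle.\<close>
    also have "\<dots> = 2 * w z1 z2 * (t 0)\<^sup>2 + 2 * m * (t 1)\<^sup>2 + 6 * m * (t 2)\<^sup>2"
      unfolding yv m_def \<sigma>_def by (simp add: power2_eq_square algebra_simps)
    finally have eq: "(\<Sum>k<5. \<Sum>l<5. y k * y l * w (r k) (r l))
      = 2 * w z1 z2 * (t 0)\<^sup>2 + 2 * m * (t 1)\<^sup>2 + 6 * m * (t 2)\<^sup>2" .
    have m: "0 < m" unfolding m_def \<sigma>_def using pos less by simp
    have "0 \<le> 2 * w z1 z2 * (t 0)\<^sup>2" "0 \<le> 2 * m * (t 1)\<^sup>2" "0 \<le> 6 * m * (t 2)\<^sup>2"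
      "t 0 \<noteq> 0 \<Longrightarrow> 0 < 2 * w z1 z2 * (t 0)\<^sup>2" "t 1 \<noteq> 0 \<Longrightarrow> 0 < 2 * m * (t 1)\<^sup>2"
      "t 2 \<noteq> 0 \<Longrightarrow> 0 < 6 * m * (t 2)\<^sup>2"
      using pos m by simp_all
    then show "0 < (\<Sum>k<5. \<Sum>l<5. y k * y l * adj_entry G (r k) (r l))"
      using t unfolding lt3 w_def[symmetric] eq by linarith
  qed
qed

subsection \<open>Bicyclic graphs without pendant vertices\<close>

text \<open>Repetitions in the list are allowed: naming a vertex at both ends gives the edge set of
  a cycle.\<close>

fun path_edges :: "'a list \<Rightarrow> 'a set set" where
  "path_edges (x # y # zs) = insert {x, y} (path_edges (y # zs))"
| "path_edges _ = {}"

lemma path_edges_append: "path_edges (xs @ x # ys) = path_edges (xs @ [x]) \<union> path_edges (x # ys)"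
proof (induction xs)
  case (Cons a xs)
  then show ?case by (cases xs) auto
qed simp

lemma path_edges_snoc: "xs \<noteq> [] \<Longrightarrow> path_edges (xs @ [y]) = insert {last xs, y} (path_edges xs)"
proof (induction xs)
  case (Cons a xs)
  then show ?case by (cases xs) auto
qed simp

lemma path_edges_Cons: "xs \<noteq> [] \<Longrightarrow> path_edges (y # xs) = insert {y, hd xs} (path_edges xs)"
  by (cases xs) auto

lemma path_edges_rev [simp]: "path_edges (rev xs) = path_edges xs"
proof (induction xs)
  case (Cons a xs)
  then show ?case
    by (cases "xs = []") (auto simp: path_edges_snoc path_edges_Cons last_rev insert_commute)
qed simp

lemma path_edges_subset: "e \<in> path_edges xs \<Longrightarrow> e \<subseteq> set xs"
  by (induction xs rule: path_edges.induct) auto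

lemma finite_path_edges [simp]: "finite (path_edges xs)"
  by (induction xs rule: path_edges.induct) auto

lemma card_path_edges: "distinct xs \<Longrightarrow> card (path_edges xs) = length xs - 1"
proof (induction xs rule: path_edges.induct)
  case (1 x y zs)
  have "{x, y} \<notin> path_edges (y # zs)"
    using path_edges_subset[of "{x, y}" "y # zs"] 1(2) by auto
  then show ?case using 1 by simp
qed auto

lemma path_edges_nth: "path_edges xs = {{xs ! m, xs ! Suc m} | m. Suc m < length xs}"
proof (induction xs rule: path_edges.induct)
  case (1 x y zs)
  have "{{(x # y # zs) ! m, (x # y # zs) ! Suc m} | m. Suc m < length (x # y # zs)}
      = insert {x, y} {{(y # zs) ! m, (y # zs) ! Suc m} | m. Suc m < length (y # zs)}"
    (is "?L = insert _ ?R")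
  proof
    show "?L \<subseteq> insert {x, y} ?R"
    proof
      fix e assume "e \<in> ?L"
      then obtain m where m: "e = {(x # y # zs) ! m, (x # y # zs) ! Suc m}"
        "Suc m < length (x # y # zs)" by auto
      then show "e \<in> insert {x, y} ?R" by (cases m) auto
    qed
    show "insert {x, y} ?R \<subseteq> ?L"
    proof
      fix e assume "e \<in> insert {x, y} ?R"
      then consider "e = {x, y}" | m where "e = {(y # zs) ! m, (y # zs) ! Suc m}"
        "Suc m < length (y # zs)" by auto
      then show "e \<in> ?L"
      proof cases
        case 1
        then show ?thesis by (auto intro!: exI[of _ 0])
      next
        case 2
        then show ?thesis by (auto intro!: exI[of _ "Suc m"])
      qed
    qed
  qed
  then show ?case using 1 by simp
qed auto

text \<open>Handshake lemma, with the edge set as a parameter because it is applied to the whole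
  graph and to the subgraph formed by a path and its chords.\<close>

lemma sum_degrees:
  assumes "finite V" "finite F" "\<And>e. e \<in> F \<Longrightarrow> e \<subseteq> V \<and> card e = 2"
  shows "(\<Sum>x\<in>V. card {e \<in> F. x \<in> e}) = 2 * card F"
proof (rule sum_multicount[OF assms(1,2)], intro ballI)
  fix e assume e: "e \<in> F"
  then have "{x \<in> V. x \<in> e} = e" using assms(3) by auto
  then show "card {x \<in> V. x \<in> e} = 2" using assms(3)[OF e] by simp
qed

lemma connected_closed_eq:
  assumes conn: "connected_graph G" and S: "S \<subseteq> verts G" "S \<noteq> {}"
    and closed: "\<And>x y. x \<in> S \<Longrightarrow> {x, y} \<in> edges G \<Longrightarrow> y \<in> S"
  shows "S = verts G"
proof
  show "verts G \<subseteq> S"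
  proof
    fix y assume y: "y \<in> verts G"
    obtain x where x: "x \<in> S" using S(2) by auto
    then have "(x, y) \<in> {(s, t). {s, t} \<in> edges G}\<^sup>*"
      using conn S(1) y unfolding connected_graph_def by auto
    then show "y \<in> S" by (induction rule: rtrancl_induct) (use x closed in auto)
  qed
qed fact

section \<open>Longest paths and their chords\<close>

definition graph_path :: "'a wgraph \<Rightarrow> 'a list \<Rightarrow> bool" where
  "graph_path G ws \<longleftrightarrow> ws \<noteq> [] \<and> distinct ws \<and> set ws \<subseteq> verts G \<and> path_edges ws \<subseteq> edges G"

definition longest_path :: "'a wgraph \<Rightarrow> 'a list \<Rightarrow> bool" where
  "longest_path G ws \<longleftrightarrow> graph_path G ws \<and> (\<forall>zs. graph_path G zs \<longrightarrow> length zs \<le> length ws)"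

lemma longest_path_exists:
  assumes "finite (verts G)" "verts G \<noteq> {}"
  obtains ws where "longest_path G ws"
proof -
  obtain x where x: "x \<in> verts G" using assms(2) by auto
  have "graph_path G [x]" using x by (simp add: graph_path_def)
  moreover have "\<forall>ws. graph_path G ws \<longrightarrow> length ws < Suc (card (verts G))"
    using assms(1) by (metis card_mono distinct_card graph_path_def less_Suc_eq_le)
  ultimately show ?thesis
    using ex_has_greatest_nat[of "graph_path G" "[x]" length "Suc (card (verts G))"] that
    unfolding longest_path_def by blast
qed

lemma longest_path_rev: "longest_path G ws \<Longrightarrow> longest_path G (rev ws)"
  unfolding longest_path_def graph_path_def by auto

text \<open>Otherwise \<open>y\<close> could be put in front of the path.\<close>

lemma longest_path_hd_neighbour:
  assumes G: "weighted_graph G" and ws: "longest_path G ws" and e: "{hd ws, y} \<in> edges G"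
  shows "y \<in> set ws"
proof (rule ccontr)
  assume "y \<notin> set ws"
  moreover have "y \<in> verts G" using G e unfolding weighted_graph_def by auto
  ultimately have "graph_path G (y # ws)"
    using ws e unfolding longest_path_def graph_path_def
    by (auto simp: path_edges_Cons insert_commute)
  then show False using ws unfolding longest_path_def by fastforce
qed

lemma edge_obtain:
  assumes G: "weighted_graph G" and e: "e \<in> edges G" "x \<in> e"
  obtains y where "e = {x, y}" "y \<noteq> x" "y \<in> verts G"
proof -
  have "card e = 2" "e \<subseteq> verts G" using G e(1) unfolding weighted_graph_def by auto
  then show ?thesis using e(2) that by (auto simp: card_2_iff)
qed

lemma finite_edges: "weighted_graph G \<Longrightarrow> finite (edges G)"
  by (rule finite_subset[of _ "Pow (verts G)"]) (auto simp: weighted_graph_def)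

text \<open>The path itself uses only one edge at its head, so degree two supplies another one, and
  maximality puts its other end on the path.\<close>

lemma longest_path_hd_chord:
  assumes G: "weighted_graph G" and ws: "longest_path G ws" and deg: "2 \<le> degree_in G (hd ws)"
  obtains i where "2 \<le> i" "i < length ws" "{hd ws, ws ! i} \<in> edges G"
proof -
  have ne: "ws \<noteq> []" and dist: "distinct ws"
    using ws unfolding longest_path_def graph_path_def by auto
  have "\<not> {e \<in> edges G. hd ws \<in> e} \<subseteq> {{hd ws, ws ! 1}}"
    using deg card_mono[of "{{hd ws, ws ! 1}}" "{e \<in> edges G. hd ws \<in> e}"]
    unfolding degree_in_def by auto
  then obtain e where e: "e \<in> edges G" "hd ws \<in> e" "e \<noteq> {hd ws, ws ! 1}" by auto
  obtain y where y: "e = {hd ws, y}" "y \<noteq> hd ws" using edge_obtain[OF G e(1,2)] by metis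
  have "y \<in> set ws" using longest_path_hd_neighbour[OF G ws] e(1) y(1) by simp
  then obtain i where i: "i < length ws" "y = ws ! i" by (auto simp: in_set_conv_nth)
  have "i \<noteq> 0" using y(2) i(2) ne by (metis hd_conv_nth)
  moreover have "i \<noteq> 1" using e(3) y(1) i(2) by auto
  ultimately show ?thesis using that[of i] i e(1) y(1) by auto
qed

text \<open>A longest path whose ends are adjacent is a cycle with one edge left out, and it may be
  cut open one step further on.\<close>

lemma longest_path_rotate1:
  assumes ws: "longest_path G ws" and e: "{last ws, hd ws} \<in> edges G"
  shows "longest_path G (rotate1 ws)"
proof (cases ws)
  case (Cons w zs)
  have "path_edges (zs @ [w]) \<subseteq> edges G"
    using ws e Cons unfolding longest_path_def graph_path_def
    by (cases "zs = []") (auto simp: path_edges_snoc path_edges_Cons)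
  then show ?thesis
    using ws Cons unfolding longest_path_def graph_path_def by auto
qed (use ws in \<open>auto simp: longest_path_def graph_path_def\<close>)

text \<open>Each end has a chord; the excluded pair is the case in which both chords are the one
  edge joining the ends. If only this case occurred, every longest path would close up to a cycle,
  and so would all its rotations. Each of its vertices would then be the head of a longest path and
  have degree at most 2, and no edge would leave the cycle. By connectedness the cycle would be the
  whole graph, against |E| = |V| + 1.\<close>

lemma longest_path_two_chords:
  assumes G: "bicyclic G" and deg: "\<And>x. x \<in> verts G \<Longrightarrow> 2 \<le> degree_in G x"
  obtains ws i j where "longest_path G ws" "2 \<le> i" "i < length ws" "j + 2 < length ws"
    "\<not> (i = length ws - 1 \<and> j = 0)"
    "{hd ws, ws ! i} \<in> edges G" "{last ws, ws ! j} \<in> edges G"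
proof (rule ccontr)
  assume "\<not> thesis"
  with that have none: "\<And>ws i j. longest_path G ws \<Longrightarrow> 2 \<le> i \<Longrightarrow> i < length ws \<Longrightarrow>
    j + 2 < length ws \<Longrightarrow> {hd ws, ws ! i} \<in> edges G \<Longrightarrow> {last ws, ws ! j} \<in> edges G \<Longrightarrow>
    i = length ws - 1 \<and> j = 0" by blast
  have wG: "weighted_graph G" and conn: "connected_graph G"
    and cE: "card (edges G) = card (verts G) + 1" using G unfolding bicyclic_def by auto
  have finV: "finite (verts G)" using wG by (simp add: weighted_graph_def)
  have finE: "finite (edges G)" using wG by (rule finite_edges)
  have inV: "hd ws \<in> verts G" "last ws \<in> verts G" if "longest_path G ws" for ws
    using that unfolding longest_path_def graph_path_def by auto
  \<comment> \<open>The closing edge serves as chord at the last vertex; any further chord at the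
    head would form an admissible pair with it.\<close>
  have cyc: "{last ws, hd ws} \<in> edges G \<and> degree_in G (hd ws) \<le> 2" if ws: "longest_path G ws" for ws
  proof -
    have ne: "ws \<noteq> []" using ws unfolding longest_path_def graph_path_def by auto
    obtain i where i: "2 \<le> i" "i < length ws" "{hd ws, ws ! i} \<in> edges G"
      using longest_path_hd_chord[OF wG ws deg[OF inV(1)[OF ws]]] .
    obtain j' where j': "2 \<le> j'" "j' < length (rev ws)" "{hd (rev ws), rev ws ! j'} \<in> edges G"
      using longest_path_hd_chord[OF wG longest_path_rev[OF ws]] deg[OF inV(2)[OF ws]] ne
      by (metis hd_rev)
    define j where "j = length ws - 1 - j'"
    have j: "j + 2 < length ws" "{last ws, ws ! j} \<in> edges G"
      using j' ne by (auto simp: j_def rev_nth hd_rev)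
    have j0: "j = 0" using none[OF ws i(1,2) j(1) i(3) j(2)] by simp
    have last0: "{last ws, hd ws} \<in> edges G" using j(2) j0 ne by (simp add: hd_conv_nth)
    have "{e \<in> edges G. hd ws \<in> e} \<subseteq> {{hd ws, ws ! 1}, {hd ws, last ws}}"
    proof
      fix e assume "e \<in> {e \<in> edges G. hd ws \<in> e}"
      then have e: "e \<in> edges G" "hd ws \<in> e" by auto
      obtain y where y: "e = {hd ws, y}" "y \<noteq> hd ws" using edge_obtain[OF wG e] by metis
      have "y \<in> set ws" using longest_path_hd_neighbour[OF wG ws] e(1) y(1) by simp
      then obtain m where m: "m < length ws" "y = ws ! m" by (auto simp: in_set_conv_nth)
      have "m \<noteq> 0" using y(2) m(2) ne by (metis hd_conv_nth)
      then consider "m = 1" | "2 \<le> m" by linarith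
      then show "e \<in> {{hd ws, ws ! 1}, {hd ws, last ws}}"
      proof cases
        case 2
        then have "m = length ws - 1" using none[OF ws 2 m(1) j(1) _ j(2)] e(1) y(1) m(2) by simp
        then show ?thesis using y m ne by (simp add: last_conv_nth)
      qed (use y m in auto)
    qed
    then have "degree_in G (hd ws) \<le> card {{hd ws, ws ! 1}, {hd ws, last ws}}"
      unfolding degree_in_def by (intro card_mono) auto
    also have "\<dots> \<le> 2" by (rule card_insert_le_m1) auto
    finally show ?thesis using last0 by simp
  qed
  obtain ws where ws: "longest_path G ws"
    using longest_path_exists[OF finV] conn unfolding connected_graph_def by blast
  have rot: "longest_path G (rotate m ws)" for m
    by (induction m) (use ws cyc longest_path_rotate1 in auto)
  have ne: "ws \<noteq> []" using ws unfolding longest_path_def graph_path_def by auto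
  have mem: "\<exists>m. x = hd (rotate m ws)" if "x \<in> set ws" for x
  proof -
    obtain m where "m < length ws" "x = ws ! m" using \<open>x \<in> set ws\<close> by (auto simp: in_set_conv_nth)
    then show ?thesis using ne by (intro exI[of _ m]) (simp add: hd_rotate_conv_nth)
  qed
  have "set ws = verts G"
  proof (rule connected_closed_eq[OF conn])
    show "set ws \<subseteq> verts G" "set ws \<noteq> {}" using ws unfolding longest_path_def graph_path_def by auto
    fix x y assume "x \<in> set ws" "{x, y} \<in> edges G"
    then show "y \<in> set ws"
      using mem longest_path_hd_neighbour[OF wG rot, of _ y] by fastforce
  qed
  then have "degree_in G x \<le> 2" if "x \<in> verts G" for x
    using that mem cyc[OF rot] by metis
  then have "(\<Sum>x\<in>verts G. degree_in G x) \<le> (\<Sum>x\<in>verts G. 2)" by (intro sum_mono) auto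
  moreover have "(\<Sum>x\<in>verts G. degree_in G x) = 2 * card (edges G)"
    unfolding degree_in_def using wG by (intro sum_degrees finV finE) (auto simp: weighted_graph_def)
  ultimately show False using cE by simp
qed

text \<open>Degree 1 is excluded by the absence of pendant vertices. A vertex of degree 0 would, by
  connectedness, be the only one, and the graph would have no edges against |E| = |V| + 1.\<close>

lemma degree_ge_two:
  assumes G: "bicyclic G" and pend: "\<not> (\<exists>x. pendant G x)" and x: "x \<in> verts G"
  shows "2 \<le> degree_in G x"
proof -
  have wG: "weighted_graph G" and conn: "connected_graph G"
    and cE: "card (edges G) = card (verts G) + 1" using G unfolding bicyclic_def by auto
  have "degree_in G x \<noteq> 0"
  proof
    assume "degree_in G x = 0"
    then have no: "x \<notin> e" if "e \<in> edges G" for e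
      using that finite_edges[OF wG] unfolding degree_in_def by auto
    have "{x} = verts G"
      by (rule connected_closed_eq[OF conn]) (use x no in auto)
    then have "edges G = {}" using no wG unfolding weighted_graph_def
      by (metis all_not_in_conv card.empty numeral_2_eq_2 old.nat.distinct(1) subset_singleton_iff singletonI)
    then show False using cE by simp
  qed
  moreover have "degree_in G x \<noteq> 1" using pend x unfolding pendant_def by auto
  ultimately show ?thesis by simp
qed

text \<open>Degrees sum to \<open>2 |V| + 2\<close> and are at least 2, while a longest path with a chord at each
  end already has degree sum \<open>2 |S| + 2\<close> on its vertex set \<open>S\<close>; so no edge leaves it.\<close>

theorem bicyclic_normal_form:
  assumes G: "bicyclic G" and pend: "\<not> (\<exists>x. pendant G x)"
  obtains ws i j where "distinct ws" "set ws = verts G" "2 \<le> i" "i < length ws" "j + 2 < length ws"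
    "\<not> (i = length ws - 1 \<and> j = 0)"
    "edges G = {{hd ws, ws ! i}, {last ws, ws ! j}} \<union> path_edges ws"
proof -
  have wG: "weighted_graph G" and conn: "connected_graph G"
    and cE: "card (edges G) = card (verts G) + 1" using G unfolding bicyclic_def by auto
  have finV: "finite (verts G)" using wG by (simp add: weighted_graph_def)
  have finE: "finite (edges G)" using wG by (rule finite_edges)
  note deg = degree_ge_two[OF G pend]
  obtain ws i j where ws: "longest_path G ws" and ij: "2 \<le> i" "i < length ws" "j + 2 < length ws"
    "\<not> (i = length ws - 1 \<and> j = 0)"
    and ch: "{hd ws, ws ! i} \<in> edges G" "{last ws, ws ! j} \<in> edges G"
    using longest_path_two_chords[OF G deg] by blast
  have ne: "ws \<noteq> []" and dist: "distinct ws" and sub: "set ws \<subseteq> verts G"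
    and pE: "path_edges ws \<subseteq> edges G"
    using ws unfolding longest_path_def graph_path_def by auto
  define S where "S = set ws"
  define F where "F = {{hd ws, ws ! i}, {last ws, ws ! j}} \<union> path_edges ws"
  have FE: "F \<subseteq> edges G" unfolding F_def using ch pE by auto
  have hl: "hd ws = ws ! 0" "last ws = ws ! (length ws - 1)"
    using ne by (auto simp: hd_conv_nth last_conv_nth)
  have eqi: "ws ! a = ws ! b \<longleftrightarrow> a = b" if "a < length ws" "b < length ws" for a b
    using nth_eq_iff_index_eq[OF dist that] .
  have n1: "{hd ws, ws ! i} \<notin> path_edges ws"
    unfolding path_edges_nth hl using ij ne by (auto simp: doubleton_eq_iff eqi)
  have n2: "{last ws, ws ! j} \<notin> path_edges ws"
    unfolding path_edges_nth hl using ij ne by (auto simp: doubleton_eq_iff eqi)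
  have n3: "{hd ws, ws ! i} \<noteq> {last ws, ws ! j}"
    unfolding hl using ij ne by (auto simp: doubleton_eq_iff eqi)
  \<comment> \<open>The path has |S| - 1 edges, and the index bounds on \<open>i\<close> and
    \<open>j\<close> make the two chords new and distinct from each other.\<close>
  have cF: "card F = card S + 1"
    unfolding F_def S_def using n1 n2 n3 ij by (simp add: card_path_edges[OF dist] distinct_card[OF dist])
  have FS: "e \<subseteq> S \<and> card e = 2" if "e \<in> F" for e
  proof
    show "card e = 2" using that FE wG unfolding weighted_graph_def by auto
    show "e \<subseteq> S" using that ij path_edges_subset[of e ws] ne unfolding F_def S_def by auto
  qed
  have finS: "finite S" "finite F" unfolding S_def F_def by auto
  have SV: "S \<subseteq> verts G" using sub S_def by simp
  have sumF: "(\<Sum>x\<in>S. card {e \<in> F. x \<in> e}) = 2 * card S + 2"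
    using sum_degrees[OF finS FS] cF by simp
  have le: "card {e \<in> F. x \<in> e} \<le> degree_in G x" for x
    unfolding degree_in_def using FE finE by (intro card_mono) auto
  have "(\<Sum>x\<in>verts G. degree_in G x) = 2 * card (verts G) + 2"
    unfolding degree_in_def using sum_degrees[OF finV finE] wG cE by (simp add: weighted_graph_def)
  moreover have "(\<Sum>x\<in>verts G. degree_in G x)
      = (\<Sum>x\<in>verts G - S. degree_in G x) + (\<Sum>x\<in>S. degree_in G x)"
    by (rule sum.subset_diff[OF SV finV])
  moreover have "2 * card (verts G - S) \<le> (\<Sum>x\<in>verts G - S. degree_in G x)"
    using sum_mono[of "verts G - S" "\<lambda>_. 2" "degree_in G"] deg by simp
  moreover have "card (verts G) = card (verts G - S) + card S"
    using SV finV finS(1) by (simp add: card_Diff_subset card_mono)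
  ultimately have "(\<Sum>x\<in>S. degree_in G x) \<le> (\<Sum>x\<in>S. card {e \<in> F. x \<in> e})"
    unfolding sumF by linarith
  then have eq: "(\<Sum>x\<in>S. card {e \<in> F. x \<in> e}) = (\<Sum>x\<in>S. degree_in G x)"
    using sum_mono[of S, OF le] by (simp add: le_antisym)
  have deq: "card {e \<in> F. x \<in> e} = degree_in G x" if "x \<in> S" for x
    using sum_mono_inv[OF eq le that finS(1)] .
  have inc: "e \<in> F" if "e \<in> edges G" "x \<in> e" "x \<in> S" for e x
  proof -
    have "{e \<in> F. x \<in> e} = {e \<in> edges G. x \<in> e}"
      using deq[OF that(3)] FE finE unfolding degree_in_def by (intro card_subset_eq) auto
    then show ?thesis using that by auto
  qed
  have "S = verts G"
  proof (rule connected_closed_eq[OF conn SV])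
    show "S \<noteq> {}" using ne S_def by simp
    fix x y assume "x \<in> S" "{x, y} \<in> edges G"
    then show "y \<in> S" using inc[of "{x, y}" x] FS[of "{x, y}"] by auto
  qed
  moreover have "edges G = F"
  proof
    show "edges G \<subseteq> F"
    proof
      fix e assume e: "e \<in> edges G"
      then obtain x where "x \<in> e" "e \<subseteq> verts G" using wG unfolding weighted_graph_def
        by (metis card.empty ex_in_conv zero_neq_numeral)
      then show "e \<in> F" using inc[OF e] \<open>S = verts G\<close> by auto
    qed
  qed fact
  ultimately show ?thesis using that[OF dist _ ij] unfolding S_def F_def by simp
qed

subsection \<open>The eight families\<close>

text \<open>Listing the vertices of \<open>H\<close> as images of those of \<open>G\<close> produces
  the same adjacency matrix: \<open>wgraph_iso\<close> controls weights on edges, and these are what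
  \<open>adj_entry\<close> reads.\<close>

lemma i_plus_iso:
  assumes fin: "finite (verts G)" and iso: "wgraph_iso G H"
  shows "i_plus G = i_plus H"
proof -
  obtain f where f: "bij_betw f (verts G) (verts H)"
    and e: "\<And>x y. x \<in> verts G \<Longrightarrow> y \<in> verts G \<Longrightarrow> {x, y} \<in> edges G \<longleftrightarrow> {f x, f y} \<in> edges H"
    "\<And>x y. x \<in> verts G \<Longrightarrow> y \<in> verts G \<Longrightarrow> {x, y} \<in> edges G \<Longrightarrow> wt G {x, y} = wt H {f x, f y}"
    using iso unfolding wgraph_iso_def by blast
  obtain xs where xs: "distinct xs" "set xs = verts G" using finite_distinct_list[OF fin] by auto
  have "distinct (map f xs)" "set (map f xs) = verts H"
    using f xs by (auto simp: distinct_map bij_betw_def)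
  moreover have "adj_entry G x y = adj_entry H (f x) (f y)" if "x \<in> verts G" "y \<in> verts G" for x y
    using e[OF that] by (auto simp: adj_entry_def)
  then have "adj_mat G xs = adj_mat H (map f xs)"
    unfolding adj_mat_def xs(2)[symmetric] by (intro eq_matI) auto
  ultimately show ?thesis using i_plus_eq[OF xs] i_plus_eq[of "map f xs" H] by simp
qed

lemma adj_entry_wgraph_of:
  "adj_entry (wgraph_of es) x y = (case map_of es {x, y} of None \<Rightarrow> 0 | Some w \<Rightarrow> w)"
  by (auto simp: adj_entry_def wgraph_of_def split: option.splits simp: map_of_eq_None_iff
      dest: map_of_SomeD intro: rev_image_eqI)

lemma weighted_graph_wgraph_of:
  assumes "\<forall>(e, w)\<in>set es. card e = 2 \<and> 0 < w"
  shows "weighted_graph (wgraph_of es)"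
proof -
  have "0 < the (map_of es e)" if "(e, w) \<in> set es" for e w
  proof -
    obtain w' where "map_of es e = Some w'"
      using weak_map_of_SomeI[OF \<open>(e, w) \<in> set es\<close>] by auto
    then show ?thesis using assms by (auto dest: map_of_SomeD)
  qed
  moreover have "finite e" if "(e, w) \<in> set es" for e w
    using assms that by (metis (mono_tags, lifting) card.infinite case_prodD zero_neq_numeral)
  moreover have "card e = 2" if "(e, w) \<in> set es" for e w
    using assms that by auto
  ultimately have "finite (verts (wgraph_of es))"
    "\<And>e. e \<in> edges (wgraph_of es) \<Longrightarrow>
      e \<subseteq> verts (wgraph_of es) \<and> card e = 2 \<and> 0 < wt (wgraph_of es) e"
    unfolding wgraph_of_def by auto
  then show ?thesis unfolding weighted_graph_def by blast
qed

text \<open>The double sum meets each edge in both orders, hence the factor 2. Distinct keys let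
  \<open>map_of\<close> be replaced by a sum over the list.\<close>

lemma qform_wgraph_of:
  assumes "distinct (map fst es)" "\<forall>(e, w)\<in>set es. card e = 2"
  shows "qform (wgraph_of es) f f = 2 * (\<Sum>(e, w)\<leftarrow>es. w * prod f e)"
proof -
  let ?V = "verts (wgraph_of es)"
  have fin_e: "finite e" if "(e, w) \<in> set es" for e w
    using assms(2) that by (metis (mono_tags, lifting) card.infinite case_prodD zero_neq_numeral)
  have fin: "finite ?V" unfolding wgraph_of_def using fin_e by auto
  have adj: "adj_entry (wgraph_of es) x y = (\<Sum>(e, w)\<leftarrow>es. if {x, y} = e then w else 0)" for x y
    unfolding adj_entry_wgraph_of using assms(1)
  proof (induction es)
    case (Cons p es)
    have "(\<Sum>(e, w)\<leftarrow>es. if {x, y} = e then w else 0) = 0" if "{x, y} \<notin> fst ` set es"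
      using that by (induction es) (simp_all add: case_prod_beta)
    then show ?case using Cons by (cases p) auto
  qed simp
  have one: "(\<Sum>x\<in>?V. \<Sum>y\<in>?V. (if {x, y} = e then w else 0) * f x * f y) = 2 * (w * prod f e)"
    if ew: "(e, w) \<in> set es" for e w
  proof -
    obtain p q where pq: "e = {p, q}" "p \<noteq> q" using assms(2) ew by (fastforce simp: card_2_iff)
    have V: "p \<in> ?V" "q \<in> ?V" unfolding wgraph_of_def using ew pq(1) by force+
    have "(\<Sum>y\<in>?V. (if {x, y} = e then w else 0) * f x * f y)
        = (if x = p then w * f p * f q else 0) + (if x = q then w * f p * f q else 0)" for x
    proof -
      have "(\<Sum>y\<in>?V. (if {x, y} = e then w else 0) * f x * f y)
          = (\<Sum>y\<in>?V. (if y = q then if x = p then w * f p * f q else 0 else 0)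
            + (if y = p then if x = q then w * f p * f q else 0 else 0))"
        using pq by (intro sum.cong) (auto simp: doubleton_eq_iff)
      then show ?thesis using V fin by (simp add: sum.distrib)
    qed
    then show ?thesis using V fin pq by (simp add: sum.distrib)
  qed
  have swap: "(\<Sum>x\<in>V. \<Sum>y\<in>V. \<Sum>(e, w)\<leftarrow>ls. (if {x, y} = e then w else 0) * f x * f y)
      = (\<Sum>(e, w)\<leftarrow>ls. \<Sum>x\<in>V. \<Sum>y\<in>V. (if {x, y} = e then w else 0) * f x * f y)" for V ls
    by (induction ls) (auto simp: sum.distrib)
  have "qform (wgraph_of es) f f
      = (\<Sum>x\<in>?V. \<Sum>y\<in>?V. \<Sum>(e, w)\<leftarrow>es. (if {x, y} = e then w else 0) * f x * f y)"
    unfolding qform_def adj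
    by (intro sum.cong refl) (simp add: sum_list_mult_const[symmetric] case_prod_unfold)
  also have "\<dots> = (\<Sum>(e, w)\<leftarrow>es. \<Sum>x\<in>?V. \<Sum>y\<in>?V. (if {x, y} = e then w else 0) * f x * f y)"
    by (rule swap)
  also have "\<dots> = (\<Sum>(e, w)\<leftarrow>es. 2 * (w * prod f e))"
    by (intro arg_cong[of _ _ sum_list] map_cong refl) (use one in auto)
  also have "\<dots> = 2 * (\<Sum>(e, w)\<leftarrow>es. w * prod f e)"
    by (simp add: sum_list_const_mult case_prod_unfold)
  finally show ?thesis .
qed

lemma i_plus_le_1:
  assumes "finite (verts G)" and "\<And>f g s. l (\<lambda>x. s * f x + g x) = s * l f + l g"
    and "\<And>f. l f = 0 \<Longrightarrow> qform G f f \<le> 0"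
  shows "i_plus G \<le> 1"
  using i_plus_le_card[of G "{()}" "\<lambda>_. l"] assms by simp

text \<open>The two functionals are indexed by \<open>bool\<close>, so the bound is 2 even if they
  coincide.\<close>

lemma i_plus_le_2:
  assumes "finite (verts G)"
    and "\<And>f g s. l (\<lambda>x. s * f x + g x) = s * l f + l g"
    and "\<And>f g s. m (\<lambda>x. s * f x + g x) = s * m f + m g"
    and "\<And>f. l f = 0 \<Longrightarrow> m f = 0 \<Longrightarrow> qform G f f \<le> 0"
  shows "i_plus G \<le> 2"
proof -
  have "i_plus G \<le> card (UNIV :: bool set)"
  proof (rule i_plus_le_card[OF assms(1), where l = "\<lambda>b. if b then l else m"])
    fix f assume "\<forall>k\<in>UNIV. (if k then l else m) f = 0"
    then have "l f = 0" "m f = 0" by (metis UNIV_I)+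
    then show "qform G f f \<le> 0" by (rule assms(4))
  qed (simp_all add: assms(2,3))
  then show ?thesis by simp
qed

section \<open>The eight graphs as explicit edge lists\<close>

lemma upt_small: "[1..<2] = [1]" "[1..<3] = [1, 2]" "[1..<4] = [1, 2, 3]" "[1..<5] = [1, 2, 3, 4]"
  by (simp_all add: upt_rec numeral_eq_Suc)

lemma infty_3_1_3_eq: "infty_graph 3 1 3 a b c = wgraph_of
  [({IV 1, IX 1}, a 1), ({IX 1, IX 2}, a 2), ({IX 2, IV 1}, a 3),
   ({IV 1, IY 1}, b 1), ({IY 1, IY 2}, b 2), ({IY 2, IV 1}, b 3)]"
  by (simp add: infty_graph_def walk_edges_def upt_small[simplified] numeral_eq_Suc)

lemma infty_3_2_3_eq: "infty_graph 3 2 3 a b c = wgraph_of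
  [({IV 1, IX 1}, a 1), ({IX 1, IX 2}, a 2), ({IX 2, IV 1}, a 3),
   ({IV 2, IY 1}, b 1), ({IY 1, IY 2}, b 2), ({IY 2, IV 2}, b 3), ({IV 1, IV 2}, c 1)]"
  by (simp add: infty_graph_def walk_edges_def upt_small[simplified] numeral_eq_Suc)

lemma infty_3_1_4_eq: "infty_graph 3 1 4 a b c = wgraph_of
  [({IV 1, IX 1}, a 1), ({IX 1, IX 2}, a 2), ({IX 2, IV 1}, a 3),
   ({IV 1, IY 1}, b 1), ({IY 1, IY 2}, b 2), ({IY 2, IY 3}, b 3), ({IY 3, IV 1}, b 4)]"
  by (simp add: infty_graph_def walk_edges_def upt_small[simplified] numeral_eq_Suc)

lemma infty_4_1_4_eq: "infty_graph 4 1 4 a b c = wgraph_of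
  [({IV 1, IX 1}, a 1), ({IX 1, IX 2}, a 2), ({IX 2, IX 3}, a 3), ({IX 3, IV 1}, a 4),
   ({IV 1, IY 1}, b 1), ({IY 1, IY 2}, b 2), ({IY 2, IY 3}, b 3), ({IY 3, IV 1}, b 4)]"
  by (simp add: infty_graph_def walk_edges_def upt_small[simplified] numeral_eq_Suc)

lemma theta_1_1_1_eq: "theta_graph 1 1 1 a b c = wgraph_of
  [({TU, TX 1}, a 1), ({TX 1, TV}, a 2), ({TU, TY 1}, b 1), ({TY 1, TV}, b 2),
   ({TU, TZ 1}, c 1), ({TZ 1, TV}, c 2)]"
  by (simp add: theta_graph_def walk_edges_def upt_small[simplified] numeral_eq_Suc)

lemma theta_1_0_1_eq: "theta_graph 1 0 1 a b c = wgraph_of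
  [({TU, TX 1}, a 1), ({TX 1, TV}, a 2), ({TU, TV}, b 1), ({TU, TZ 1}, c 1), ({TZ 1, TV}, c 2)]"
  by (simp add: theta_graph_def walk_edges_def upt_small[simplified] numeral_eq_Suc)

lemma theta_1_0_2_eq: "theta_graph 1 0 2 a b c = wgraph_of
  [({TU, TX 1}, a 1), ({TX 1, TV}, a 2), ({TU, TV}, b 1),
   ({TU, TZ 1}, c 1), ({TZ 1, TZ 2}, c 2), ({TZ 2, TV}, c 3)]"
  by (simp add: theta_graph_def walk_edges_def upt_small[simplified] numeral_eq_Suc)

lemma theta_2_0_2_eq: "theta_graph 2 0 2 a b c = wgraph_of
  [({TU, TX 1}, a 1), ({TX 1, TX 2}, a 2), ({TX 2, TV}, a 3), ({TU, TV}, b 1),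
   ({TU, TZ 1}, c 1), ({TZ 1, TZ 2}, c 2), ({TZ 2, TV}, c 3)]"
  by (simp add: theta_graph_def walk_edges_def upt_small[simplified] numeral_eq_Suc)

lemma pos_weights_small:
  "pos_weights (Suc 0) a \<longleftrightarrow> 0 < a (Suc 0)"
  "pos_weights 0 a \<longleftrightarrow> True"
  "pos_weights 1 a \<longleftrightarrow> 0 < a 1"
  "pos_weights 2 a \<longleftrightarrow> 0 < a 1 \<and> 0 < a 2"
  "pos_weights 3 a \<longleftrightarrow> 0 < a 1 \<and> 0 < a 2 \<and> 0 < a 3"
  "pos_weights 4 a \<longleftrightarrow> 0 < a 1 \<and> 0 < a 2 \<and> 0 < a 3 \<and> 0 < a 4"
proof -
  have s: "{1..1::nat} = {1}" "{1..2::nat} = {1, 2}" "{1..3::nat} = {1, 2, 3}" "{1..4::nat} = {1, 2, 3, 4}"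
    by auto
  show "pos_weights (Suc 0) a \<longleftrightarrow> 0 < a (Suc 0)" "pos_weights 0 a \<longleftrightarrow> True" "pos_weights 1 a \<longleftrightarrow> 0 < a 1"
    "pos_weights 2 a \<longleftrightarrow> 0 < a 1 \<and> 0 < a 2"
    "pos_weights 3 a \<longleftrightarrow> 0 < a 1 \<and> 0 < a 2 \<and> 0 < a 3"
    "pos_weights 4 a \<longleftrightarrow> 0 < a 1 \<and> 0 < a 2 \<and> 0 < a 3 \<and> 0 < a 4"
    unfolding pos_weights_def s by auto
qed

section \<open>Inertia of the eight graphs\<close>

text \<open>Half the form of a triangle, times \<open>a2\<close>, is (a2 x1 + a3 v)(a2 x2 + a1 v) -
  a1 a3 v^2. The hypothesis says that the two factors add up to 0, so their product is minus a
  square.\<close>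

lemma triangle_form_le:
  fixes a1 a2 a3 v x1 x2 :: real
  assumes "a2 * (x1 + x2) + (a1 + a3) * v = 0"
  shows "a2 * (a1 * (v * x1) + a2 * (x1 * x2) + a3 * (x2 * v)) \<le> - (a1 * a3 * v\<^sup>2)"
proof -
  have eq: "a2 * x2 + a1 * v = - (a2 * x1 + a3 * v)" using assms by (simp add: algebra_simps)
  have "a2 * (a1 * (v * x1) + a2 * (x1 * x2) + a3 * (x2 * v))
      = (a2 * x1 + a3 * v) * (a2 * x2 + a1 * v) - a1 * a3 * v\<^sup>2"
    by (simp add: algebra_simps power2_eq_square)
  also have "\<dots> = - (a2 * x1 + a3 * v)\<^sup>2 - a1 * a3 * v\<^sup>2"
    unfolding eq by (simp add: power2_eq_square algebra_simps)
  finally have "a2 * (a1 * (v * x1) + a2 * (x1 * x2) + a3 * (x2 * v))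
      = - (a2 * x1 + a3 * v)\<^sup>2 - a1 * a3 * v\<^sup>2" .
  then show ?thesis using zero_le_power2[of "a2 * x1 + a3 * v"] by linarith
qed

text \<open>When the products of opposite weights agree, half the form of a four-cycle is, up to the
  factor \<open>b2\<close>, a product of two linear forms; the first hypothesis annihilates one of
  them.\<close>

lemma square_form_eq_0:
  fixes b1 b2 b3 b4 v y1 y2 y3 :: real
  assumes "b2 * y1 + b3 * y3 = 0" "b1 * b3 = b2 * b4" "b2 \<noteq> 0"
  shows "b1 * (v * y1) + b2 * (y1 * y2) + b3 * (y2 * y3) + b4 * (y3 * v) = 0"
proof -
  have "b2 * (b1 * (v * y1) + b2 * (y1 * y2) + b3 * (y2 * y3) + b4 * (y3 * v))
      = (b2 * y1 + b3 * y3) * (b2 * y2 + b1 * v) + (b2 * b4 - b1 * b3) * (y3 * v)"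
    by (simp add: algebra_simps)
  then show ?thesis using assms by simp
qed

lemmas wgraph_simps = adj_entry_wgraph_of doubleton_eq_iff

lemma verts_wgraph_of: "verts (wgraph_of es) = \<Union> (fst ` set es)"
  by (simp add: wgraph_of_def)

lemma finite_verts: "weighted_graph G \<Longrightarrow> finite (verts G)"
  by (simp add: weighted_graph_def)

text \<open>One functional per triangle suffices, as the terms left over at the common vertex are
  nonpositive. Conversely \<open>IX 1 IX 2\<close> and \<open>IY 1 IY 2\<close> are two edges with
  no edge between them.\<close>

lemma i_plus_infty_3_1_3:
  assumes "pos_weights 3 a" "pos_weights 3 b"
  shows "i_plus (infty_graph 3 1 3 a b c) = 2"
proof -
  have pos: "0 < a 1" "0 < a 2" "0 < a 3" "0 < b 1" "0 < b 2" "0 < b 3"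
    using assms by (auto simp: pos_weights_small)
  let ?H = "infty_graph 3 1 3 a b c"
  have wH: "weighted_graph ?H"
    unfolding infty_3_1_3_eq by (rule weighted_graph_wgraph_of) (use pos in auto)
  have "i_plus ?H \<le> 2"
  proof (rule i_plus_le_2[OF finite_verts[OF wH],
      of "\<lambda>f. a 2 * (f (IX 1) + f (IX 2)) + (a 1 + a 3) * f (IV 1)"
         "\<lambda>f. b 2 * (f (IY 1) + f (IY 2)) + (b 1 + b 3) * f (IV 1)"])
    fix f :: "infty_vertex \<Rightarrow> real"
    let ?A = "a 1 * (f (IV 1) * f (IX 1)) + a 2 * (f (IX 1) * f (IX 2)) + a 3 * (f (IX 2) * f (IV 1))"
    let ?B = "b 1 * (f (IV 1) * f (IY 1)) + b 2 * (f (IY 1) * f (IY 2)) + b 3 * (f (IY 2) * f (IV 1))"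
    assume "a 2 * (f (IX 1) + f (IX 2)) + (a 1 + a 3) * f (IV 1) = 0"
    from triangle_form_le[OF this] have "a 2 * ?A \<le> 0"
      using pos by (smt (verit) mult_nonneg_nonneg zero_le_power2)
    then have A: "?A \<le> 0" using pos by (simp add: mult_le_0_iff)
    assume "b 2 * (f (IY 1) + f (IY 2)) + (b 1 + b 3) * f (IV 1) = 0"
    from triangle_form_le[OF this] have "b 2 * ?B \<le> 0"
      using pos by (smt (verit) mult_nonneg_nonneg zero_le_power2)
    then have B: "?B \<le> 0" using pos by (simp add: mult_le_0_iff)
    have "qform ?H f f = 2 * (?A + ?B)"
      unfolding infty_3_1_3_eq by (subst qform_wgraph_of) (simp_all add: doubleton_eq_iff)
    then show "qform ?H f f \<le> 0" using A B by simp
  qed (simp_all add: algebra_simps)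
  moreover have "2 \<le> i_plus ?H"
    by (rule two_le_i_plus[OF wH, of "IX 1" "IY 1" "IX 2" "IY 2"])
      (use pos in \<open>unfold infty_3_1_3_eq, simp_all add: wgraph_simps verts_wgraph_of\<close>)
  ultimately show ?thesis by simp
qed

text \<open>Splitting off \<open>IX 1 IX 2\<close> and \<open>IY 1 IY 2\<close> leaves the binary
  form - (a1 a3 / a2) v^2 - (b1 b3 / b2) u^2 + c1 v u at the two vertices of the connecting edge.
  The condition says that its discriminant makes it nonpositive everywhere.\<close>

lemma i_plus_infty_3_2_3:
  assumes "pos_weights 3 a" "pos_weights 3 b" "pos_weights 1 c"
  shows "i_plus (infty_graph 3 2 3 a b c) = 2 \<longleftrightarrow>
    4 * a 1 * a 3 * b 1 * b 3 - a 2 * b 2 * (c 1)\<^sup>2 \<ge> 0"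
proof -
  have pos: "0 < a 1" "0 < a 2" "0 < a 3" "0 < b 1" "0 < b 2" "0 < b 3" "0 < c 1"
    using assms by (auto simp: pos_weights_small)
  let ?H = "infty_graph 3 2 3 a b c"
  have wH: "weighted_graph ?H"
    unfolding infty_3_2_3_eq by (rule weighted_graph_wgraph_of) (use pos in auto)
  have le: "i_plus ?H \<le> 2" if cond: "4 * a 1 * a 3 * b 1 * b 3 - a 2 * b 2 * (c 1)\<^sup>2 \<ge> 0"
  proof (rule i_plus_le_2[OF finite_verts[OF wH],
      of "\<lambda>f. a 2 * (f (IX 1) + f (IX 2)) + (a 1 + a 3) * f (IV 1)"
         "\<lambda>f. b 2 * (f (IY 1) + f (IY 2)) + (b 1 + b 3) * f (IV 2)"])
    fix f :: "infty_vertex \<Rightarrow> real"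
    let ?v = "f (IV 1)" and ?u = "f (IV 2)"
    define A where "A = a 1 * (?v * f (IX 1)) + a 2 * (f (IX 1) * f (IX 2)) + a 3 * (f (IX 2) * ?v)"
    define B where "B = b 1 * (?u * f (IY 1)) + b 2 * (f (IY 1) * f (IY 2)) + b 3 * (f (IY 2) * ?u)"
    assume "a 2 * (f (IX 1) + f (IX 2)) + (a 1 + a 3) * ?v = 0"
    from triangle_form_le[OF this] have A: "a 2 * A \<le> - (a 1 * a 3 * ?v\<^sup>2)" unfolding A_def .
    assume "b 2 * (f (IY 1) + f (IY 2)) + (b 1 + b 3) * ?u = 0"
    from triangle_form_le[OF this] have B: "b 2 * B \<le> - (b 1 * b 3 * ?u\<^sup>2)" unfolding B_def .
    \<comment> \<open>The coefficients of that binary form multiplied by - a2 b2. Nonnegativity then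
      follows by completing the square in the value at \<open>IV 1\<close>.\<close>
    define p where "p = a 1 * a 3 * b 2"
    define q where "q = b 1 * b 3 * a 2"
    define r where "r = a 2 * b 2 * c 1"
    have p: "0 < p" unfolding p_def using pos by simp
    have "4 * p * q - r\<^sup>2 = a 2 * b 2 * (4 * a 1 * a 3 * b 1 * b 3 - a 2 * b 2 * (c 1)\<^sup>2)"
      unfolding p_def q_def r_def by (simp add: algebra_simps power2_eq_square)
    then have disc: "0 \<le> 4 * p * q - r\<^sup>2" using cond pos by simp
    have "4 * p * (p * ?v\<^sup>2 + q * ?u\<^sup>2 - r * (?v * ?u)) = (2 * p * ?v - r * ?u)\<^sup>2 + (4 * p * q - r\<^sup>2) * ?u\<^sup>2"
      by (simp add: algebra_simps power2_eq_square)
    also have "\<dots> \<ge> 0" using disc by simp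
    finally have quad: "0 \<le> p * ?v\<^sup>2 + q * ?u\<^sup>2 - r * (?v * ?u)" using p by (simp add: zero_le_mult_iff)
    have "b 2 * (a 2 * A) \<le> b 2 * (- (a 1 * a 3 * ?v\<^sup>2))" "a 2 * (b 2 * B) \<le> a 2 * (- (b 1 * b 3 * ?u\<^sup>2))"
      using A B pos by (simp_all only: mult_le_cancel_left_pos)
    then have "a 2 * b 2 * (A + B + c 1 * (?v * ?u)) \<le> - (p * ?v\<^sup>2 + q * ?u\<^sup>2 - r * (?v * ?u))"
      unfolding p_def q_def r_def by (simp add: algebra_simps)
    then have "a 2 * b 2 * (A + B + c 1 * (?v * ?u)) \<le> 0" using quad by linarith
    then have le0: "A + B + c 1 * (?v * ?u) \<le> 0" using pos by (simp add: mult_le_0_iff zero_less_mult_iff)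
    have "qform ?H f f = 2 * (A + B + c 1 * (?v * ?u))"
      unfolding infty_3_2_3_eq A_def B_def by (subst qform_wgraph_of) (simp_all add: doubleton_eq_iff)
    then show "qform ?H f f \<le> 0" using le0 by simp
  qed (simp_all add: algebra_simps)
  have ge2: "2 \<le> i_plus ?H"
    by (rule two_le_i_plus[OF wH, of "IX 1" "IY 1" "IX 2" "IY 2"])
      (use pos in \<open>unfold infty_3_2_3_eq, simp_all add: wgraph_simps verts_wgraph_of\<close>)
  have ge3: "3 \<le> i_plus ?H" if cond: "4 * a 1 * a 3 * b 1 * b 3 - a 2 * b 2 * (c 1)\<^sup>2 < 0"
  proof -
    \<comment> \<open>The third row of \<open>F\<close> has the ratio v : u = r : 2 p at which the
      completed square above vanishes, so the negative discriminant remains. On the triangles it is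
      extended so that both factors of each triangle form are 0, which makes it orthogonal to the
      first two rows. Inside the graph the last \<open>else\<close> is the vertex
      \<open>IY 2\<close>.\<close>
    define \<gamma> where "\<gamma> = a 2 * b 2 * c 1"
    define \<alpha> where "\<alpha> = 2 * a 1 * a 2 * a 3"
    define m where "m = \<alpha> * (a 2 * b 2 * (a 2 * b 2 * (c 1)\<^sup>2 - 4 * a 1 * a 3 * b 1 * b 3))"
    define F where "F j =
      [\<lambda>x. if x = IX 1 \<or> x = IX 2 then 1 else 0,
       \<lambda>x. if x = IY 1 \<or> x = IY 2 then 1 else 0,
       \<lambda>x. if x = IV 1 then \<gamma> * a 2 else if x = IX 1 then - \<gamma> * a 3 else if x = IX 2 then - \<gamma> * a 1
         else if x = IV 2 then \<alpha> * b 2 else if x = IY 1 then - \<alpha> * b 3 else - \<alpha> * b 1] ! j" for j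
    have lt3: "(\<exists>j\<in>{..<3}. t j \<noteq> 0) \<longleftrightarrow> t 0 \<noteq> 0 \<or> t 1 \<noteq> 0 \<or> t 2 \<noteq> 0" for t :: "nat \<Rightarrow> real"
      by (auto simp: eval_nat_numeral lessThan_Suc)
    have sum3: "(\<Sum>j<3. f j) = f 0 + f 1 + f 2" for f :: "nat \<Rightarrow> real"
      by (simp add: eval_nat_numeral)
    have "card {..<3::nat} \<le> i_plus ?H"
    proof (rule card_le_i_plus[OF finite_verts[OF wH], where F = F])
      fix t :: "nat \<Rightarrow> real"
      assume t: "\<exists>j\<in>{..<3}. t j \<noteq> 0"
      define y where "y x = (\<Sum>j<3. t j * F j x)" for x
      have yv: "y (IV 1) = t 2 * (\<gamma> * a 2)" "y (IX 1) = t 0 - t 2 * (\<gamma> * a 3)"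
        "y (IX 2) = t 0 - t 2 * (\<gamma> * a 1)" "y (IV 2) = t 2 * (\<alpha> * b 2)"
        "y (IY 1) = t 1 - t 2 * (\<alpha> * b 3)" "y (IY 2) = t 1 - t 2 * (\<alpha> * b 1)"
        by (simp_all add: y_def sum3 F_def)
      have "qform ?H y y = 2 * (a 1 * (y (IV 1) * y (IX 1)) + a 2 * (y (IX 1) * y (IX 2))
          + a 3 * (y (IX 2) * y (IV 1)) + b 1 * (y (IV 2) * y (IY 1)) + b 2 * (y (IY 1) * y (IY 2))
          + b 3 * (y (IY 2) * y (IV 2)) + c 1 * (y (IV 1) * y (IV 2)))"
        unfolding infty_3_2_3_eq by (subst qform_wgraph_of) (simp_all add: doubleton_eq_iff)
      also have "\<dots> = 2 * a 2 * (t 0)\<^sup>2 + 2 * b 2 * (t 1)\<^sup>2 + m * (t 2)\<^sup>2"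
        unfolding yv m_def \<alpha>_def \<gamma>_def by (simp add: power2_eq_square algebra_simps)
      finally have eq: "qform ?H y y = 2 * a 2 * (t 0)\<^sup>2 + 2 * b 2 * (t 1)\<^sup>2 + m * (t 2)\<^sup>2" .
      have m: "0 < m" unfolding m_def \<alpha>_def using pos cond by simp
      have "0 \<le> 2 * a 2 * (t 0)\<^sup>2" "0 \<le> 2 * b 2 * (t 1)\<^sup>2" "0 \<le> m * (t 2)\<^sup>2"
        "t 0 \<noteq> 0 \<Longrightarrow> 0 < 2 * a 2 * (t 0)\<^sup>2" "t 1 \<noteq> 0 \<Longrightarrow> 0 < 2 * b 2 * (t 1)\<^sup>2"
        "t 2 \<noteq> 0 \<Longrightarrow> 0 < m * (t 2)\<^sup>2"
        using pos m by simp_all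
      then have "0 < qform ?H y y" using t unfolding lt3 eq by linarith
      then show "0 < qform ?H (\<lambda>x. \<Sum>j<3. t j * F j x) (\<lambda>x. \<Sum>j<3. t j * F j x)"
        unfolding y_def .
    qed simp
    then show ?thesis by simp
  qed
  show ?thesis using le ge2 ge3 by fastforce
qed

text \<open>The four-cycle costs a single functional exactly when its form factors. Otherwise the
  determinant between \<open>IX 1\<close>, \<open>IY 1\<close>, \<open>IY 3\<close> and
  \<open>IX 2\<close>, \<open>IY 2\<close>, \<open>IV 1\<close> is a2 (b2 b4 - b1 b3), which is
  nonzero.\<close>

lemma i_plus_infty_3_1_4:
  assumes "pos_weights 3 a" "pos_weights 4 b"
  shows "i_plus (infty_graph 3 1 4 a b c) = 2 \<longleftrightarrow> b 1 * b 3 = b 2 * b 4"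
proof -
  have pos: "0 < a 1" "0 < a 2" "0 < a 3" "0 < b 1" "0 < b 2" "0 < b 3" "0 < b 4"
    using assms by (auto simp: pos_weights_small)
  let ?H = "infty_graph 3 1 4 a b c"
  have wH: "weighted_graph ?H"
    unfolding infty_3_1_4_eq by (rule weighted_graph_wgraph_of) (use pos in auto)
  have le: "i_plus ?H \<le> 2" if cond: "b 1 * b 3 = b 2 * b 4"
  proof (rule i_plus_le_2[OF finite_verts[OF wH],
      of "\<lambda>f. a 2 * (f (IX 1) + f (IX 2)) + (a 1 + a 3) * f (IV 1)"
         "\<lambda>f. b 2 * f (IY 1) + b 3 * f (IY 3)"])
    fix f :: "infty_vertex \<Rightarrow> real"
    let ?A = "a 1 * (f (IV 1) * f (IX 1)) + a 2 * (f (IX 1) * f (IX 2)) + a 3 * (f (IX 2) * f (IV 1))"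
    let ?B = "b 1 * (f (IV 1) * f (IY 1)) + b 2 * (f (IY 1) * f (IY 2)) + b 3 * (f (IY 2) * f (IY 3))
      + b 4 * (f (IY 3) * f (IV 1))"
    assume "a 2 * (f (IX 1) + f (IX 2)) + (a 1 + a 3) * f (IV 1) = 0"
    from triangle_form_le[OF this] have "a 2 * ?A \<le> 0"
      using pos by (smt (verit) mult_nonneg_nonneg zero_le_power2)
    then have A: "?A \<le> 0" using pos by (simp add: mult_le_0_iff)
    assume "b 2 * f (IY 1) + b 3 * f (IY 3) = 0"
    then have B: "?B = 0" by (rule square_form_eq_0) (use cond pos in auto)
    have "qform ?H f f = 2 * (?A + ?B)"
      unfolding infty_3_1_4_eq by (subst qform_wgraph_of) (simp_all add: doubleton_eq_iff)
    then show "qform ?H f f \<le> 0" using A B by simp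
  qed (simp_all add: algebra_simps)
  have ge2: "2 \<le> i_plus ?H"
    by (rule two_le_i_plus[OF wH, of "IX 1" "IY 1" "IX 2" "IY 2"])
      (use pos in \<open>unfold infty_3_1_4_eq, simp_all add: wgraph_simps verts_wgraph_of\<close>)
  have ge3: "3 \<le> i_plus ?H" if cond: "b 1 * b 3 \<noteq> b 2 * b 4"
    by (rule three_le_i_plus[OF wH, of "IX 1" "IY 1" "IY 3" "IX 2" "IY 2" "IV 1"])
      (use pos cond in \<open>unfold infty_3_1_4_eq, simp_all add: wgraph_simps verts_wgraph_of\<close>)
  show ?thesis using le ge2 ge3 by force
qed

text \<open>Each four-cycle has to factor on its own: for an unbalanced one the determinant argument
  takes its two neighbours of \<open>IV 1\<close> together with one edge of the other cycle.\<close>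

lemma i_plus_infty_4_1_4:
  assumes "pos_weights 4 a" "pos_weights 4 b"
  shows "i_plus (infty_graph 4 1 4 a b c) = 2 \<longleftrightarrow> a 1 * a 3 = a 2 * a 4 \<and> b 1 * b 3 = b 2 * b 4"
proof -
  have pos: "0 < a 1" "0 < a 2" "0 < a 3" "0 < a 4" "0 < b 1" "0 < b 2" "0 < b 3" "0 < b 4"
    using assms by (auto simp: pos_weights_small)
  let ?H = "infty_graph 4 1 4 a b c"
  have wH: "weighted_graph ?H"
    unfolding infty_4_1_4_eq by (rule weighted_graph_wgraph_of) (use pos in auto)
  have le: "i_plus ?H \<le> 2" if cond: "a 1 * a 3 = a 2 * a 4" "b 1 * b 3 = b 2 * b 4"
  proof (rule i_plus_le_2[OF finite_verts[OF wH],
      of "\<lambda>f. a 2 * f (IX 1) + a 3 * f (IX 3)" "\<lambda>f. b 2 * f (IY 1) + b 3 * f (IY 3)"])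
    fix f :: "infty_vertex \<Rightarrow> real"
    let ?A = "a 1 * (f (IV 1) * f (IX 1)) + a 2 * (f (IX 1) * f (IX 2)) + a 3 * (f (IX 2) * f (IX 3))
      + a 4 * (f (IX 3) * f (IV 1))"
    let ?B = "b 1 * (f (IV 1) * f (IY 1)) + b 2 * (f (IY 1) * f (IY 2)) + b 3 * (f (IY 2) * f (IY 3))
      + b 4 * (f (IY 3) * f (IV 1))"
    assume "a 2 * f (IX 1) + a 3 * f (IX 3) = 0"
    then have A: "?A = 0" by (rule square_form_eq_0) (use cond pos in auto)
    assume "b 2 * f (IY 1) + b 3 * f (IY 3) = 0"
    then have B: "?B = 0" by (rule square_form_eq_0) (use cond pos in auto)
    have "qform ?H f f = 2 * (?A + ?B)"
      unfolding infty_4_1_4_eq by (subst qform_wgraph_of) (simp_all add: doubleton_eq_iff)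
    then show "qform ?H f f \<le> 0" using A B by simp
  qed (simp_all add: algebra_simps)
  have ge2: "2 \<le> i_plus ?H"
    by (rule two_le_i_plus[OF wH, of "IX 1" "IY 1" "IX 2" "IY 2"])
      (use pos in \<open>unfold infty_4_1_4_eq, simp_all add: wgraph_simps verts_wgraph_of\<close>)
  have ge3: "3 \<le> i_plus ?H" if cond: "a 1 * a 3 \<noteq> a 2 * a 4"
    by (rule three_le_i_plus[OF wH, of "IY 1" "IX 1" "IX 3" "IY 2" "IX 2" "IV 1"])
      (use pos cond in \<open>unfold infty_4_1_4_eq, simp_all add: wgraph_simps verts_wgraph_of\<close>)
  have ge3': "3 \<le> i_plus ?H" if cond: "b 1 * b 3 \<noteq> b 2 * b 4"
    by (rule three_le_i_plus[OF wH, of "IX 1" "IY 1" "IY 3" "IX 2" "IY 2" "IV 1"])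
      (use pos cond in \<open>unfold infty_4_1_4_eq, simp_all add: wgraph_simps verts_wgraph_of\<close>)
  show ?thesis using le ge2 ge3 ge3' by force
qed

text \<open>The graph is bipartite with parts {TU, TV} and the three middle vertices, so
  \<open>i_plus\<close> is the rank of a 2 by 3 matrix; it drops to 1 exactly when all its columns
  are proportional to the first.\<close>

lemma i_plus_theta_1_1_1:
  assumes "pos_weights 2 a" "pos_weights 2 b" "pos_weights 2 c"
  shows "i_plus (theta_graph 1 1 1 a b c) = 2 \<longleftrightarrow> a 2 * b 1 \<noteq> a 1 * b 2 \<or> a 2 * c 1 \<noteq> a 1 * c 2"
proof -
  have pos: "0 < a 1" "0 < a 2" "0 < b 1" "0 < b 2" "0 < c 1" "0 < c 2"
    using assms by (auto simp: pos_weights_small)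
  let ?H = "theta_graph 1 1 1 a b c"
  have wH: "weighted_graph ?H"
    unfolding theta_1_1_1_eq by (rule weighted_graph_wgraph_of) (use pos in auto)
  have qf: "qform ?H f f = 2 * (a 1 * (f TU * f (TX 1)) + a 2 * (f (TX 1) * f TV)
      + b 1 * (f TU * f (TY 1)) + b 2 * (f (TY 1) * f TV)
      + c 1 * (f TU * f (TZ 1)) + c 2 * (f (TZ 1) * f TV))" for f
    unfolding theta_1_1_1_eq by (subst qform_wgraph_of) (simp_all add: doubleton_eq_iff)
  have le2: "i_plus ?H \<le> 2"
    by (rule i_plus_le_2[OF finite_verts[OF wH], of "\<lambda>f. f TU" "\<lambda>f. f TV"])
      (simp_all add: qf[simplified])
  have le1: "i_plus ?H \<le> 1" if cond: "a 2 * b 1 = a 1 * b 2" "a 2 * c 1 = a 1 * c 2"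
  proof (rule i_plus_le_1[OF finite_verts[OF wH], of "\<lambda>f. a 1 * f TU + a 2 * f TV"])
    fix f :: "theta_vertex \<Rightarrow> real"
    let ?l = "a 1 * f TU + a 2 * f TV"
    assume l: "?l = 0"
    have "a 1 * qform ?H f f = 2 * (?l * (a 1 * f (TX 1) + b 1 * f (TY 1) + c 1 * f (TZ 1))
      + (a 1 * b 2 - a 2 * b 1) * (f (TY 1) * f TV) + (a 1 * c 2 - a 2 * c 1) * (f (TZ 1) * f TV))"
      unfolding qf by (simp add: algebra_simps)
    then show "qform ?H f f \<le> 0" unfolding l using cond pos by simp
  qed (simp_all add: algebra_simps)
  have geb: "2 \<le> i_plus ?H" if cond: "a 2 * b 1 \<noteq> a 1 * b 2"
    by (rule two_le_i_plus[OF wH, of "TX 1" "TY 1" TU TV])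
      (use pos cond in \<open>unfold theta_1_1_1_eq, simp_all add: wgraph_simps verts_wgraph_of\<close>)
  have gec: "2 \<le> i_plus ?H" if cond: "a 2 * c 1 \<noteq> a 1 * c 2"
    by (rule two_le_i_plus[OF wH, of "TX 1" "TZ 1" TU TV])
      (use pos cond in \<open>unfold theta_1_1_1_eq, simp_all add: wgraph_simps verts_wgraph_of\<close>)
  show ?thesis using le2 le1 geb gec by force
qed

text \<open>In the proportional case, on a1 u + a2 v = 0 both middle vertices drop out of the form
  and the edge \<open>u v\<close> contributes a nonpositive term, so one functional is
  enough.\<close>

lemma i_plus_theta_1_0_1:
  assumes "pos_weights 2 a" "pos_weights 1 b" "pos_weights 2 c"
  shows "i_plus (theta_graph 1 0 1 a b c) = 2 \<longleftrightarrow> a 2 * c 1 \<noteq> a 1 * c 2"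
proof -
  have pos: "0 < a 1" "0 < a 2" "0 < b 1" "0 < c 1" "0 < c 2"
    using assms by (auto simp: pos_weights_small)
  let ?H = "theta_graph 1 0 1 a b c"
  have wH: "weighted_graph ?H"
    unfolding theta_1_0_1_eq by (rule weighted_graph_wgraph_of) (use pos in auto)
  have qf: "qform ?H f f = 2 * (a 1 * (f TU * f (TX 1)) + a 2 * (f (TX 1) * f TV)
      + b 1 * (f TU * f TV) + c 1 * (f TU * f (TZ 1)) + c 2 * (f (TZ 1) * f TV))" for f
    unfolding theta_1_0_1_eq by (subst qform_wgraph_of) (simp_all add: doubleton_eq_iff)
  have le2: "i_plus ?H \<le> 2"
    by (rule i_plus_le_2[OF finite_verts[OF wH], of "\<lambda>f. f TU" "\<lambda>f. f TV"])
      (simp_all add: qf[simplified])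
  have le1: "i_plus ?H \<le> 1" if cond: "a 2 * c 1 = a 1 * c 2"
  proof (rule i_plus_le_1[OF finite_verts[OF wH], of "\<lambda>f. a 1 * f TU + a 2 * f TV"])
    fix f :: "theta_vertex \<Rightarrow> real"
    let ?l = "a 1 * f TU + a 2 * f TV"
    assume l: "?l = 0"
    have "a 1 * qform ?H f f = 2 * (?l * (a 1 * f (TX 1) + c 1 * f (TZ 1) + b 1 * f TV)
      + (a 1 * c 2 - a 2 * c 1) * (f (TZ 1) * f TV) - a 2 * b 1 * (f TV)\<^sup>2)"
      unfolding qf by (simp add: algebra_simps power2_eq_square)
    then have "a 1 * qform ?H f f = - (2 * (a 2 * b 1 * (f TV)\<^sup>2))" unfolding l using cond by simp
    also have "\<dots> \<le> 0" using pos by simp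
    finally show "qform ?H f f \<le> 0" using pos by (simp add: mult_le_0_iff)
  qed (simp_all add: algebra_simps)
  have gec: "2 \<le> i_plus ?H" if cond: "a 2 * c 1 \<noteq> a 1 * c 2"
    by (rule two_le_i_plus[OF wH, of "TX 1" "TZ 1" TU TV])
      (use pos cond in \<open>unfold theta_1_0_1_eq, simp_all add: wgraph_simps verts_wgraph_of\<close>)
  show ?thesis using le2 le1 gec by force
qed

text \<open>Splitting off \<open>TZ 1 TZ 2\<close> leaves a triangle in which \<open>u v\<close> has
  the weight b1 - c1 c3 / c2. While this is nonnegative one further functional suffices; once it is
  negative the triangle has two positive eigenvalues of its own.\<close>

lemma i_plus_theta_1_0_2:
  assumes "pos_weights 2 a" "pos_weights 1 b" "pos_weights 3 c"
  shows "i_plus (theta_graph 1 0 2 a b c) = 2 \<longleftrightarrow> b 1 * c 2 \<ge> c 1 * c 3"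
proof -
  have pos: "0 < a 1" "0 < a 2" "0 < b 1" "0 < c 1" "0 < c 2" "0 < c 3"
    using assms by (auto simp: pos_weights_small)
  let ?H = "theta_graph 1 0 2 a b c"
  have wH: "weighted_graph ?H"
    unfolding theta_1_0_2_eq by (rule weighted_graph_wgraph_of) (use pos in auto)
  have qf: "qform ?H f f = 2 * (a 1 * (f TU * f (TX 1)) + a 2 * (f (TX 1) * f TV)
      + b 1 * (f TU * f TV) + c 1 * (f TU * f (TZ 1)) + c 2 * (f (TZ 1) * f (TZ 2))
      + c 3 * (f (TZ 2) * f TV))" for f
    unfolding theta_1_0_2_eq by (subst qform_wgraph_of) (simp_all add: doubleton_eq_iff)
  have le: "i_plus ?H \<le> 2" if cond: "b 1 * c 2 \<ge> c 1 * c 3"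
  proof (rule i_plus_le_2[OF finite_verts[OF wH],
      of "\<lambda>f. a 1 * f TU + a 2 * f TV" "\<lambda>f. c 2 * f (TZ 1) + c 3 * f TV"])
    fix f :: "theta_vertex \<Rightarrow> real"
    let ?l = "a 1 * f TU + a 2 * f TV" and ?m = "c 2 * f (TZ 1) + c 3 * f TV"
    let ?b = "b 1 * c 2 - c 1 * c 3"
    assume l: "?l = 0" and m: "?m = 0"
    have "a 1 * c 2 * qform ?H f f = 2 * (?l * (a 1 * c 2 * f (TX 1) + ?b * f TV)
      + ?m * (a 1 * c 2 * f (TZ 2) + a 1 * c 1 * f TU) - a 2 * ?b * (f TV)\<^sup>2)"
      unfolding qf by (simp add: algebra_simps power2_eq_square)
    then have "a 1 * c 2 * qform ?H f f = - (2 * (a 2 * ?b * (f TV)\<^sup>2))" unfolding l m by simp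
    also have "\<dots> \<le> 0" using pos cond by simp
    finally show "qform ?H f f \<le> 0" using pos by (simp add: mult_le_0_iff zero_less_mult_iff)
  qed (simp_all add: algebra_simps)
  have ge2: "2 \<le> i_plus ?H"
    by (rule two_le_i_plus[OF wH, of "TX 1" "TZ 2" TU "TZ 1"])
      (use pos in \<open>unfold theta_1_0_2_eq, simp_all add: wgraph_simps verts_wgraph_of\<close>)
  have ge3: "3 \<le> i_plus ?H" if cond: "b 1 * c 2 < c 1 * c 3"
    by (rule five_cycle_three_le_i_plus[OF wH, of TU TV "TX 1" "TZ 1" "TZ 2"])
      (use pos cond in \<open>unfold theta_1_0_2_eq, simp_all add: wgraph_simps verts_wgraph_of\<close>)
  show ?thesis using le ge2 ge3 by force
qed

text \<open>Splitting off \<open>TX 1 TX 2\<close> and \<open>TZ 1 TZ 2\<close> leaves the single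
  edge \<open>u v\<close> of weight b1 - a1 a3 / a2 - c1 c3 / c2. Of whatever sign, a nonzero weight
  adds one positive eigenvalue, so it has to vanish.\<close>

lemma i_plus_theta_2_0_2:
  assumes "pos_weights 3 a" "pos_weights 1 b" "pos_weights 3 c"
  shows "i_plus (theta_graph 2 0 2 a b c) = 2 \<longleftrightarrow>
    a 2 * b 1 * c 2 = a 1 * a 3 * c 2 + a 2 * c 1 * c 3"
proof -
  have pos: "0 < a 1" "0 < a 2" "0 < a 3" "0 < b 1" "0 < c 1" "0 < c 2" "0 < c 3"
    using assms by (auto simp: pos_weights_small)
  let ?H = "theta_graph 2 0 2 a b c"
  have wH: "weighted_graph ?H"
    unfolding theta_2_0_2_eq by (rule weighted_graph_wgraph_of) (use pos in auto)
  have qf: "qform ?H f f = 2 * (a 1 * (f TU * f (TX 1)) + a 2 * (f (TX 1) * f (TX 2))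
      + a 3 * (f (TX 2) * f TV) + b 1 * (f TU * f TV)
      + c 1 * (f TU * f (TZ 1)) + c 2 * (f (TZ 1) * f (TZ 2)) + c 3 * (f (TZ 2) * f TV))" for f
    unfolding theta_2_0_2_eq by (subst qform_wgraph_of) (simp_all add: doubleton_eq_iff)
  have le: "i_plus ?H \<le> 2" if cond: "a 2 * b 1 * c 2 = a 1 * a 3 * c 2 + a 2 * c 1 * c 3"
  proof (rule i_plus_le_2[OF finite_verts[OF wH],
      of "\<lambda>f. a 2 * f (TX 1) + a 3 * f TV" "\<lambda>f. c 2 * f (TZ 1) + c 3 * f TV"])
    fix f :: "theta_vertex \<Rightarrow> real"
    let ?l = "a 2 * f (TX 1) + a 3 * f TV" and ?m = "c 2 * f (TZ 1) + c 3 * f TV"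
    assume l: "?l = 0" and m: "?m = 0"
    have "a 2 * c 2 * qform ?H f f = 2 * (?l * (a 2 * c 2 * f (TX 2) + a 1 * c 2 * f TU)
      + ?m * (a 2 * c 2 * f (TZ 2) + a 2 * c 1 * f TU)
      + (a 2 * b 1 * c 2 - (a 1 * a 3 * c 2 + a 2 * c 1 * c 3)) * (f TU * f TV))"
      unfolding qf by (simp add: algebra_simps)
    then have "a 2 * c 2 * qform ?H f f = 0" unfolding l m cond by simp
    then show "qform ?H f f \<le> 0" using pos by simp
  qed (simp_all add: algebra_simps)
  have ge2: "2 \<le> i_plus ?H"
    by (rule two_le_i_plus[OF wH, of "TX 1" "TZ 1" "TX 2" "TZ 2"])
      (use pos in \<open>unfold theta_2_0_2_eq, simp_all add: wgraph_simps verts_wgraph_of\<close>)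
  have ge3: "3 \<le> i_plus ?H" if cond: "a 2 * b 1 * c 2 \<noteq> a 1 * a 3 * c 2 + a 2 * c 1 * c 3"
    by (rule three_le_i_plus[OF wH, of "TX 1" "TZ 1" TV "TX 2" "TZ 2" TU])
      (use pos cond in \<open>unfold theta_2_0_2_eq, simp_all add: wgraph_simps verts_wgraph_of algebra_simps\<close>)
  show ?thesis using le ge2 ge3 by force
qed

subsection \<open>Shapes of bicyclic graphs\<close>

lemma adj_entry_pos: "weighted_graph G \<Longrightarrow> {x, y} \<in> edges G \<Longrightarrow> 0 < adj_entry G x y"
  by (simp add: weighted_graph_def adj_entry_def)

lemma adj_entry_eq_0: "{x, y} \<notin> edges G \<Longrightarrow> adj_entry G x y = 0"
  by (simp add: adj_entry_def)

text \<open>The matrix between the \<open>p\<close>s and the \<open>q\<close>s is lower triangular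
  with positive diagonal. Adjacencies below the diagonal, such as \<open>p2 q1\<close>, stay free,
  which is what makes the pattern flexible enough for infinite families.\<close>

lemma triangular_three_le_i_plus:
  assumes G: "weighted_graph G"
    and e: "{p1, q1} \<in> edges G" "{p2, q2} \<in> edges G" "{p3, q3} \<in> edges G"
    and n: "{p1, p2} \<notin> edges G" "{p1, p3} \<notin> edges G" "{p2, p3} \<notin> edges G"
      "{p1, q2} \<notin> edges G" "{p1, q3} \<notin> edges G" "{p2, q3} \<notin> edges G"
  shows "3 \<le> i_plus G"
proof (rule three_le_i_plus[OF G, of p1 p2 p3 q1 q2 q3])
  show "{p1, p2, p3, q1, q2, q3} \<subseteq> verts G"
    using G e unfolding weighted_graph_def by auto
qed (use e[THEN adj_entry_pos[OF G]] n[THEN adj_entry_eq_0] in simp_all)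

lemma not_path_edge:
  "x \<notin> set xs \<Longrightarrow> {x, y} \<notin> path_edges xs" "y \<notin> set xs \<Longrightarrow> {x, y} \<notin> path_edges xs"
  using path_edges_subset[of "{x, y}" xs] by auto

text \<open>The map goes from the model to \<open>G\<close>, against the direction of
  \<open>wgraph_iso\<close>, so that it can be written by cases on the constructors of the model; it
  has to be injective only on vertices that occur.\<close>

lemma wgraph_iso_wgraph_of:
  assumes inj: "inj_on g (\<Union> (fst ` set es))" and V: "verts G = g ` \<Union> (fst ` set es)"
    and E: "edges G = (`) g ` fst ` set es"
    and w: "\<forall>(e, w)\<in>set es. wt G (g ` e) = w"
  shows "wgraph_iso G (wgraph_of es)"
proof -
  let ?W = "\<Union> (fst ` set es)"
  let ?f = "inv_into ?W g"
  have bij: "bij_betw ?f (verts G) (verts (wgraph_of es))"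
    unfolding V using inj by (simp add: verts_wgraph_of bij_betw_inv_into inj_on_imp_bij_betw)
  have edges: "{x, y} \<in> edges G \<longleftrightarrow> {?f x, ?f y} \<in> edges (wgraph_of es)"
    and wt: "{x, y} \<in> edges G \<Longrightarrow> wt G {x, y} = wt (wgraph_of es) {?f x, ?f y}"
    if xy: "x \<in> verts G" "y \<in> verts G" for x y
  proof -
    obtain p q where p: "p \<in> ?W" "x = g p" and q: "q \<in> ?W" "y = g q" using xy unfolding V by blast
    have f: "?f x = p" "?f y = q" unfolding p(2) q(2) using inj p(1) q(1) by (auto intro: inv_into_f_f)
    have im: "{x, y} = g ` {p, q}" using p q by simp
    have eq: "e = {p, q}" if "e \<in> fst ` set es" "g ` e = g ` {p, q}" for e
      using inj_on_image_eq_iff[OF inj, of e "{p, q}"] that p(1) q(1) by blast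
    show iff: "{x, y} \<in> edges G \<longleftrightarrow> {?f x, ?f y} \<in> edges (wgraph_of es)"
      unfolding f im E wgraph_of_def using eq by auto
    assume "{x, y} \<in> edges G"
    then have "{p, q} \<in> fst ` set es" using iff unfolding f wgraph_of_def by simp
    then obtain w' where "map_of es {p, q} = Some w'"
      by (metis map_of_eq_None_iff not_None_eq)
    moreover from this have "wt G (g ` {p, q}) = w'" using bspec[OF w map_of_SomeD] by fastforce
    ultimately show "wt G {x, y} = wt (wgraph_of es) {?f x, ?f y}"
      unfolding f im by (simp add: wgraph_of_def)
  qed
  show ?thesis unfolding wgraph_iso_def using bij edges wt by blast
qed

section \<open>Unweighted shapes of theta- and infinity-graphs\<close>

text \<open>The lists are the interiors of the three paths, so an empty list stands for the edge
  \<open>u v\<close>. Lists rather than lengths allow case distinctions by patterns and permutation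
  of the paths.\<close>

definition theta_shape :: "'a wgraph \<Rightarrow> 'a \<Rightarrow> 'a \<Rightarrow> 'a list \<Rightarrow> 'a list \<Rightarrow> 'a list \<Rightarrow> bool" where
  "theta_shape G u v X Y Z \<longleftrightarrow> distinct (u # v # X @ Y @ Z) \<and> verts G = set (u # v # X @ Y @ Z) \<and>
     edges G = path_edges (u # X @ [v]) \<union> path_edges (u # Y @ [v]) \<union> path_edges (u # Z @ [v])"

text \<open>\<open>A\<close> and \<open>C\<close> are the cycles without their attaching vertices,
  and \<open>D\<close> is the connecting path including both ends; a one-element \<open>D\<close>
  means that the cycles share a vertex.\<close>

definition infty_shape :: "'a wgraph \<Rightarrow> 'a list \<Rightarrow> 'a list \<Rightarrow> 'a list \<Rightarrow> bool" where
  "infty_shape G A D C \<longleftrightarrow> D \<noteq> [] \<and> distinct (A @ D @ C) \<and> verts G = set (A @ D @ C) \<and>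
     edges G = path_edges (hd D # A @ [hd D]) \<union> path_edges D \<union> path_edges (last D # C @ [last D])"

lemma theta_shape_swap12: "theta_shape G u v X Y Z \<Longrightarrow> theta_shape G u v Y X Z"
  unfolding theta_shape_def by auto

lemma theta_shape_swap23: "theta_shape G u v X Y Z \<Longrightarrow> theta_shape G u v X Z Y"
  unfolding theta_shape_def by auto

lemma infty_shape_swap: "infty_shape G A D C \<Longrightarrow> infty_shape G C (rev D) A"
  unfolding infty_shape_def by (auto simp: hd_rev last_rev)

text \<open>The three connections from \<open>u\<close> to \<open>v\<close> are: back along
  \<open>A\<close> and over the chord from the head, directly through \<open>B\<close>, and over the
  other chord and back along \<open>C\<close>. This explains the two reversals.\<close>

lemma theta_shape_of_path:
  assumes dist: "distinct (A @ u # B @ v # C)" and V: "verts G = set (A @ u # B @ v # C)"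
    and E: "edges G = {{hd (A @ u # B @ v # C), v}, {last (A @ u # B @ v # C), u}}
      \<union> path_edges (A @ u # B @ v # C)"
  shows "theta_shape G u v (rev A) B (rev C)"
proof -
  have "path_edges (u # rev A @ [v]) = path_edges (rev (v # A @ [u]))" by simp
  also have "\<dots> = insert {v, hd (A @ [u])} (path_edges (A @ [u]))"
    unfolding path_edges_rev by (rule path_edges_Cons) simp
  finally have 1: "path_edges (u # rev A @ [v]) = insert {v, hd (A @ [u])} (path_edges (A @ [u]))" .
  have "path_edges (u # rev C @ [v]) = path_edges (rev ((v # C) @ [u]))" by simp
  also have "\<dots> = insert {last (v # C), u} (path_edges (v # C))"
    unfolding path_edges_rev by (rule path_edges_snoc) simp
  finally have 2: "path_edges (u # rev C @ [v]) = insert {last (v # C), u} (path_edges (v # C))" .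
  have "path_edges (A @ u # B @ v # C)
      = path_edges (A @ [u]) \<union> (path_edges (u # B @ [v]) \<union> path_edges (v # C))"
    using path_edges_append[of A u "B @ v # C"] path_edges_append[of "u # B" v C] by simp
  moreover have "hd (A @ u # B @ v # C) = hd (A @ [u])" "last (A @ u # B @ v # C) = last (v # C)"
    by (simp_all add: hd_append)
  ultimately have "edges G = path_edges (u # rev A @ [v]) \<union> path_edges (u # B @ [v])
      \<union> path_edges (u # rev C @ [v])"
    unfolding E 1 2 by (auto simp: insert_commute)
  then show ?thesis unfolding theta_shape_def using dist V by auto
qed

text \<open>Chords that do not cross close the initial segment \<open>A\<close> at the first vertex
  of \<open>D\<close> and the final segment \<open>C\<close> at its last vertex.\<close>

lemma infty_shape_of_path:
  assumes dist: "distinct (A @ D @ C)" and V: "verts G = set (A @ D @ C)"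
    and ne: "A \<noteq> []" "D \<noteq> []" "C \<noteq> []"
    and E: "edges G = {{hd A, hd D}, {last C, last D}} \<union> path_edges (A @ D @ C)"
  shows "infty_shape G A D C"
proof -
  have "path_edges (A @ D @ C) = path_edges (A @ [hd D]) \<union> path_edges (D @ C)"
    using path_edges_append[of A "hd D" "tl D @ C"] ne(2) by (cases D) auto
  also have "path_edges (D @ C) = path_edges D \<union> path_edges (last D # C)"
  proof -
    have "butlast D @ last D # C = D @ C"
      using append_butlast_last_id[OF ne(2)] by (metis append_Cons append_Nil append_assoc)
    then show ?thesis
      using path_edges_append[of "butlast D" "last D" C] append_butlast_last_id[OF ne(2)] by metis
  qed
  finally have "edges G = path_edges (hd D # A @ [hd D]) \<union> path_edges D \<union> path_edges (last D # C @ [last D])"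
    using E ne path_edges_snoc[of "last D # C" "last D"] path_edges_Cons[of "A @ [hd D]" "hd D"]
    by (auto simp: insert_commute)
  then show ?thesis unfolding infty_shape_def using dist V ne(2) by auto
qed

theorem bicyclic_shape:
  assumes G: "bicyclic G" and pend: "\<not> (\<exists>x. pendant G x)"
  obtains (infty) A D C where "infty_shape G A D C" "2 \<le> length A" "2 \<le> length C"
  | (theta) u v X Y Z where "theta_shape G u v X Y Z"
      "X \<noteq> [] \<or> Y \<noteq> []" "X \<noteq> [] \<or> Z \<noteq> []" "Y \<noteq> [] \<or> Z \<noteq> []"
proof -
  obtain ws i j where ws: "distinct ws" "set ws = verts G" and ij: "2 \<le> i" "i < length ws" "j + 2 < length ws"
    "\<not> (i = length ws - 1 \<and> j = 0)"
    and E: "edges G = {{hd ws, ws ! i}, {last ws, ws ! j}} \<union> path_edges ws"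
    by (rule bicyclic_normal_form[OF G pend])
  show thesis
  proof (cases "i \<le> j")
    case True
    define A where "A = take i ws"
    define D where "D = take (Suc j - i) (drop i ws)"
    define C where "C = drop (Suc j) ws"
    have "take (Suc j) ws = A @ D" unfolding A_def D_def using True take_add[of i "Suc j - i" ws] by simp
    then have split: "ws = A @ D @ C" unfolding C_def by (metis append.assoc append_take_drop_id)
    have len: "length A = i" "length C = length ws - Suc j" "length D = Suc j - i"
      unfolding A_def C_def D_def using ij True by auto
    have ne: "A \<noteq> []" "D \<noteq> []" "C \<noteq> []" using len ij True by auto
    have nth: "ws ! i = hd D" "ws ! j = last D" "hd ws = hd A" "last ws = last C"
      unfolding split using ne len True
      by (auto simp: nth_append hd_conv_nth last_conv_nth)
    have "infty_shape G A D C"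
      by (rule infty_shape_of_path) (use ws E nth split ne in auto)
    then show ?thesis using infty[of A D C] len ij by simp
  next
    case False
    define A where "A = take j ws"
    define B where "B = take (i - Suc j) (drop (Suc j) ws)"
    define C where "C = drop (Suc i) ws"
    have "drop (Suc j) ws = B @ drop i ws"
      unfolding B_def using False by (metis Suc_leI append_take_drop_id drop_drop le_add_diff_inverse2 not_le)
    moreover have "drop i ws = ws ! i # C" unfolding C_def using ij by (simp add: Cons_nth_drop_Suc)
    ultimately have split: "ws = A @ ws ! j # B @ ws ! i # C"
      unfolding A_def using ij id_take_nth_drop[of j ws] by simp
    have len: "length A = j" "length B = i - Suc j" "length C = length ws - Suc i"
      unfolding A_def B_def C_def using ij False by auto
    have "theta_shape G (ws ! j) (ws ! i) (rev A) B (rev C)"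
      by (rule theta_shape_of_path) (use ws E split in \<open>simp_all only: split[symmetric]\<close>)
    \<comment> \<open>The interiors have lengths j, i - j - 1 and length ws - 1 - i. That no two are
      empty is the content of \<open>2 \<le> i\<close>, of \<open>j + 2 < length ws\<close> and of
      the exclusion of the closing edge.\<close>
    then show ?thesis
      by (rule theta) (use len ij False in auto)
  qed
qed

section \<open>Shapes with at least three positive eigenvalues\<close>

lemma theta_three_le_i_plus_4:
  assumes G: "weighted_graph G" and sh: "theta_shape G u v X (y # Y) (z1 # z2 # z3 # z4 # Z)"
  shows "3 \<le> i_plus G"
  by (rule triangular_three_le_i_plus[OF G, of y u z1 z2 z3 z4];
    (insert sh[unfolded theta_shape_def, simplified], elim conjE, simp add: doubleton_eq_iff not_path_edge))

lemma theta_three_le_i_plus_3_3: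
  assumes G: "weighted_graph G" and sh: "theta_shape G u v X [y1, y2, y3] [z1, z2, z3]"
  shows "3 \<le> i_plus G"
  by (rule triangular_three_le_i_plus[OF G, of z1 z2 z3 v y3 y2];
    (insert sh[unfolded theta_shape_def, simplified], elim conjE, simp add: doubleton_eq_iff not_path_edge))

lemma theta_three_le_i_plus_2_3:
  assumes G: "weighted_graph G" and sh: "theta_shape G u v X [y1, y2] [z1, z2, z3]"
  shows "3 \<le> i_plus G"
  by (rule triangular_three_le_i_plus[OF G, of z1 z2 z3 v y2 y1];
    (insert sh[unfolded theta_shape_def, simplified], elim conjE, simp add: doubleton_eq_iff not_path_edge))

text \<open>On the six-cycle \<open>y u z1 z2 z3 v\<close>, the determinant between alternate
  vertices is the sum over its two perfect matchings. A cyclic permutation of three columns is even,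
  so both products count positively and nothing cancels.\<close>

lemma theta_three_le_i_plus_1_3:
  assumes G: "weighted_graph G" and sh: "theta_shape G u v X [y] [z1, z2, z3]"
  shows "3 \<le> i_plus G"
proof -
  have n: "{y, z1} \<notin> edges G" "{y, z3} \<notin> edges G" "{z1, z3} \<notin> edges G"
    "{y, z2} \<notin> edges G" "{z1, v} \<notin> edges G" "{z3, u} \<notin> edges G"
    using sh by (auto simp: theta_shape_def doubleton_eq_iff not_path_edge)
  have e: "{y, u} \<in> edges G" "{y, v} \<in> edges G" "{z1, u} \<in> edges G" "{z1, z2} \<in> edges G"
    "{z3, z2} \<in> edges G" "{z3, v} \<in> edges G"
    using sh by (auto simp: theta_shape_def doubleton_eq_iff)
  show ?thesis
  proof (rule three_le_i_plus[OF G, of y z1 z3 u z2 v])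
    have "0 < adj_entry G y u * (adj_entry G z1 z2 * adj_entry G z3 v)
        + adj_entry G y v * (adj_entry G z1 u * adj_entry G z3 z2)"
      by (intro add_pos_pos mult_pos_pos e[THEN adj_entry_pos[OF G]])
    then show "adj_entry G y u * (adj_entry G z1 z2 * adj_entry G z3 v - adj_entry G z1 v * adj_entry G z3 z2)
      - adj_entry G y z2 * (adj_entry G z1 u * adj_entry G z3 v - adj_entry G z1 v * adj_entry G z3 u)
      + adj_entry G y v * (adj_entry G z1 u * adj_entry G z3 z2 - adj_entry G z1 z2 * adj_entry G z3 u) \<noteq> 0"
      using n[THEN adj_entry_eq_0] by simp
    show "{y, z1, z3, u, z2, v} \<subseteq> verts G" using sh by (simp add: theta_shape_def)
  qed (use n[THEN adj_entry_eq_0] in simp_all)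
qed

lemma theta_three_le_i_plus_2_2_2:
  assumes G: "weighted_graph G" and sh: "theta_shape G u v [x1, x2] [y1, y2] [z1, z2]"
  shows "3 \<le> i_plus G"
  by (rule triangular_three_le_i_plus[OF G, of x1 x2 y1 y2 z1 z2];
    (insert sh[unfolded theta_shape_def, simplified], elim conjE, simp add: doubleton_eq_iff not_path_edge))

lemma theta_three_le_i_plus_1_2_2:
  assumes G: "weighted_graph G" and sh: "theta_shape G u v [x] [y1, y2] [z1, z2]"
  shows "3 \<le> i_plus G"
  by (rule triangular_three_le_i_plus[OF G, of x u y1 y2 z1 z2];
    (insert sh[unfolded theta_shape_def, simplified], elim conjE, simp add: doubleton_eq_iff not_path_edge))

text \<open>A determinant may vanish here when the weights at \<open>x\<close> and \<open>y\<close>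
  are proportional. The five-cycle \<open>u x v z2 z1\<close> works for all weights, since
  \<open>u\<close> and \<open>v\<close> are nonadjacent and the strict inequality holds
  trivially.\<close>

lemma theta_three_le_i_plus_1_1_2:
  assumes G: "weighted_graph G" and sh: "theta_shape G u v [x] [y] [z1, z2]"
  shows "3 \<le> i_plus G"
proof (rule five_cycle_three_le_i_plus[OF G, of u v x z1 z2])
  have e: "{u, x} \<in> edges G" "{x, v} \<in> edges G" "{z1, z2} \<in> edges G" "{u, z1} \<in> edges G" "{z2, v} \<in> edges G"
    and n: "{u, z2} \<notin> edges G" "{v, z1} \<notin> edges G" "{x, z1} \<notin> edges G" "{x, z2} \<notin> edges G" "{u, v} \<notin> edges G"
    using sh by (auto simp: theta_shape_def doubleton_eq_iff)
  note pos = e[THEN adj_entry_pos[OF G]] and zero = n[THEN adj_entry_eq_0]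
  show "0 < adj_entry G u x" "0 < adj_entry G x v" "0 < adj_entry G z1 z2" by fact+
  show "adj_entry G u z2 = 0" "adj_entry G v z1 = 0" "adj_entry G x z1 = 0" "adj_entry G x z2 = 0" by fact+
  show "adj_entry G u v * adj_entry G z1 z2 < adj_entry G u z1 * adj_entry G z2 v"
    using pos zero by simp
qed (use sh in \<open>auto simp: theta_shape_def\<close>)

lemma infty_three_le_i_plus_5:
  assumes G: "weighted_graph G" and sh: "infty_shape G (a0 # a1 # a2 # a3 # A) D (c0 # c1 # C)"
  shows "3 \<le> i_plus G"
proof -
  \<comment> \<open>The path \<open>D\<close> stays unspecified; it is enough that its ends,
    possibly equal, lie outside both cycle interiors. The three edges used are \<open>a0 a1\<close>,
    \<open>a3 a2\<close> and \<open>c0 c1\<close>.\<close>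
  define d where "d = hd D"
  define l where "l = last D"
  have mem: "d \<in> set D" "l \<in> set D" using sh unfolding d_def l_def by (auto simp: infty_shape_def)
  have dist: "distinct (a0 # a1 # a2 # a3 # A @ D @ c0 # c1 # C)"
    using sh by (simp add: infty_shape_def)
  have new: "d \<notin> {a0, a1, a2, a3, c0, c1}" "l \<notin> {a0, a1, a2, a3, c0, c1}"
    using mem dist by auto
  have E: "edges G = path_edges (d # (a0 # a1 # a2 # a3 # A) @ [d]) \<union> path_edges D
      \<union> path_edges (l # (c0 # c1 # C) @ [l])"
    using sh unfolding d_def l_def by (simp add: infty_shape_def)
  show ?thesis
    by (rule triangular_three_le_i_plus[OF G, of a0 a1 a3 a2 c0 c1];
      (insert dist[simplified] new[simplified], elim conjE, simp add: E doubleton_eq_iff not_path_edge))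
qed

lemma infty_three_le_i_plus_4:
  assumes G: "weighted_graph G" and sh: "infty_shape G [a0, a1, a2] (d0 # d1 # D) (c0 # c1 # C)"
  shows "3 \<le> i_plus G"
proof -
  define l where "l = last (d1 # D)"
  have mem: "l \<in> set (d1 # D)" unfolding l_def by (rule last_in_set) simp
  have dist: "distinct (a0 # a1 # a2 # d0 # (d1 # D) @ c0 # c1 # C)"
    using sh by (simp add: infty_shape_def)
  have new: "l \<notin> {a0, a1, a2, d0, c0, c1}"
    using mem dist by auto
  have E: "edges G = path_edges (d0 # [a0, a1, a2] @ [d0]) \<union> path_edges (d0 # d1 # D)
      \<union> path_edges (l # (c0 # c1 # C) @ [l])"
    using sh unfolding l_def by (simp add: infty_shape_def)
  show ?thesis
    by (rule triangular_three_le_i_plus[OF G, of a1 a0 d0 d1 c0 c1];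
      (insert dist[simplified] new[simplified], elim conjE, simp add: E doubleton_eq_iff not_path_edge))
qed

lemma infty_three_le_i_plus_3:
  assumes G: "weighted_graph G" and sh: "infty_shape G [a0, a1] (d0 # d1 # d2 # D) (c0 # c1 # C)"
  shows "3 \<le> i_plus G"
proof -
  define l where "l = last (d2 # D)"
  have mem: "l \<in> set (d2 # D)" unfolding l_def by (rule last_in_set) simp
  have dist: "distinct (a0 # a1 # d0 # d1 # (d2 # D) @ c0 # c1 # C)"
    using sh by (simp add: infty_shape_def)
  have new: "l \<notin> {a0, a1, d0, d1, c0, c1}"
    using mem dist by auto
  have E: "edges G = path_edges (d0 # [a0, a1] @ [d0]) \<union> path_edges (d0 # d1 # d2 # D)
      \<union> path_edges (l # (c0 # c1 # C) @ [l])"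
    using sh unfolding l_def by (simp add: infty_shape_def)
  show ?thesis
    by (rule triangular_three_le_i_plus[OF G, of d1 d0 a0 a1 c0 c1];
      (insert dist[simplified] new[simplified], elim conjE, simp add: E doubleton_eq_iff not_path_edge))
qed

section \<open>Recognizing the eight graphs from their shapes\<close>

lemma edge_weight_pos: "weighted_graph G \<Longrightarrow> e \<in> edges G \<Longrightarrow> 0 < wt G e"
  by (simp add: weighted_graph_def)

lemma wgraph_iso_wgraph_of_list:
  assumes "set vs = \<Union> (fst ` set es)" and "distinct (map g vs)" and "verts G = set (map g vs)"
    and "edges G = set (map (\<lambda>(e, w). g ` e) es)" and "list_all (\<lambda>(e, w). wt G (g ` e) = w) es"
  shows "wgraph_iso G (wgraph_of es)"
proof (rule wgraph_iso_wgraph_of[of g])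
  show "edges G = (`) g ` fst ` set es" unfolding assms(4) by force
qed (use assms in \<open>auto simp: distinct_map list_all_iff\<close>)

lemma theta_weight_counts: "1 + 1 = (2::nat)" "0 + 1 = (1::nat)" "2 + 1 = (3::nat)"
  by simp_all

lemma is_infty_3_1_3I:
  assumes G: "weighted_graph G" and sh: "infty_shape G [x1, x2] [v] [y1, y2]"
  shows "\<exists>a b c. is_infty G 3 1 3 a b c"
proof -
  have dist: "distinct [x1, x2, v, y1, y2]" and V: "verts G = {x1, x2, v, y1, y2}"
    and E: "edges G = {{v, x1}, {x1, x2}, {x2, v}, {v, y1}, {y1, y2}, {y2, v}}"
    using sh unfolding infty_shape_def by auto
  have pos: "0 < wt G e" if "e \<in> {{v, x1}, {x1, x2}, {x2, v}, {v, y1}, {y1, y2}, {y2, v}}" for e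
    using edge_weight_pos[OF G] that unfolding E .
  \<comment> \<open>Weights and numbered vertices are indexed from 1, so position 0 of each such
    list, here and in the map \<open>g\<close> below, is padding. The constant 1 given for
    \<open>c\<close> is a placeholder, as a path with one vertex has no edges.\<close>
  define a where "a = (!) [0, wt G {v, x1}, wt G {x1, x2}, wt G {x2, v}]"
  define b where "b = (!) [0, wt G {v, y1}, wt G {y1, y2}, wt G {y2, v}]"
  have "wgraph_iso G (infty_graph 3 1 3 a b (\<lambda>_. 1))"
    unfolding infty_3_1_3_eq
    by (rule wgraph_iso_wgraph_of_list[where vs = "[IV 1, IX 1, IX 2, IY 1, IY 2]" and g = "\<lambda>t. case t of IV _ \<Rightarrow> v
        | IX n \<Rightarrow> [x1, x1, x2] ! n | IY n \<Rightarrow> [y1, y1, y2] ! n"])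
      (use dist V in \<open>auto simp: E a_def b_def\<close>)
  moreover have "pos_weights 3 a" "pos_weights 3 b"
    by (simp_all add: pos_weights_small a_def b_def pos)
  ultimately show ?thesis unfolding is_infty_def by (auto simp: pos_weights_small)
qed

lemma is_infty_3_2_3I:
  assumes G: "weighted_graph G" and sh: "infty_shape G [x1, x2] [v, u] [y1, y2]"
  shows "\<exists>a b c. is_infty G 3 2 3 a b c"
proof -
  have dist: "distinct [x1, x2, v, u, y1, y2]" and V: "verts G = {x1, x2, v, u, y1, y2}"
    and E: "edges G = {{v, x1}, {x1, x2}, {x2, v}, {v, u}, {u, y1}, {y1, y2}, {y2, u}}"
    using sh unfolding infty_shape_def by auto
  have pos: "0 < wt G e" if "e \<in> {{v, x1}, {x1, x2}, {x2, v}, {v, u}, {u, y1}, {y1, y2}, {y2, u}}" for e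
    using edge_weight_pos[OF G] that unfolding E .
  define a where "a = (!) [0, wt G {v, x1}, wt G {x1, x2}, wt G {x2, v}]"
  define b where "b = (!) [0, wt G {u, y1}, wt G {y1, y2}, wt G {y2, u}]"
  define c where "c = (\<lambda>_::nat. wt G {v, u})"
  have "wgraph_iso G (infty_graph 3 2 3 a b c)"
    unfolding infty_3_2_3_eq
    by (rule wgraph_iso_wgraph_of_list[where vs = "[IX 1, IX 2, IV 1, IV 2, IY 1, IY 2]" and g = "\<lambda>t. case t of IV n \<Rightarrow> [v, v, u] ! n
        | IX n \<Rightarrow> [x1, x1, x2] ! n | IY n \<Rightarrow> [y1, y1, y2] ! n"])
      (use dist V in \<open>auto simp: E a_def b_def c_def\<close>)
  moreover have "pos_weights 3 a" "pos_weights 3 b" "pos_weights 1 c"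
    by (simp_all add: pos_weights_small a_def b_def c_def pos)
  ultimately show ?thesis unfolding is_infty_def by auto
qed

lemma is_infty_3_1_4I:
  assumes G: "weighted_graph G" and sh: "infty_shape G [x1, x2] [v] [y1, y2, y3]"
  shows "\<exists>a b c. is_infty G 3 1 4 a b c"
proof -
  have dist: "distinct [x1, x2, v, y1, y2, y3]" and V: "verts G = {x1, x2, v, y1, y2, y3}"
    and E: "edges G = {{v, x1}, {x1, x2}, {x2, v}, {v, y1}, {y1, y2}, {y2, y3}, {y3, v}}"
    using sh unfolding infty_shape_def by auto
  have pos: "0 < wt G e" if "e \<in> {{v, x1}, {x1, x2}, {x2, v}, {v, y1}, {y1, y2}, {y2, y3}, {y3, v}}" for e
    using edge_weight_pos[OF G] that unfolding E .
  define a where "a = (!) [0, wt G {v, x1}, wt G {x1, x2}, wt G {x2, v}]"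
  define b where "b = (!) [0, wt G {v, y1}, wt G {y1, y2}, wt G {y2, y3}, wt G {y3, v}]"
  have "wgraph_iso G (infty_graph 3 1 4 a b (\<lambda>_. 1))"
    unfolding infty_3_1_4_eq
    by (rule wgraph_iso_wgraph_of_list[where vs = "[IX 1, IX 2, IV 1, IY 1, IY 2, IY 3]" and g = "\<lambda>t. case t of IV _ \<Rightarrow> v
        | IX n \<Rightarrow> [x1, x1, x2] ! n | IY n \<Rightarrow> [y1, y1, y2, y3] ! n"])
      (use dist V in \<open>auto simp: E a_def b_def\<close>)
  moreover have "pos_weights 3 a" "pos_weights 4 b"
    by (simp_all add: pos_weights_small a_def b_def pos)
  ultimately show ?thesis unfolding is_infty_def by (auto simp: pos_weights_small)
qed

lemma is_infty_4_1_4I: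
  assumes G: "weighted_graph G" and sh: "infty_shape G [x1, x2, x3] [v] [y1, y2, y3]"
  shows "\<exists>a b c. is_infty G 4 1 4 a b c"
proof -
  have dist: "distinct [x1, x2, x3, v, y1, y2, y3]" and V: "verts G = {x1, x2, x3, v, y1, y2, y3}"
    and E: "edges G = {{v, x1}, {x1, x2}, {x2, x3}, {x3, v}, {v, y1}, {y1, y2}, {y2, y3}, {y3, v}}"
    using sh unfolding infty_shape_def by auto
  have pos: "0 < wt G e" if "e \<in> {{v, x1}, {x1, x2}, {x2, x3}, {x3, v}, {v, y1}, {y1, y2}, {y2, y3}, {y3, v}}" for e
    using edge_weight_pos[OF G] that unfolding E .
  define a where "a = (!) [0, wt G {v, x1}, wt G {x1, x2}, wt G {x2, x3}, wt G {x3, v}]"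
  define b where "b = (!) [0, wt G {v, y1}, wt G {y1, y2}, wt G {y2, y3}, wt G {y3, v}]"
  have "wgraph_iso G (infty_graph 4 1 4 a b (\<lambda>_. 1))"
    unfolding infty_4_1_4_eq
    by (rule wgraph_iso_wgraph_of_list[where vs = "[IX 1, IX 2, IX 3, IV 1, IY 1, IY 2, IY 3]" and g = "\<lambda>t. case t of IV _ \<Rightarrow> v
        | IX n \<Rightarrow> [x1, x1, x2, x3] ! n | IY n \<Rightarrow> [y1, y1, y2, y3] ! n"])
      (use dist V in \<open>auto simp: E a_def b_def\<close>)
  moreover have "pos_weights 4 a" "pos_weights 4 b"
    by (simp_all add: pos_weights_small a_def b_def pos)
  ultimately show ?thesis unfolding is_infty_def by (auto simp: pos_weights_small)
qed

lemma is_theta_1_1_1I: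
  assumes G: "weighted_graph G" and sh: "theta_shape G u v [x] [y] [z]"
  shows "\<exists>a b c. is_theta G 1 1 1 a b c"
proof -
  have dist: "distinct [u, v, x, y, z]" and V: "verts G = {u, v, x, y, z}"
    and E: "edges G = {{u, x}, {x, v}, {u, y}, {y, v}, {u, z}, {z, v}}"
    using sh unfolding theta_shape_def by auto
  have pos: "0 < wt G e" if "e \<in> {{u, x}, {x, v}, {u, y}, {y, v}, {u, z}, {z, v}}" for e
    using edge_weight_pos[OF G] that unfolding E .
  define a where "a = (!) [0, wt G {u, x}, wt G {x, v}]"
  define b where "b = (!) [0, wt G {u, y}, wt G {y, v}]"
  define c where "c = (!) [0, wt G {u, z}, wt G {z, v}]"
  have "wgraph_iso G (theta_graph 1 1 1 a b c)"
    unfolding theta_1_1_1_eq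
    by (rule wgraph_iso_wgraph_of_list[where vs = "[TU, TV, TX 1, TY 1, TZ 1]" and g = "case_theta_vertex u v (\<lambda>_. x) (\<lambda>_. y) (\<lambda>_. z)"])
      (use dist V in \<open>auto simp: E a_def b_def c_def\<close>)
  moreover have "pos_weights 2 a" "pos_weights 2 b" "pos_weights 2 c"
    by (simp_all add: pos_weights_small a_def b_def c_def pos)
  ultimately show ?thesis unfolding is_theta_def theta_weight_counts by blast
qed

lemma is_theta_1_0_1I:
  assumes G: "weighted_graph G" and sh: "theta_shape G u v [] [x] [z]"
  shows "\<exists>a b c. is_theta G 1 0 1 a b c"
proof -
  have dist: "distinct [u, v, x, z]" and V: "verts G = {u, v, x, z}"
    and E: "edges G = {{u, v}, {u, x}, {x, v}, {u, z}, {z, v}}"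
    using sh unfolding theta_shape_def by auto
  have pos: "0 < wt G e" if "e \<in> {{u, v}, {u, x}, {x, v}, {u, z}, {z, v}}" for e
    using edge_weight_pos[OF G] that unfolding E .
  define a where "a = (!) [0, wt G {u, x}, wt G {x, v}]"
  \<comment> \<open>The empty path comes first in the shape but is the middle path of the model; its
    only edge has index 1.\<close>
  define b where "b = (\<lambda>_::nat. wt G {u, v})"
  define c where "c = (!) [0, wt G {u, z}, wt G {z, v}]"
  have "wgraph_iso G (theta_graph 1 0 1 a b c)"
    unfolding theta_1_0_1_eq
    by (rule wgraph_iso_wgraph_of_list[where vs = "[TU, TV, TX 1, TZ 1]" and g = "case_theta_vertex u v (\<lambda>_. x) (\<lambda>_. u) (\<lambda>_. z)"])
      (use dist V in \<open>auto simp: E a_def b_def c_def\<close>)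
  moreover have "pos_weights 2 a" "pos_weights 1 b" "pos_weights 2 c"
    by (simp_all add: pos_weights_small a_def b_def c_def pos)
  ultimately show ?thesis unfolding is_theta_def theta_weight_counts by blast
qed

lemma is_theta_1_0_2I:
  assumes G: "weighted_graph G" and sh: "theta_shape G u v [] [x] [z1, z2]"
  shows "\<exists>a b c. is_theta G 1 0 2 a b c"
proof -
  have dist: "distinct [u, v, x, z1, z2]" and V: "verts G = {u, v, x, z1, z2}"
    and E: "edges G = {{u, v}, {u, x}, {x, v}, {u, z1}, {z1, z2}, {z2, v}}"
    using sh unfolding theta_shape_def by auto
  have pos: "0 < wt G e" if "e \<in> {{u, v}, {u, x}, {x, v}, {u, z1}, {z1, z2}, {z2, v}}" for e
    using edge_weight_pos[OF G] that unfolding E .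
  define a where "a = (!) [0, wt G {u, x}, wt G {x, v}]"
  define b where "b = (\<lambda>_::nat. wt G {u, v})"
  define c where "c = (!) [0, wt G {u, z1}, wt G {z1, z2}, wt G {z2, v}]"
  have "wgraph_iso G (theta_graph 1 0 2 a b c)"
    unfolding theta_1_0_2_eq
    by (rule wgraph_iso_wgraph_of_list[where vs = "[TU, TV, TX 1, TZ 1, TZ 2]" and g = "case_theta_vertex u v (\<lambda>_. x) (\<lambda>_. u) ((!) [z1, z1, z2])"])
      (use dist V in \<open>auto simp: E a_def b_def c_def\<close>)
  moreover have "pos_weights 2 a" "pos_weights 1 b" "pos_weights 3 c"
    by (simp_all add: pos_weights_small a_def b_def c_def pos)
  ultimately show ?thesis unfolding is_theta_def theta_weight_counts by blast
qed

lemma is_theta_2_0_2I: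
  assumes G: "weighted_graph G" and sh: "theta_shape G u v [] [x1, x2] [z1, z2]"
  shows "\<exists>a b c. is_theta G 2 0 2 a b c"
proof -
  have dist: "distinct [u, v, x1, x2, z1, z2]" and V: "verts G = {u, v, x1, x2, z1, z2}"
    and E: "edges G = {{u, v}, {u, x1}, {x1, x2}, {x2, v}, {u, z1}, {z1, z2}, {z2, v}}"
    using sh unfolding theta_shape_def by auto
  have pos: "0 < wt G e" if "e \<in> {{u, v}, {u, x1}, {x1, x2}, {x2, v}, {u, z1}, {z1, z2}, {z2, v}}" for e
    using edge_weight_pos[OF G] that unfolding E .
  define a where "a = (!) [0, wt G {u, x1}, wt G {x1, x2}, wt G {x2, v}]"
  define b where "b = (\<lambda>_::nat. wt G {u, v})"
  define c where "c = (!) [0, wt G {u, z1}, wt G {z1, z2}, wt G {z2, v}]"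
  have "wgraph_iso G (theta_graph 2 0 2 a b c)"
    unfolding theta_2_0_2_eq
    by (rule wgraph_iso_wgraph_of_list[where vs = "[TU, TV, TX 1, TX 2, TZ 1, TZ 2]" and g = "case_theta_vertex u v ((!) [x1, x1, x2]) (\<lambda>_. u) ((!) [z1, z1, z2])"])
      (use dist V in \<open>auto simp: E a_def b_def c_def\<close>)
  moreover have "pos_weights 3 a" "pos_weights 1 b" "pos_weights 3 c"
    by (simp_all add: pos_weights_small a_def b_def c_def pos)
  ultimately show ?thesis unfolding is_theta_def theta_weight_counts by blast
qed

section \<open>Case distinction on the lengths\<close>

lemma infty_shape_cases:
  assumes G: "weighted_graph G" and sh: "infty_shape G A D C"
    and len: "2 \<le> length A" "2 \<le> length C" and less: "i_plus G < 3"
  shows "(\<exists>a b c. is_infty G 3 1 3 a b c) \<or> (\<exists>a b c. is_infty G 3 2 3 a b c)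
    \<or> (\<exists>a b c. is_infty G 3 1 4 a b c) \<or> (\<exists>a b c. is_infty G 4 1 4 a b c)"
proof -
  \<comment> \<open>By the symmetry of the shape \<open>A\<close> may be taken as the longer
    interior. A cycle of length p has an interior of length p - 1.\<close>
  have main: "(\<exists>a b c. is_infty G 3 1 3 a b c) \<or> (\<exists>a b c. is_infty G 3 2 3 a b c)
      \<or> (\<exists>a b c. is_infty G 3 1 4 a b c) \<or> (\<exists>a b c. is_infty G 4 1 4 a b c)"
    if sh: "infty_shape G A D C" and len: "2 \<le> length C" "length C \<le> length A" for A D C
  proof -
    obtain c0 c1 C' where C: "C = c0 # c1 # C'" using len(1) by (auto simp: numeral_2_eq_2 Suc_le_length_iff)
    obtain d0 D' where D: "D = d0 # D'" using sh unfolding infty_shape_def by (cases D) auto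
    have "\<not> 4 \<le> length A"
    proof
      assume "4 \<le> length A"
      then obtain a0 a1 a2 a3 A' where "A = a0 # a1 # a2 # a3 # A'"
        by (auto simp: eval_nat_numeral Suc_le_length_iff)
      then show False using infty_three_le_i_plus_5[OF G] sh less unfolding C by fastforce
    qed
    then consider "length A = 3" | "length A = 2" using len by linarith
    then show ?thesis
    proof cases
      case 1
      then obtain a0 a1 a2 where A: "A = [a0, a1, a2]" by (auto simp: eval_nat_numeral length_Suc_conv)
      have D': "D' = []"
        using infty_three_le_i_plus_4[OF G, of a0 a1 a2 d0 _ _ c0 c1 C'] sh less
        unfolding A C D by (cases D') auto
      \<comment> \<open>The family (3,1,4) names its shorter cycle first, whereas here the longer
        one is in front.\<close>
      have sh': "infty_shape G C [d0] A" using infty_shape_swap[OF sh] unfolding D D' by simp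
      have "length C = 2 \<or> length C = 3" using len 1 by linarith
      then show ?thesis
      proof
        assume "length C = 2"
        then show ?thesis using is_infty_3_1_4I[OF G, of c0 c1] sh' unfolding C A by simp
      next
        assume "length C = 3"
        then obtain c2 where "C' = [c2]" unfolding C by (auto simp: eval_nat_numeral length_Suc_conv)
        then show ?thesis using is_infty_4_1_4I[OF G, of c0 c1 c2] sh' unfolding C A by simp
      qed
    next
      case 2
      then obtain a0 a1 where A: "A = [a0, a1]" by (auto simp: eval_nat_numeral length_Suc_conv)
      have C': "C' = []" using len(2) 2 unfolding C by simp
      show ?thesis
      proof (cases D')
        case Nil
        then show ?thesis using is_infty_3_1_3I[OF G, of a0 a1 d0 c0 c1] sh unfolding A C C' D by simp
      next
        case (Cons d1 D'')
        then have "D'' = []"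
          using infty_three_le_i_plus_3[OF G, of a0 a1 d0 d1 _ _ c0 c1 C'] sh less
          unfolding A C D by (cases D'') auto
        then show ?thesis
          using is_infty_3_2_3I[OF G, of a0 a1 d0 d1 c0 c1] sh Cons unfolding A C C' D by simp
      qed
    qed
  qed
  show ?thesis
    using main[OF sh] main[OF infty_shape_swap[OF sh]] len nat_le_linear[of "length A" "length C"]
    by blast
qed

lemma theta_shape_cases:
  assumes G: "weighted_graph G" and sh: "theta_shape G u v X Y Z"
    and ne: "X \<noteq> [] \<or> Y \<noteq> []" "X \<noteq> [] \<or> Z \<noteq> []" "Y \<noteq> [] \<or> Z \<noteq> []" and less: "i_plus G < 3"
  shows "(\<exists>a b c. is_theta G 1 1 1 a b c) \<or> (\<exists>a b c. is_theta G 1 0 1 a b c)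
    \<or> (\<exists>a b c. is_theta G 1 0 2 a b c) \<or> (\<exists>a b c. is_theta G 2 0 2 a b c)"
proof -
  \<comment> \<open>With the paths sorted by length only the shortest can be empty, which is
    recorded by \<open>Y \<noteq> []\<close>; the six orders are treated at the end by
    swapping.\<close>
  have main: "(\<exists>a b c. is_theta G 1 1 1 a b c) \<or> (\<exists>a b c. is_theta G 1 0 1 a b c)
      \<or> (\<exists>a b c. is_theta G 1 0 2 a b c) \<or> (\<exists>a b c. is_theta G 2 0 2 a b c)"
    if sh: "theta_shape G u v X Y Z" and len: "length X \<le> length Y" "length Y \<le> length Z" and ne: "Y \<noteq> []"
    for X Y Z
  proof -
    obtain y Y' where Y: "Y = y # Y'" using ne by (cases Y) auto
    have "\<not> 4 \<le> length Z"
    proof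
      assume "4 \<le> length Z"
      then obtain z1 z2 z3 z4 Z' where "Z = z1 # z2 # z3 # z4 # Z'"
        by (auto simp: eval_nat_numeral Suc_le_length_iff)
      then show False using theta_three_le_i_plus_4[OF G] sh less unfolding Y by fastforce
    qed
    moreover have "1 \<le> length Z" using len(2) unfolding Y by simp
    ultimately have Z4: "length Z = 1 \<or> length Z = 2 \<or> length Z = 3" by linarith
    have "length Z \<noteq> 3"
    proof
      assume Z3: "length Z = 3"
      then obtain z1 z2 z3 where Z: "Z = [z1, z2, z3]" by (auto simp: eval_nat_numeral length_Suc_conv)
      have "1 \<le> length Y" unfolding Y by simp
      then have "length Y = 1 \<or> length Y = 2 \<or> length Y = 3" using len(2) Z3 by linarith
      then consider "Y = [y]" | y2 where "Y = [y, y2]" | y2 y3 where "Y = [y, y2, y3]"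
        unfolding Y by (auto simp: eval_nat_numeral length_Suc_conv)
      then have "3 \<le> i_plus G"
      proof cases
        case 1
        then show ?thesis using theta_three_le_i_plus_1_3[OF G] sh unfolding Z by blast
      next
        case 2
        then show ?thesis using theta_three_le_i_plus_2_3[OF G] sh unfolding Z by blast
      next
        case 3
        then show ?thesis using theta_three_le_i_plus_3_3[OF G] sh unfolding Z by blast
      qed
      then show False using less by simp
    qed
    then consider "length Z = 1" | "length Z = 2" using Z4 by blast
    then show ?thesis
    proof cases
      case 1
      then obtain z where Z: "Z = [z]" by (auto simp: length_Suc_conv)
      have Y': "Y' = []" using len(2) unfolding Z Y by simp
      show ?thesis
      proof (cases X)
        case Nil
        then show ?thesis using is_theta_1_0_1I[OF G, of u v y z] sh unfolding Y Y' Z by simp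
      next
        case (Cons x X')
        then have "X = [x]" using len(1) unfolding Y Y' by simp
        then show ?thesis using is_theta_1_1_1I[OF G, of u v x y z] sh unfolding Y Y' Z by simp
      qed
    next
      case 2
      then obtain z1 z2 where Z: "Z = [z1, z2]" by (auto simp: eval_nat_numeral length_Suc_conv)
      have "1 \<le> length Y" unfolding Y by simp
      then have "length Y = 1 \<or> length Y = 2" using len(2) 2 by linarith
      then consider "Y = [y]" | y2 where "Y = [y, y2]"
        unfolding Y by (auto simp: eval_nat_numeral length_Suc_conv)
      then show ?thesis
      proof cases
        case 1
        show ?thesis
        proof (cases X)
          case Nil
          then show ?thesis using is_theta_1_0_2I[OF G, of u v y z1 z2] sh 1 unfolding Z by simp
        next
          case (Cons x X')
          then have "X = [x]" using len(1) 1 by simp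
          then show ?thesis using theta_three_le_i_plus_1_1_2[OF G] sh 1 less unfolding Z by fastforce
        qed
      next
        case 2
        have "length Y = 2" using 2 by simp
        then have "length X = 0 \<or> length X = 1 \<or> length X = 2" using len(1) by linarith
        then consider "X = []" | x where "X = [x]" | x1 x2 where "X = [x1, x2]"
          by (auto simp: eval_nat_numeral length_Suc_conv)
        then show ?thesis
        proof cases
          case 1
          then show ?thesis using is_theta_2_0_2I[OF G, of u v y y2 z1 z2] sh 2 unfolding Z by simp
        next
          case 2
          then show ?thesis
            using theta_three_le_i_plus_1_2_2[OF G] sh \<open>Y = [y, y2]\<close> less unfolding Z by fastforce
        next
          case 3
          then show ?thesis
            using theta_three_le_i_plus_2_2_2[OF G] sh \<open>Y = [y, y2]\<close> less unfolding Z by fastforce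
        qed
      qed
    qed
  qed
  note s12 = theta_shape_swap12 and s23 = theta_shape_swap23
  consider "length X \<le> length Y \<and> length Y \<le> length Z" | "length X \<le> length Z \<and> length Z \<le> length Y"
    | "length Y \<le> length X \<and> length X \<le> length Z" | "length Y \<le> length Z \<and> length Z \<le> length X"
    | "length Z \<le> length X \<and> length X \<le> length Y" | "length Z \<le> length Y \<and> length Y \<le> length X"
    by linarith
  then show ?thesis
  proof cases
    case 1
    then show ?thesis using ne by (intro main[OF sh]) auto
  next
    case 2
    then show ?thesis using ne by (intro main[OF s23[OF sh]]) auto
  next
    case 3
    then show ?thesis using ne by (intro main[OF s12[OF sh]]) auto
  next
    case 4
    then show ?thesis using ne by (intro main[OF s23[OF s12[OF sh]]]) auto
  next
    case 5
    then show ?thesis using ne by (intro main[OF s12[OF s23[OF sh]]]) auto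
  next
    case 6
    then show ?thesis using ne by (intro main[OF s12[OF s23[OF s12[OF sh]]]]) auto
  qed
qed

theorem theorem4p3:
  fixes G :: "'a wgraph"
  assumes "bicyclic G"
    and "\<not> (\<exists>x. pendant G x)"
  shows "i_plus G = 2 \<longleftrightarrow>
    (\<exists>a b c. is_infty G 3 1 3 a b c) \<or>
    (\<exists>a b c. is_infty G 3 2 3 a b c \<and>
       4 * a 1 * a 3 * b 1 * b 3 - a 2 * b 2 * (c 1)^2 \<ge> 0) \<or>
    (\<exists>a b c. is_infty G 3 1 4 a b c \<and> b 1 * b 3 = b 2 * b 4) \<or>
    (\<exists>a b c. is_infty G 4 1 4 a b c \<and> a 1 * a 3 = a 2 * a 4 \<and> b 1 * b 3 = b 2 * b 4) \<or>
    (\<exists>a b c. is_theta G 1 1 1 a b c \<and> (a 2 * b 1 \<noteq> a 1 * b 2 \<or> a 2 * c 1 \<noteq> a 1 * c 2)) \<or>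
    (\<exists>a b c. is_theta G 1 0 1 a b c \<and> a 2 * c 1 \<noteq> a 1 * c 2) \<or>
    (\<exists>a b c. is_theta G 1 0 2 a b c \<and> b 1 * c 2 \<ge> c 1 * c 3) \<or>
    (\<exists>a b c. is_theta G 2 0 2 a b c \<and>
       a 2 * b 1 * c 2 = a 1 * a 3 * c 2 + a 2 * c 1 * c 3)"
proof -
  have G: "weighted_graph G" using assms(1) unfolding bicyclic_def by simp
  note iso = i_plus_iso[OF finite_verts[OF G]]
  have i313: "i_plus G = 2" if "is_infty G 3 1 3 a b c" for a b c
    using that iso i_plus_infty_3_1_3 unfolding is_infty_def by metis
  have i323: "i_plus G = 2 \<longleftrightarrow> 4 * a 1 * a 3 * b 1 * b 3 - a 2 * b 2 * (c 1)^2 \<ge> 0"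
    if "is_infty G 3 2 3 a b c" for a b c
  proof -
    have "pos_weights 1 c" using that unfolding is_infty_def by simp
    then show ?thesis using that iso i_plus_infty_3_2_3 unfolding is_infty_def by metis
  qed
  have i314: "i_plus G = 2 \<longleftrightarrow> b 1 * b 3 = b 2 * b 4" if "is_infty G 3 1 4 a b c" for a b c
    using that iso i_plus_infty_3_1_4 unfolding is_infty_def by metis
  have i414: "i_plus G = 2 \<longleftrightarrow> a 1 * a 3 = a 2 * a 4 \<and> b 1 * b 3 = b 2 * b 4"
    if "is_infty G 4 1 4 a b c" for a b c
    using that iso i_plus_infty_4_1_4 unfolding is_infty_def by metis
  have t111: "i_plus G = 2 \<longleftrightarrow> a 2 * b 1 \<noteq> a 1 * b 2 \<or> a 2 * c 1 \<noteq> a 1 * c 2"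
    if "is_theta G 1 1 1 a b c" for a b c
    using that iso i_plus_theta_1_1_1 unfolding is_theta_def theta_weight_counts by metis
  have t101: "i_plus G = 2 \<longleftrightarrow> a 2 * c 1 \<noteq> a 1 * c 2" if "is_theta G 1 0 1 a b c" for a b c
    using that iso i_plus_theta_1_0_1 unfolding is_theta_def theta_weight_counts by metis
  have t102: "i_plus G = 2 \<longleftrightarrow> b 1 * c 2 \<ge> c 1 * c 3" if "is_theta G 1 0 2 a b c" for a b c
    using that iso i_plus_theta_1_0_2 unfolding is_theta_def theta_weight_counts by metis
  have t202: "i_plus G = 2 \<longleftrightarrow> a 2 * b 1 * c 2 = a 1 * a 3 * c 2 + a 2 * c 1 * c 3"
    if "is_theta G 2 0 2 a b c" for a b c
    using that iso i_plus_theta_2_0_2 unfolding is_theta_def theta_weight_counts by metis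
  \<comment> \<open>A graph may match a family under several labellings with different weights. Each
    family result is an equivalence, so every labelling gives the same verdict, and the existential
    condition reduces to \<open>i_plus G = 2\<close> together with membership in the family.\<close>
  have ex3: "(\<exists>a b c. P a b c \<and> Q a b c) \<longleftrightarrow> i_plus G = 2 \<and> (\<exists>a b c. P a b c)"
    if "\<And>a b c. P a b c \<Longrightarrow> i_plus G = 2 \<longleftrightarrow> Q a b c"
    for P Q :: "(nat \<Rightarrow> real) \<Rightarrow> (nat \<Rightarrow> real) \<Rightarrow> (nat \<Rightarrow> real) \<Rightarrow> bool"
    using that by metis
  have shape: "(\<exists>a b c. is_infty G 3 1 3 a b c) \<or> (\<exists>a b c. is_infty G 3 2 3 a b c)
    \<or> (\<exists>a b c. is_infty G 3 1 4 a b c) \<or> (\<exists>a b c. is_infty G 4 1 4 a b c)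
    \<or> (\<exists>a b c. is_theta G 1 1 1 a b c) \<or> (\<exists>a b c. is_theta G 1 0 1 a b c)
    \<or> (\<exists>a b c. is_theta G 1 0 2 a b c) \<or> (\<exists>a b c. is_theta G 2 0 2 a b c)"
    if two: "i_plus G = 2"
  proof -
    have less: "i_plus G < 3" using two by simp
    from assms show ?thesis
    proof (cases rule: bicyclic_shape)
      case (infty A D C)
      from infty_shape_cases[OF G infty less] show ?thesis by argo
    next
      case (theta u v X Y Z)
      from theta_shape_cases[OF G theta less] show ?thesis by argo
    qed
  qed
  have e323: "(\<exists>a b c. is_infty G 3 2 3 a b c \<and>
      4 * a 1 * a 3 * b 1 * b 3 - a 2 * b 2 * (c 1)^2 \<ge> 0)
      \<longleftrightarrow> i_plus G = 2 \<and> (\<exists>a b c. is_infty G 3 2 3 a b c)"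
    by (rule ex3) (rule i323)
  have e314: "(\<exists>a b c. is_infty G 3 1 4 a b c \<and>
      b 1 * b 3 = b 2 * b 4)
      \<longleftrightarrow> i_plus G = 2 \<and> (\<exists>a b c. is_infty G 3 1 4 a b c)"
    by (rule ex3) (rule i314)
  have e414: "(\<exists>a b c. is_infty G 4 1 4 a b c \<and>
      a 1 * a 3 = a 2 * a 4 \<and> b 1 * b 3 = b 2 * b 4)
      \<longleftrightarrow> i_plus G = 2 \<and> (\<exists>a b c. is_infty G 4 1 4 a b c)"
    by (rule ex3) (rule i414)
  have e111: "(\<exists>a b c. is_theta G 1 1 1 a b c \<and>
      (a 2 * b 1 \<noteq> a 1 * b 2 \<or> a 2 * c 1 \<noteq> a 1 * c 2))
      \<longleftrightarrow> i_plus G = 2 \<and> (\<exists>a b c. is_theta G 1 1 1 a b c)"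
    by (rule ex3) (rule t111)
  have e101: "(\<exists>a b c. is_theta G 1 0 1 a b c \<and>
      a 2 * c 1 \<noteq> a 1 * c 2)
      \<longleftrightarrow> i_plus G = 2 \<and> (\<exists>a b c. is_theta G 1 0 1 a b c)"
    by (rule ex3) (rule t101)
  have e102: "(\<exists>a b c. is_theta G 1 0 2 a b c \<and>
      b 1 * c 2 \<ge> c 1 * c 3)
      \<longleftrightarrow> i_plus G = 2 \<and> (\<exists>a b c. is_theta G 1 0 2 a b c)"
    by (rule ex3) (rule t102)
  have e202: "(\<exists>a b c. is_theta G 2 0 2 a b c \<and>
      a 2 * b 1 * c 2 = a 1 * a 3 * c 2 + a 2 * c 1 * c 3)
      \<longleftrightarrow> i_plus G = 2 \<and> (\<exists>a b c. is_theta G 2 0 2 a b c)"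
    by (rule ex3) (rule t202)
  have "(\<exists>a b c. is_infty G 3 1 3 a b c) \<Longrightarrow> i_plus G = 2" using i313 by blast
  then show ?thesis
    unfolding e323 e314 e414 e111 e101 e102 e202 using shape by argo
qed

end
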